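(* Let $\mathcal{F}$ be any set of complex-valued constraints. If $\mathcal{F}\subseteq \mathcal{ED}$, then $\#\mathrm{CSP}^{*}(\mathcal{F})$ is computable deterministically in polynomial time (it belongs to $\mathrm{FP}_{\mathbb{C}}$). Otherwise, $\#\mathrm{SAT}_{\mathbb{C}} \le_{AP} \#\mathrm{CSP}^{*}(\mathcal{F})$.
   Context: A (complex-valued) constraint of arity $k\ge 1$ is a function $f:\{0,1\}^k\to\mathbb{C}$. Binary constraints are written $(f(00),f(01),f(10),f(11))$; symmetric constraints (value depends only on the Hamming weight $i$ of the input) are written $[f_0,\dots,f_k]$. Let $EQ=[1,0,1]$, $XOR=[0,1,0]$, and let $\mathcal{U}$ be the set of all unary constraints. For a set $\mathcal{F}$ of constraints, $\#\mathrm{CSP}(\mathcal{F})$ is the problem: given Boolean variables $x_1,\dots,x_n$ and a finite list of pairs $(h,(x_{i_1},\dots,x_{i_k}))$ with $h\in\mathcal{F}$ of arity $k$, output $\sum_{\sigma:\{x_1,\dots,x_n\}\to\{0,1\}}\prod h(\sigma(x_{i_1}),\dots,\sigma(x_{i_k}))$, the product over all pairs in the list. $\#\mathrm{CSP}^*(\mathcal{F})$ denotes $\#\mathrm{CSP}(\mathcal{F}\cup\mathcal{U})$. Complex numbers are treated as atomic objects, arithmetic operations on them costing unit time; $\mathrm{FP}_{\mathbb{C}}$ is the class of complex-valued functions computable deterministically in polynomial time in this model. $\mathcal{ED}$ is the set of constraints $f$ of arity $k\ge1$ for which there are $\ell_1,\ell_2\ge0$ with $\ell_1+\ell_2\ge1$,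 unary constraints $h_1,\dots,h_{\ell_1}$, constraints $g_1,\dots,g_{\ell_2}\in\{EQ,XOR\}$ and indices $j_i,m_i,n_i\in[k]$ with $f(x_1,\dots,x_k)=\prod_{i=1}^{\ell_1}h_i(x_{j_i})\prod_{i=1}^{\ell_2}g_i(x_{m_i},x_{n_i})$ for all inputs. $\#\mathrm{SAT}_{\mathbb{C}}$: given a propositional formula $\phi$ (connectives $\neg,\vee,\wedge$) with variable set $V(\phi)$ and functions $w_x:\{0,1\}\to\mathbb{C}\setminus\{0\}$ for $x\in V(\phi)$, output $\sum_{\sigma}\prod_{x\in V(\phi)}w_x(\sigma(x))$, summed over truth assignments $\sigma$ satisfying $\phi$. Approximation: for $\epsilon\in(0,1)$, $w$ is a $2^\epsilon$-approximate solution for $A\in\mathbb{C}$ if either $A=0$ and $w=0$, or $A\neq0$, $2^{-\epsilon}\le|w/A|\le2^{\epsilon}$ and $|\arg(w/A)|\le\epsilon$ (with $\arg\in(-\pi,\pi]$). A randomized approximation scheme for $F:\Sigma^*\to\mathbb{C}$ is a randomized algorithm that on input $(x,\epsilon)$ outputs a $2^\epsilon$-approximate solution for $F(x)$ with probability at least $3/4$. An AP-reduction from $F$ to $G$ (written $F\le_{AP}G$) is a randomized algorithm that, using an arbitrary randomized approximation scheme $M$ for $G$ as an oracle, is a randomized approximation scheme for $F$, makes only oracle queries $(w,\delta)$ with $1/\delta\le p(|x|,1/\epsilon)$ for a fixed polynomial $p$, and runs in time polynomial in $(|x|,1/\epsilon)$ independently of $M$. *)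

theory Defs
  imports "HOL-Probability.Probability" "HOL-Computational_Algebra.Polynomial"
begin

section \<open>Constraints\<close>

text \<open>A constraint is its arity together with a function on Boolean tuples, written as lists; only
  the values on lists whose length is the arity matter.\<close>

type_synonym constraint = "nat \<times> (bool list \<Rightarrow> complex)"

abbreviation arity :: "constraint \<Rightarrow> nat" where "arity h \<equiv> fst h"
abbreviation app :: "constraint \<Rightarrow> bool list \<Rightarrow> complex" where "app h \<equiv> snd h"

definition constraints :: "constraint set" where
  "constraints = {h. 1 \<le> arity h}"

definition unary :: "constraint set" where
  "unary = {h. arity h = 1}"

definition EQ :: constraint where
  "EQ = (2, \<lambda>x. if x ! 0 = x ! 1 then 1 else 0)"

definition XOR :: constraint where
  "XOR = (2, \<lambda>x. if x ! 0 \<noteq> x ! 1 then 1 else 0)"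

definition ED :: "constraint set" where
  "ED = {f \<in> constraints. \<exists>l1 l2 h g j m n.
      l1 + l2 \<ge> (1::nat) \<and>
      (\<forall>i<l1. h i \<in> unary \<and> j i < arity f) \<and>
      (\<forall>i<l2. g i \<in> {EQ, XOR} \<and> m i < arity f \<and> n i < arity f) \<and>
      (\<forall>x. length x = arity f \<longrightarrow>
         app f x = (\<Prod>i<l1. app (h i) [x ! j i]) * (\<Prod>i<l2. app (g i) [x ! m i, x ! n i]))}"


section \<open>A model of computation with atomic complex numbers\<close>

text \<open>Programs are imperative, with finitely many variables holding binary trees whose leaves are
  complex numbers or \<open>Null\<close>. Every command counts one step; in particular allocating and reading a
  cell, an arithmetic operation on complex numbers and a test each take unit time (a program
  contains only finitely many expressions, of fixed size). Discrete data are trees as well, so the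
  size of a tree plays the role of the length of an input string.\<close>

datatype val = Num complex | Null | Cell val val

primrec vsize :: "val \<Rightarrow> nat" where
  "vsize (Num z) = 1"
| "vsize Null = 1"
| "vsize (Cell a b) = 1 + vsize a + vsize b"

primrec num :: "val \<Rightarrow> complex" where
  "num (Num z) = z"
| "num Null = 0"
| "num (Cell a b) = 0"

primrec left :: "val \<Rightarrow> val" where
  "left (Num z) = Null"
| "left Null = Null"
| "left (Cell a b) = a"

primrec right :: "val \<Rightarrow> val" where
  "right (Num z) = Null"
| "right Null = Null"
| "right (Cell a b) = b"

datatype exp =
    Var nat
  | Const complex
  | Empty
  | Mk exp exp
  | Fst exp
  | Snd exp
  | Add exp exp
  | Sub exp exp
  | Mult exp exp
  | Div exp exp

datatype test =
    IsNum exp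
  | IsCell exp
  | Equal exp exp
  | Less exp exp

datatype com =
    Skip
  | Assign nat exp
  | Seq com com
  | Cond test com com
  | While test com
  | Flip nat
  | Query nat exp exp

type_synonym store = "nat \<Rightarrow> val"

primrec eval_exp :: "exp \<Rightarrow> store \<Rightarrow> val" where
  "eval_exp (Var i) s = s i"
| "eval_exp (Const z) s = Num z"
| "eval_exp Empty s = Null"
| "eval_exp (Mk a b) s = Cell (eval_exp a s) (eval_exp b s)"
| "eval_exp (Fst a) s = left (eval_exp a s)"
| "eval_exp (Snd a) s = right (eval_exp a s)"
| "eval_exp (Add a b) s = Num (num (eval_exp a s) + num (eval_exp b s))"
| "eval_exp (Sub a b) s = Num (num (eval_exp a s) - num (eval_exp b s))"
| "eval_exp (Mult a b) s = Num (num (eval_exp a s) * num (eval_exp b s))"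
| "eval_exp (Div a b) s = Num (num (eval_exp a s) / num (eval_exp b s))"

text \<open>\<open>Less\<close> compares real parts. It lets a randomized algorithm make use of its real accuracy
  parameter; deterministic computations over the complex numbers (\<open>FP_C\<close> below) only get the
  equality test.\<close>

primrec eval_test :: "test \<Rightarrow> store \<Rightarrow> bool" where
  "eval_test (IsNum a) s \<longleftrightarrow> (\<exists>z. eval_exp a s = Num z)"
| "eval_test (IsCell a) s \<longleftrightarrow> (\<exists>u v. eval_exp a s = Cell u v)"
| "eval_test (Equal a b) s \<longleftrightarrow> num (eval_exp a s) = num (eval_exp b s)"
| "eval_test (Less a b) s \<longleftrightarrow> Re (num (eval_exp a s)) < Re (num (eval_exp b s))"

text \<open>A configuration is the stack of commands still to be executed and the store. An oracle maps a
  query and an accuracy to a distribution of answers, and each call draws a fresh answer. As trees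
  may share subtrees, asking a query \<open>w\<close> is charged \<open>vsize w\<close> additional steps, the cost of writing
  it out.\<close>

type_synonym config = "com list \<times> store"
type_synonym oracle_fun = "val \<Rightarrow> real \<Rightarrow> complex pmf"

fun step :: "oracle_fun \<Rightarrow> config \<Rightarrow> config pmf" where
  "step M ([], s) = return_pmf ([], s)"
| "step M (Skip # K, s) = return_pmf (K, s)"
| "step M (Assign x e # K, s) = return_pmf (K, s(x := eval_exp e s))"
| "step M (Seq c d # K, s) = return_pmf (c # d # K, s)"
| "step M (Cond b c d # K, s) = return_pmf ((if eval_test b s then c else d) # K, s)"
| "step M (While b c # K, s) =
     return_pmf (if eval_test b s then (c # While b c # K, s) else (K, s))"
| "step M (Flip x # K, s) =
     map_pmf (\<lambda>b. (K, s(x := Num (of_bool b)))) (bernoulli_pmf (1/2))"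
| "step M (Query x a d # K, s) =
     map_pmf (\<lambda>z. (replicate (vsize (eval_exp a s)) Skip @ K, s(x := Num z)))
       (M (eval_exp a s) (Re (num (eval_exp d s))))"

primrec run :: "oracle_fun \<Rightarrow> nat \<Rightarrow> config \<Rightarrow> config pmf" where
  "run M 0 C = return_pmf C"
| "run M (Suc n) C = bind_pmf (step M C) (run M n)"

definition init :: "com \<Rightarrow> val \<Rightarrow> config" where
  "init c v = ([c], (\<lambda>_. Null)(0 := v))"

definition halted :: "config \<Rightarrow> bool" where
  "halted C \<longleftrightarrow> fst C = []"

definition result :: "config \<Rightarrow> complex" where
  "result C = num (snd C 0)"

fun pending_query :: "config \<Rightarrow> (val \<times> real) option" where
  "pending_query (Query x a d # K, s) = Some (eval_exp a s, Re (num (eval_exp d s)))"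
| "pending_query _ = None"

primrec oracle_free :: "com \<Rightarrow> bool" where
  "oracle_free Skip \<longleftrightarrow> True"
| "oracle_free (Assign x e) \<longleftrightarrow> True"
| "oracle_free (Seq c d) \<longleftrightarrow> oracle_free c \<and> oracle_free d"
| "oracle_free (Cond b c d) \<longleftrightarrow> oracle_free c \<and> oracle_free d"
| "oracle_free (While b c) \<longleftrightarrow> oracle_free c"
| "oracle_free (Flip x) \<longleftrightarrow> True"
| "oracle_free (Query x a d) \<longleftrightarrow> False"

primrec order_free :: "test \<Rightarrow> bool" where
  "order_free (IsNum a) \<longleftrightarrow> True"
| "order_free (IsCell a) \<longleftrightarrow> True"
| "order_free (Equal a b) \<longleftrightarrow> True"
| "order_free (Less a b) \<longleftrightarrow> False"

primrec deterministic :: "com \<Rightarrow> bool" where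
  "deterministic Skip \<longleftrightarrow> True"
| "deterministic (Assign x e) \<longleftrightarrow> True"
| "deterministic (Seq c d) \<longleftrightarrow> deterministic c \<and> deterministic d"
| "deterministic (Cond b c d) \<longleftrightarrow> order_free b \<and> deterministic c \<and> deterministic d"
| "deterministic (While b c) \<longleftrightarrow> order_free b \<and> deterministic c"
| "deterministic (Flip x) \<longleftrightarrow> False"
| "deterministic (Query x a d) \<longleftrightarrow> False"

text \<open>Placeholder for programs that ask no queries.\<close>

definition no_oracle :: oracle_fun where
  "no_oracle = (\<lambda>_ _. return_pmf 0)"


section \<open>Complexity notions\<close>

text \<open>A problem is the graph of a complex-valued function defined on the trees that encode its
  instances; nothing is required of an algorithm on other trees.\<close>

type_synonym problem = "(val \<times> complex) set"

definition FP_C :: "problem set" where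
  "FP_C = {P. \<exists>c (p :: real poly). deterministic c \<and>
     (\<forall>(v, y) \<in> P. \<exists>n C. real n \<le> poly p (real (vsize v)) \<and>
        run no_oracle n (init c v) = return_pmf C \<and> halted C \<and> result C = y)}"

definition approx_solution :: "real \<Rightarrow> complex \<Rightarrow> complex \<Rightarrow> bool" where
  "approx_solution \<epsilon> A w \<longleftrightarrow>
     (A = 0 \<and> w = 0) \<or>
     (A \<noteq> 0 \<and> 2 powr (- \<epsilon>) \<le> cmod (w / A) \<and> cmod (w / A) \<le> 2 powr \<epsilon> \<and> \<bar>Arg (w / A)\<bar> \<le> \<epsilon>)"

definition with_accuracy :: "val \<Rightarrow> real \<Rightarrow> val" where
  "with_accuracy v \<epsilon> = Cell v (Num (complex_of_real \<epsilon>))"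

text \<open>The program halts almost surely, since the limits below are the weights of a \<open>pmf\<close>.\<close>

definition computes :: "com \<Rightarrow> val \<Rightarrow> complex pmf \<Rightarrow> bool" where
  "computes c v D \<longleftrightarrow>
     (\<forall>z. (\<lambda>n. measure_pmf.prob (run no_oracle n (init c v)) {C. halted C \<and> result C = z})
            \<longlonglongrightarrow> pmf D z)"

definition RAS :: "problem \<Rightarrow> oracle_fun \<Rightarrow> bool" where
  "RAS P M \<longleftrightarrow>
     (\<exists>c. oracle_free c \<and>
        (\<forall>v \<in> Domain P. \<forall>\<epsilon>. 0 < \<epsilon> \<and> \<epsilon> < 1 \<longrightarrow> computes c (with_accuracy v \<epsilon>) (M v \<epsilon>))) \<and>
     (\<forall>(v, y) \<in> P. \<forall>\<epsilon>. 0 < \<epsilon> \<and> \<epsilon> < 1 \<longrightarrow>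
        measure_pmf.prob (M v \<epsilon>) {w. approx_solution \<epsilon> y w} \<ge> 3/4)"

definition poly2 :: "real poly poly \<Rightarrow> real \<Rightarrow> real \<Rightarrow> real" where
  "poly2 p a b = poly (poly p [:a:]) b"

text \<open>The time bound \<open>t\<close> and the accuracy bound \<open>p\<close> are chosen before the oracle \<open>M\<close>, and both hold
  for every outcome of the coins and of the oracle's answers.\<close>

definition AP_reducible :: "problem \<Rightarrow> problem \<Rightarrow> bool" (infix "\<le>\<^sub>A\<^sub>P" 50) where
  "P \<le>\<^sub>A\<^sub>P Q \<longleftrightarrow>
     (\<exists>c (t :: real poly poly) (p :: real poly poly). \<forall>M. RAS Q M \<longrightarrow>
        (\<forall>(v, y) \<in> P. \<forall>\<epsilon>. 0 < \<epsilon> \<and> \<epsilon> < 1 \<longrightarrow>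
           (let C0 = init c (with_accuracy v \<epsilon>); s = real (vsize v) in
            (\<exists>n. real n \<le> poly2 t s (1 / \<epsilon>) \<and>
               (\<forall>C \<in> set_pmf (run M n C0). halted C) \<and>
               measure_pmf.prob (run M n C0) {C. approx_solution \<epsilon> y (result C)} \<ge> 3/4) \<and>
            (\<forall>n. \<forall>C \<in> set_pmf (run M n C0). \<forall>w \<delta>. pending_query C = Some (w, \<delta>) \<longrightarrow>
               w \<in> Domain Q \<and> 0 < \<delta> \<and> \<delta> < 1 \<and> 1 / \<delta> \<le> poly2 p s (1 / \<epsilon>)))))"


section \<open>Encodings\<close>

primrec enc_list :: "val list \<Rightarrow> val" where
  "enc_list [] = Null"
| "enc_list (v # vs) = Cell v (enc_list vs)"

definition enc_nat :: "nat \<Rightarrow> val" where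
  "enc_nat i = Num (of_nat i)"

text \<open>The truth table of a \<open>k\<close>-ary function, as the complete binary tree of its \<open>2 ^ k\<close> values.\<close>

primrec enc_table :: "nat \<Rightarrow> (bool list \<Rightarrow> complex) \<Rightarrow> val" where
  "enc_table 0 f = Num (f [])"
| "enc_table (Suc k) f =
     Cell (enc_table k (\<lambda>x. f (False # x))) (enc_table k (\<lambda>x. f (True # x)))"


section \<open>Counting constraint satisfaction problems\<close>

text \<open>The variables of an instance \<open>(n, cs)\<close> are the numbers below \<open>n\<close>.\<close>

type_synonym csp_instance = "nat \<times> (constraint \<times> nat list) list"

definition csp_instances :: "constraint set \<Rightarrow> csp_instance set" where
  "csp_instances F = {(n, cs).
     \<forall>(h, xs) \<in> set cs. h \<in> F \<and> length xs = arity h \<and> set xs \<subseteq> {..<n}}"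

definition csp_count :: "csp_instance \<Rightarrow> complex" where
  "csp_count I = (case I of (n, cs) \<Rightarrow>
     (\<Sum>\<sigma> \<in> {..<n} \<rightarrow>\<^sub>E (UNIV :: bool set). \<Prod>(h, xs)\<leftarrow>cs. app h (map \<sigma> xs)))"

text \<open>The variables are listed, so that their number counts towards the size, and each constraint
  is given by its truth table.\<close>

definition enc_csp :: "csp_instance \<Rightarrow> val" where
  "enc_csp I = (case I of (n, cs) \<Rightarrow>
     Cell (enc_list (map enc_nat [0..<n]))
       (enc_list (map (\<lambda>(h, xs). Cell (enc_table (arity h) (app h)) (enc_list (map enc_nat xs))) cs)))"

definition CSP :: "constraint set \<Rightarrow> problem" where
  "CSP F = (\<lambda>I. (enc_csp I, csp_count I)) ` csp_instances F"

definition CSP_star :: "constraint set \<Rightarrow> problem" where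
  "CSP_star F = CSP (F \<union> unary)"


section \<open>Weighted counting of satisfying assignments\<close>

datatype form = Prop nat | Neg form | Disj form form | Conj form form

primrec vars :: "form \<Rightarrow> nat set" where
  "vars (Prop x) = {x}"
| "vars (Neg a) = vars a"
| "vars (Disj a b) = vars a \<union> vars b"
| "vars (Conj a b) = vars a \<union> vars b"

primrec sat :: "(nat \<Rightarrow> bool) \<Rightarrow> form \<Rightarrow> bool" where
  "sat \<sigma> (Prop x) \<longleftrightarrow> \<sigma> x"
| "sat \<sigma> (Neg a) \<longleftrightarrow> \<not> sat \<sigma> a"
| "sat \<sigma> (Disj a b) \<longleftrightarrow> sat \<sigma> a \<or> sat \<sigma> b"
| "sat \<sigma> (Conj a b) \<longleftrightarrow> sat \<sigma> a \<and> sat \<sigma> b"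

type_synonym sat_instance = "form \<times> (nat \<Rightarrow> bool \<Rightarrow> complex)"

definition sat_instances :: "sat_instance set" where
  "sat_instances = {(\<phi>, w). \<forall>x \<in> vars \<phi>. \<forall>b. w x b \<noteq> 0}"

definition sat_count :: "sat_instance \<Rightarrow> complex" where
  "sat_count I = (case I of (\<phi>, w) \<Rightarrow>
     (\<Sum>\<sigma> | \<sigma> \<in> vars \<phi> \<rightarrow>\<^sub>E UNIV \<and> sat \<sigma> \<phi>. \<Prod>x \<in> vars \<phi>. w x (\<sigma> x)))"

primrec enc_form :: "form \<Rightarrow> val" where
  "enc_form (Prop x) = Cell (enc_nat 0) (enc_nat x)"
| "enc_form (Neg a) = Cell (enc_nat 1) (enc_form a)"
| "enc_form (Disj a b) = Cell (enc_nat 2) (Cell (enc_form a) (enc_form b))"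
| "enc_form (Conj a b) = Cell (enc_nat 3) (Cell (enc_form a) (enc_form b))"

text \<open>The weights are given as the list of triples \<open>x, w x False, w x True\<close>, in increasing order of
  the variable \<open>x\<close>.\<close>

definition enc_sat :: "sat_instance \<Rightarrow> val" where
  "enc_sat I = (case I of (\<phi>, w) \<Rightarrow>
     Cell (enc_form \<phi>)
       (enc_list (map (\<lambda>x. Cell (enc_nat x) (Cell (Num (w x False)) (Num (w x True))))
          (sorted_list_of_set (vars \<phi>)))))"

definition SAT_C :: problem where
  "SAT_C = (\<lambda>I. (enc_sat I, sat_count I)) ` sat_instances"


section \<open>The problems are functions of the encoded instance\<close>

lemma single_valued_graph:
  assumes "\<And>I J. I \<in> A \<Longrightarrow> J \<in> A \<Longrightarrow> e I = e J \<Longrightarrow> c I = c J"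
  shows "single_valued ((\<lambda>I. (e I, c I)) ` A)"
proof (rule single_valuedI)
  fix v y z
  assume "(v, y) \<in> (\<lambda>I. (e I, c I)) ` A" "(v, z) \<in> (\<lambda>I. (e I, c I)) ` A"
  then obtain I J where "I \<in> A" "J \<in> A" "v = e I" "v = e J" "y = c I" "z = c J"
    by (elim imageE) simp
  then show "y = z"
    using assms by metis
qed

lemma enc_list_inject: "enc_list us = enc_list vs \<Longrightarrow> us = vs"
proof (induction us arbitrary: vs)
  case Nil
  then show ?case by (cases vs) auto
next
  case (Cons a us)
  then show ?case by (cases vs) auto
qed

lemma enc_nat_inject: "enc_nat i = enc_nat j \<longleftrightarrow> i = j"
  by (simp add: enc_nat_def)

lemma enc_nats_inject: "enc_list (map enc_nat xs) = enc_list (map enc_nat ys) \<Longrightarrow> xs = ys"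
  by (drule enc_list_inject, erule map_injective) (simp add: inj_def enc_nat_inject)

lemma enc_table_inject:
  "enc_table k f = enc_table k g \<Longrightarrow> length x = k \<Longrightarrow> f x = g x"
proof (induction k arbitrary: f g x)
  case 0
  then show ?case by simp
next
  case (Suc k)
  then obtain b y where x: "x = b # y" "length y = k"
    by (auto simp: length_Suc_conv)
  show ?case
    using Suc.IH[of "\<lambda>x. f (b # x)" "\<lambda>x. g (b # x)" y] Suc.prems(1) x by (cases b) auto
qed

lemma CSP_single_valued: "single_valued (CSP F)"
proof -
  have *: "csp_count I = csp_count J"
    if I: "I \<in> csp_instances F" and J: "J \<in> csp_instances F" and e: "enc_csp I = enc_csp J" for I J
  proof -
    obtain n cs m ds where IJ: "I = (n, cs)" "J = (m, ds)"
      by (cases I, cases J) auto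
    let ?e = "\<lambda>(h, xs). Cell (enc_table (arity h) (app h)) (enc_list (map enc_nat xs))"
    have "[0..<n] = [0..<m]"
      by (rule enc_nats_inject) (use e in \<open>simp add: IJ enc_csp_def\<close>)
    then have nm: "n = m"
      by (metis length_upt diff_zero)
    have "map ?e cs = map ?e ds"
      by (rule enc_list_inject) (use e in \<open>simp add: IJ enc_csp_def\<close>)
    then have "map (\<lambda>(h, xs). app h (map \<sigma> xs)) cs = map (\<lambda>(h, xs). app h (map \<sigma> xs)) ds"
      for \<sigma> :: "nat \<Rightarrow> bool"
      using I J unfolding IJ
    proof (induction cs arbitrary: ds)
      case Nil
      then show ?case by simp
    next
      case (Cons a cs)
      then obtain b ds' where ds: "ds = b # ds'" by (cases ds) auto
      obtain h xs g ys where ab: "a = (h, xs)" "b = (g, ys)"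
        by (cases a, cases b) auto
      have xy: "xs = ys"
        by (rule enc_nats_inject) (use Cons.prems(1) in \<open>simp add: ds ab\<close>)
      have "arity h = length xs" "arity g = length xs"
        using Cons.prems(2,3) by (auto simp: csp_instances_def ds ab xy)
      with Cons.prems(1) have "app h (map \<sigma> xs) = app g (map \<sigma> ys)"
        by (auto simp: ds ab xy intro: enc_table_inject[of "length ys"])
      moreover have "map (\<lambda>(h, xs). app h (map \<sigma> xs)) cs = map (\<lambda>(h, xs). app h (map \<sigma> xs)) ds'"
        by (rule Cons.IH) (use Cons.prems in \<open>auto simp: csp_instances_def ds\<close>)
      ultimately show ?case by (simp add: ds ab)
    qed
    then show ?thesis by (simp add: IJ csp_count_def nm)
  qed
  show ?thesis
    unfolding CSP_def by (rule single_valued_graph) (fact *)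
qed

lemma enc_form_inject: "enc_form \<phi> = enc_form \<psi> \<Longrightarrow> \<phi> = \<psi>"
proof (induction \<phi> arbitrary: \<psi>)
  case (Prop x)
  then show ?case by (cases \<psi>) (auto simp: enc_nat_inject)
next
  case (Neg \<phi>)
  then show ?case by (cases \<psi>) (auto simp: enc_nat_inject)
next
  case (Disj \<phi>1 \<phi>2)
  then show ?case by (cases \<psi>) (auto simp: enc_nat_inject)
next
  case (Conj \<phi>1 \<phi>2)
  then show ?case by (cases \<psi>) (auto simp: enc_nat_inject)
qed

lemma finite_vars: "finite (vars \<phi>)"
  by (induction \<phi>) auto

lemma SAT_C_single_valued: "single_valued SAT_C"
proof -
  have *: "sat_count I = sat_count J" if e: "enc_sat I = enc_sat J" for I J
  proof -
    obtain \<phi> w \<psi> w' where IJ: "I = (\<phi>, w)" "J = (\<psi>, w')"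
      by (cases I, cases J) auto
    have f: "\<psi> = \<phi>"
      by (rule enc_form_inject[symmetric]) (use e in \<open>simp add: IJ enc_sat_def\<close>)
    let ?e = "\<lambda>w x. Cell (enc_nat x) (Cell (Num (w x False)) (Num (w x True)))"
    have "map (?e w) (sorted_list_of_set (vars \<phi>)) = map (?e w') (sorted_list_of_set (vars \<phi>))"
      by (rule enc_list_inject) (use e in \<open>simp add: IJ f enc_sat_def\<close>)
    then have "w x b = w' x b" if "x \<in> vars \<phi>" for x b
      using that by (cases b) (auto simp: finite_vars)
    then show ?thesis
      by (simp add: IJ f sat_count_def)
  qed
  show ?thesis
    unfolding SAT_C_def by (rule single_valued_graph, rule *)
qed

end

theory Submission
  imports Defs
begin

text \<open>A constraint is in \<open>ED\<close> iff it is a product of unary factors and factors tying two variables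
  by equality or disequality. Such a factorization can be read off the truth table by splitting off one
  variable after another, and the partition function is then computed by eliminating the variables:
  a variable tied to another one is replaced by it, and otherwise it only has unary factors.

  If a constraint of \<open>F\<close> is not in \<open>ED\<close>, then fixing, summing with generic weights and keeping just
  two of its variables gives a nonsingular binary function \<open>g\<close> with at least three nonzero values: for a
  suitable pair of variables neither the determinant nor the diagonal nor the antidiagonal of \<open>g\<close> vanishes
  identically as a polynomial in the weights. Because of the free complex unary weights, a few products
  \<open>g diag(a, b) g\<^sup>T\<close> and then sums over one auxiliary variable realize every Boolean gate exactly. So a
  formula is compiled gate by gate into an instance with the same value, and the oracle is asked only once,
  with the given accuracy.\<close>


section \<open>Factorable constraints\<close>

text \<open>One dichotomy serves both directions: the first variable of a factorable function either
  splits off or is tied to a later variable. The algorithm uses it to factor a table; the hardness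
  proof strips such variables until one is neither.

  The conditions imposed on \<open>g\<close> are witnessed by different weight vectors. Each is
  polynomial along every line in weight space, so a line through two witnesses contains a point good
  for both.

  That gates come out exactly and not only approximately rests on negative weights: cancellation
  creates the zero entry of an OR, and unary factors normalize the other entries. No scalar and no
  error remain to be controlled.

  On the machine side, \<open>Mk\<close> shares subtrees, so few steps can build a tree of
  exponential size; polynomial time composes only if output sizes are bounded along with the time.
  All functions on trees are total, whatever the shape of the input. Gadgets depend on
  \<open>F\<close> alone, so their tables and weights are constants in the text of the
  program.\<close>

inductive factorable :: "nat \<Rightarrow> (bool list \<Rightarrow> complex) \<Rightarrow> bool" for k where
  factorable_const: "factorable k (\<lambda>x. c)"
| factorable_unary: "j < k \<Longrightarrow> factorable k (\<lambda>x. h (x ! j))"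
| factorable_edge: "m < k \<Longrightarrow> n < k \<Longrightarrow> factorable k (\<lambda>x. of_bool ((x ! m = x ! n) = q))"
| factorable_mult: "factorable k f \<Longrightarrow> factorable k g \<Longrightarrow> factorable k (\<lambda>x. f x * g x)"
| factorable_cong: "factorable k f \<Longrightarrow> (\<And>x. length x = k \<Longrightarrow> f x = g x) \<Longrightarrow> factorable k g"

lemma factorable_prod: "(\<And>i. i < (l::nat) \<Longrightarrow> factorable k (g i)) \<Longrightarrow> factorable k (\<lambda>x. \<Prod>i<l. g i x)"
  by (induction l) (auto intro!: factorable_const factorable_mult simp: lessThan_Suc)

lemma app_EQ: "app EQ [a, b] = of_bool (a = b)" and app_XOR: "app XOR [a, b] = of_bool (a \<noteq> b)"
  by (auto simp: EQ_def XOR_def)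

lemma EQ_neq_XOR: "EQ \<noteq> XOR"
  using app_EQ[of True True] app_XOR[of True True] by force

lemma ED_imp_factorable:
  assumes "f \<in> ED"
  shows "factorable (arity f) (app f)"
proof -
  obtain l1 l2 :: nat and h g j m n where
    1: "\<forall>i<l1. h i \<in> unary \<and> j i < arity f" and
    2: "\<forall>i<l2. g i \<in> {EQ, XOR} \<and> m i < arity f \<and> n i < arity f" and
    3: "\<forall>x. length x = arity f \<longrightarrow>
         app f x = (\<Prod>i<l1. app (h i) [x ! j i]) * (\<Prod>i<l2. app (g i) [x ! m i, x ! n i])"
    using assms unfolding ED_def by (elim CollectE conjE exE) (rule that; assumption)
  have "factorable (arity f) (\<lambda>x. app (g i) [x ! m i, x ! n i])" if "i < l2" for i
  proof -
    have "(\<lambda>x. app (g i) [x ! m i, x ! n i]) = (\<lambda>x. of_bool ((x ! m i = x ! n i) = (g i = EQ)))"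
      using 2[rule_format, OF that] EQ_neq_XOR by (auto simp: app_EQ app_XOR fun_eq_iff)
    then show ?thesis
      using 2[rule_format, OF that] by (auto intro: factorable_edge)
  qed
  then have "factorable (arity f) (\<lambda>x. (\<Prod>i<l1. app (h i) [x ! j i]) * (\<Prod>i<l2. app (g i) [x ! m i, x ! n i]))"
    using 1 by (intro factorable_mult factorable_prod) (auto intro: factorable_unary[where h = "\<lambda>b. app (h i) [b]" for i])
  then show ?thesis
    by (rule factorable_cong) (simp add: 3)
qed

text \<open>Lists in place of indexed families make the product case an append. A constant becomes a
  constant unary constraint on variable \<open>0\<close>, which is where \<open>1 \<le> k\<close>
  enters; \<open>factorable\<close> itself also makes sense at arity 0, the base of later
  inductions.\<close>

lemma factorable_lists:
  assumes "factorable k f" "1 \<le> k"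
  shows "\<exists>us es. (\<forall>(h, j) \<in> set us. h \<in> unary \<and> j < k) \<and>
    (\<forall>(g, m, n) \<in> set es. g \<in> {EQ, XOR} \<and> m < k \<and> n < k) \<and>
    (\<forall>x. length x = k \<longrightarrow>
       f x = (\<Prod>(h, j)\<leftarrow>us. app h [x ! j]) * (\<Prod>(g, m, n)\<leftarrow>es. app g [x ! m, x ! n]))"
  using assms
proof (induction rule: factorable.induct)
  case (factorable_const c)
  then show ?case
    by (intro exI[of _ "[((1, \<lambda>_. c), 0)]"] exI[of _ "[]"]) (auto simp: unary_def)
next
  case (factorable_unary j h)
  then show ?case
    by (intro exI[of _ "[((1, \<lambda>x. h (hd x)), j)]"] exI[of _ "[]"]) (auto simp: unary_def)
next
  case (factorable_edge m n q)
  then show ?case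
    by (intro exI[of _ "[]"] exI[of _ "[(if q then EQ else XOR, m, n)]"]) (auto simp: EQ_def XOR_def)
next
  case (factorable_mult f g)
  then obtain us es us' es' where
    "\<forall>(h, j) \<in> set us. h \<in> unary \<and> j < k" "\<forall>(g, m, n) \<in> set es. g \<in> {EQ, XOR} \<and> m < k \<and> n < k"
    "\<forall>x. length x = k \<longrightarrow> f x = (\<Prod>(h, j)\<leftarrow>us. app h [x ! j]) * (\<Prod>(g, m, n)\<leftarrow>es. app g [x ! m, x ! n])"
    "\<forall>(h, j) \<in> set us'. h \<in> unary \<and> j < k" "\<forall>(g, m, n) \<in> set es'. g \<in> {EQ, XOR} \<and> m < k \<and> n < k"
    "\<forall>x. length x = k \<longrightarrow> g x = (\<Prod>(h, j)\<leftarrow>us'. app h [x ! j]) * (\<Prod>(g, m, n)\<leftarrow>es'. app g [x ! m, x ! n])"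
    by blast
  then show ?case
    by (intro exI[of _ "us @ us'"] exI[of _ "es @ es'"]) auto
next
  case (factorable_cong f g)
  then show ?case by simp
qed

lemma ED_iff_factorable: "f \<in> ED \<longleftrightarrow> 1 \<le> arity f \<and> factorable (arity f) (app f)"
proof
  assume "f \<in> ED"
  then show "1 \<le> arity f \<and> factorable (arity f) (app f)"
    using ED_imp_factorable by (auto simp: ED_def constraints_def)
next
  assume f: "1 \<le> arity f \<and> factorable (arity f) (app f)"
  then obtain us es where us: "\<forall>(h, j) \<in> set us. h \<in> unary \<and> j < arity f"
    and es: "\<forall>(g, m, n) \<in> set es. g \<in> {EQ, XOR} \<and> m < arity f \<and> n < arity f"
    and eq: "\<forall>x. length x = arity f \<longrightarrow>
       app f x = (\<Prod>(h, j)\<leftarrow>us. app h [x ! j]) * (\<Prod>(g, m, n)\<leftarrow>es. app g [x ! m, x ! n])"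
    using factorable_lists by blast
  \<comment> \<open>The constant factor 1 in front keeps the number of factors positive even if both
    lists are empty, as \<open>ED\<close> demands.\<close>
  define vs where "vs = ((1, \<lambda>_. 1) :: constraint, 0) # us"
  have vs: "\<forall>(h, j) \<in> set vs. h \<in> unary \<and> j < arity f" and ne: "1 \<le> length vs"
    using us f by (auto simp: vs_def unary_def)
  have prod_list_nth: "prod_list (map G xs) = (\<Prod>i<length xs. G (xs ! i))"
    for G :: "'b \<Rightarrow> complex" and xs
    by (simp add: prod.list_conv_set_nth atLeast0LessThan)
  have vs1: "(\<Prod>(h, j)\<leftarrow>vs. app h [x ! j]) = (\<Prod>(h, j)\<leftarrow>us. app h [x ! j])" for x
    by (simp add: vs_def)
  have eq': "app f x = (\<Prod>i<length vs. app (fst (vs ! i)) [x ! snd (vs ! i)]) *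
      (\<Prod>i<length es. app (fst (es ! i)) [x ! fst (snd (es ! i)), x ! snd (snd (es ! i))])"
    if "length x = arity f" for x
    using eq that vs1[of x] by (simp add: case_prod_beta prod_list_nth)
  show "f \<in> ED"
    unfolding ED_def mem_Collect_eq
  proof (intro conjI exI)
    show "f \<in> constraints" using f by (simp add: constraints_def)
    show "length vs + length es \<ge> (1::nat)" using ne by simp
    show "\<forall>x. length x = arity f \<longrightarrow> app f x = (\<Prod>i<length vs. app (fst (vs ! i)) [x ! snd (vs ! i)]) *
      (\<Prod>i<length es. app (fst (es ! i)) [x ! fst (snd (es ! i)), x ! snd (snd (es ! i))])"
      using eq' by blast
  qed (use vs es in \<open>auto simp: case_prod_beta dest!: nth_mem\<close>)
qed

section \<open>Splitting off the first variable\<close>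

definition separable :: "nat \<Rightarrow> (bool list \<Rightarrow> complex) \<Rightarrow> bool" where
  "separable k f \<longleftrightarrow> (\<exists>h g. \<forall>b y. length y = k \<longrightarrow> f (b # y) = h b * g y)"

text \<open>The sign \<open>q\<close> is \<open>True\<close> for equality with the variable
  \<open>j\<close> of the tail and \<open>False\<close> for disequality.\<close>

definition linked :: "nat \<Rightarrow> (bool list \<Rightarrow> complex) \<Rightarrow> nat \<Rightarrow> bool \<Rightarrow> bool" where
  "linked k f j q \<longleftrightarrow> (\<forall>b y. length y = k \<longrightarrow> f (b # y) \<noteq> 0 \<longrightarrow> (b = y ! j) = q)"

lemma separableI: "(\<And>b y. length y = k \<Longrightarrow> f (b # y) = h b * g y) \<Longrightarrow> separable k f"
  unfolding separable_def by blast

text \<open>A product is linked as soon as one of its factors is, because its support only shrinks;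
  otherwise both factors are separable, and so is the product.\<close>

lemma factorable_Suc_cases: "factorable (Suc k) f \<Longrightarrow> separable k f \<or> (\<exists>j<k. \<exists>q. linked k f j q)"
proof (induction rule: factorable.induct)
  case (factorable_const c)
  show ?case by (rule disjI1, rule separableI[of _ _ "\<lambda>_. 1" "\<lambda>_. c"]) simp
next
  case (factorable_unary j h)
  then show ?case
  proof (cases j)
    case 0
    then show ?thesis by (intro disjI1 separableI[of _ _ h "\<lambda>_. 1"]) simp
  next
    case (Suc i)
    then show ?thesis by (intro disjI1 separableI[of _ _ "\<lambda>_. 1" "\<lambda>y. h (y ! i)"]) simp
  qed
next
  case (factorable_edge m n q)
  consider "m = 0" "n = 0" | j where "m = 0" "n = Suc j" | j where "m = Suc j" "n = 0"
    | i j where "m = Suc i" "n = Suc j"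
    by (cases m; cases n) auto
  then show ?case
  proof cases
    case 1
    then show ?thesis
      by (intro disjI1 separableI[of _ _ "\<lambda>_. 1" "\<lambda>_. of_bool q"]) simp
  next
    case (2 j)
    then have "j < k" "linked k (\<lambda>x. of_bool ((x ! m = x ! n) = q)) j q"
      using factorable_edge by (simp_all add: linked_def)
    then show ?thesis by blast
  next
    case (3 j)
    then have "j < k" "linked k (\<lambda>x. of_bool ((x ! m = x ! n) = q)) j q"
      using factorable_edge unfolding linked_def by auto
    then show ?thesis by blast
  next
    case (4 i j)
    then show ?thesis
      by (intro disjI1 separableI[of _ _ "\<lambda>_. 1" "\<lambda>y. of_bool ((y ! i = y ! j) = q)"]) simp
  qed
next
  case (factorable_mult f g)
  show ?case
  proof (cases "separable k f \<and> separable k g")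
    case True
    then obtain h1 g1 h2 g2 where "\<forall>b y. length y = k \<longrightarrow> f (b # y) = h1 b * g1 y"
      "\<forall>b y. length y = k \<longrightarrow> g (b # y) = h2 b * g2 y"
      unfolding separable_def by blast
    then have "separable k (\<lambda>x. f x * g x)"
      unfolding separable_def by (intro exI[of _ "\<lambda>b. h1 b * h2 b"] exI[of _ "\<lambda>y. g1 y * g2 y"]) simp
    then show ?thesis ..
  next
    case False
    with factorable_mult.IH obtain j q where "j < k" "linked k f j q \<or> linked k g j q"
      by blast
    then have "linked k (\<lambda>x. f x * g x) j q" by (auto simp: linked_def)
    with \<open>j < k\<close> show ?thesis by blast
  qed
next
  case (factorable_cong f g)
  then show ?case by (simp add: separable_def linked_def)
qed

text \<open>One induction covers both substitutions for the first variable: a fixed bit, and another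
  variable or its negation. Under either, an edge at the first variable becomes a constant, a unary
  factor or another edge.\<close>

lemma factorable_subst_gen:
  assumes "factorable (Suc k) f"
    and l: "l = (\<lambda>y. c) \<or> (\<exists>j<k. l = (\<lambda>y. (y ! j) = q))"
  shows "factorable k (\<lambda>y. f (l y # y))"
  using assms(1)
proof (induction rule: factorable.induct)
  case (factorable_const c)
  then show ?case by (rule factorable.factorable_const)
next
  case (factorable_unary j h)
  show ?case
  proof (cases j)
    case 0
    from l show ?thesis
    proof
      assume "l = (\<lambda>y. c)"
      then show ?thesis using 0 by (simp add: factorable.factorable_const)
    next
      assume "\<exists>j<k. l = (\<lambda>y. (y ! j) = q)"
      then show ?thesis using 0 factorable.factorable_unary[where h = "\<lambda>b. h (b = q)"] by force
    qed
  next
    case (Suc i)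
    then show ?thesis using factorable_unary by (simp add: factorable.factorable_unary)
  qed
next
  case (factorable_edge m n r)
  have one: "factorable k (\<lambda>y. of_bool ((l y = y ! i) = r))" if "i < k" for i
    using l
  proof
    assume "l = (\<lambda>y. c)"
    then show ?thesis using that factorable.factorable_unary[where h = "\<lambda>b. of_bool ((c = b) = r)"] by force
  next
    assume "\<exists>j<k. l = (\<lambda>y. (y ! j) = q)"
    then obtain j where j: "j < k" "l = (\<lambda>y. (y ! j) = q)" by blast
    \<comment> \<open>Composing two signed equalities with signs \<open>q\<close> and
      \<open>r\<close> gives a signed equality with sign \<open>r = q\<close>.\<close>
    have "((y ! j = q) = y ! i) = r \<longleftrightarrow> (y ! j = y ! i) = (r = q)" for y :: "bool list"
      by auto
    then show ?thesis using factorable.factorable_edge[OF j(1) that, of "r = q"] by (simp add: j(2))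
  qed
  consider "m = 0" "n = 0" | j where "m = 0" "n = Suc j" | j where "m = Suc j" "n = 0"
    | i j where "m = Suc i" "n = Suc j"
    by (cases m; cases n) auto
  then show ?case
  proof cases
    case 1
    then show ?thesis by (simp add: factorable.factorable_const)
  next
    case 2
    then show ?thesis using factorable_edge one by simp
  next
    case (3 j)
    then have "j < k" using factorable_edge by simp
    moreover have "(y ! j = l y) = r \<longleftrightarrow> (l y = y ! j) = r" for y
      by auto
    ultimately show ?thesis using one[of j] 3 by simp
  next
    case 4
    then show ?thesis using factorable_edge by (simp add: factorable.factorable_edge)
  qed
next
  case (factorable_mult f g)
  then show ?case by (simp add: factorable.factorable_mult)
next
  case (factorable_cong f g)
  from factorable_cong.IH show ?case
    by (rule factorable.factorable_cong) (simp add: factorable_cong.hyps)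
qed

lemma factorable_restrict: "factorable (Suc k) f \<Longrightarrow> factorable k (\<lambda>y. f (c # y))"
  using factorable_subst_gen[of k f "\<lambda>y. c" c] by simp

lemma factorable_subst: "factorable (Suc k) f \<Longrightarrow> j < k \<Longrightarrow> factorable k (\<lambda>y. f ((y ! j = q) # y))"
  using factorable_subst_gen[of k f "\<lambda>y. (y ! j) = q"] by blast

lemma factorable_tl: "factorable k f \<Longrightarrow> factorable (Suc k) (\<lambda>x. f (tl x))"
proof (induction rule: factorable.induct)
  case (factorable_const c)
  show ?case by (rule factorable.factorable_const)
next
  case (factorable_unary j h)
  have "factorable (Suc k) (\<lambda>x. h (x ! Suc j))" using factorable_unary by (intro factorable.factorable_unary) simp
  then show ?case by (rule factorable.factorable_cong) (use factorable_unary in \<open>simp add: nth_tl\<close>)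
next
  case (factorable_edge m n q)
  have "factorable (Suc k) (\<lambda>x. of_bool ((x ! Suc m = x ! Suc n) = q))"
    using factorable_edge by (intro factorable.factorable_edge) auto
  then show ?case by (rule factorable.factorable_cong) (use factorable_edge in \<open>simp add: nth_tl\<close>)
next
  case (factorable_mult f g)
  then show ?case by (simp add: factorable.factorable_mult)
next
  case (factorable_cong f g)
  from factorable_cong.IH show ?case
    by (rule factorable.factorable_cong) (simp add: factorable_cong.hyps)
qed

lemma factorable_separable: "(\<And>b y. length y = k \<Longrightarrow> f (b # y) = h b * g y) \<Longrightarrow> factorable k g \<Longrightarrow> factorable (Suc k) f"
  by (rule factorable_cong[OF factorable_mult[OF factorable_unary[of 0 _ h] factorable_tl[of k g]]])
     (auto simp: length_Suc_conv)

text \<open>Only the first bit dictated by \<open>y ! j\<close> can contribute to the sum, so the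
  sum is \<open>f\<close> with its first variable forgotten, and the edge alone brings that variable
  back.\<close>

lemma linked_sum: "linked k f j q \<Longrightarrow> length y = k \<Longrightarrow>
    f (b # y) = of_bool ((b = y ! j) = q) * (f (False # y) + f (True # y))"
  unfolding linked_def by (cases b; cases q; cases "y ! j"; fastforce)

lemma factorable_linked:
  assumes "linked k f j q" "j < k" "factorable k (\<lambda>y. f (False # y) + f (True # y))"
  shows "factorable (Suc k) f"
proof (rule factorable_cong[OF factorable_mult[OF factorable_edge[of 0 _ "Suc j" q] factorable_tl[OF assms(3)]]])
  fix x :: "bool list"
  assume "length x = Suc k"
  then obtain b y where x: "x = b # y" "length y = k"
    by (auto simp: length_Suc_conv)
  show "of_bool ((x ! 0 = x ! Suc j) = q) * (f (False # tl x) + f (True # tl x)) = f x"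
    unfolding x using linked_sum[OF assms(1) x(2), of b] by simp
qed (use assms(2) in simp_all)

lemma factorable_sum_linked:
  assumes "linked k f j q" "j < k" "factorable (Suc k) f"
  shows "factorable k (\<lambda>y. f (False # y) + f (True # y))"
proof (rule factorable_cong[OF factorable_subst[OF assms(3,2), of q]])
  fix y :: "bool list"
  assume "length y = k"
  then show "f ((y ! j = q) # y) = f (False # y) + f (True # y)"
    using assms(1) unfolding linked_def by (cases q; cases "y ! j"; fastforce)
qed

section \<open>Non-degenerate binary weighted projections\<close>

primrec multilin :: "(bool \<Rightarrow> complex) list \<Rightarrow> (bool list \<Rightarrow> complex) \<Rightarrow> complex" where
  "multilin [] T = T []"
| "multilin (w # v) T = w False * multilin v (\<lambda>x. T (False # x)) + w True * multilin v (\<lambda>x. T (True # x))"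

text \<open>The shape of a gadget with a single use of \<open>f\<close>: each argument is either
  read from a variable (\<open>Inl\<close>) or summed out with a unary weight
  (\<open>Inr\<close>).\<close>

primrec psum :: "(nat + (bool \<Rightarrow> complex)) list \<Rightarrow> (bool list \<Rightarrow> complex) \<Rightarrow> (nat \<Rightarrow> bool) \<Rightarrow> complex" where
  "psum [] f \<sigma> = f []"
| "psum (p # ps) f \<sigma> = (case p of Inl x \<Rightarrow> psum ps (\<lambda>y. f (\<sigma> x # y)) \<sigma>
     | Inr w \<Rightarrow> w False * psum ps (\<lambda>y. f (False # y)) \<sigma> + w True * psum ps (\<lambda>y. f (True # y)) \<sigma>)"

definition pin :: "bool \<Rightarrow> bool \<Rightarrow> complex" where
  "pin c b = of_bool (b = c)"

lemma multilin_pin: "multilin (map pin y) T = T y"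
  by (induction y arbitrary: T) (simp_all add: pin_def)

lemma multilin_cong: "(\<And>y. length y = length v \<Longrightarrow> T y = T' y) \<Longrightarrow> multilin v T = multilin v T'"
proof (induction v arbitrary: T T')
  case (Cons w v)
  have "multilin v (\<lambda>x. T (b # x)) = multilin v (\<lambda>x. T' (b # x))" for b
    by (rule Cons.IH) (simp add: Cons.prems)
  then show ?case by simp
qed simp

lemma multilin_scale: "multilin v (\<lambda>x. c * T x) = c * multilin v T"
  by (induction v arbitrary: T) (simp_all add: algebra_simps)

definition line :: "(bool \<Rightarrow> complex) list \<Rightarrow> (bool \<Rightarrow> complex) list \<Rightarrow> complex \<Rightarrow> (bool \<Rightarrow> complex) list" where
  "line v v' s = map2 (\<lambda>w w' b. w b + s * (w' b - w b)) v v'"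

lemma length_line [simp]: "length (line v v' s) = min (length v) (length v')"
  by (simp add: line_def)

lemma line_0: "length v = length v' \<Longrightarrow> line v v' 0 = v"
  by (auto simp: line_def intro!: nth_equalityI)

lemma line_1: "length v = length v' \<Longrightarrow> line v v' 1 = v'"
  by (auto simp: line_def intro!: nth_equalityI)

lemma line_update: "(line v v' s)[j := e] = line (v[j := e]) (v'[j := e]) s"
  by (simp add: line_def zip_update map_update)

text \<open>This replaces multivariate polynomials: it is closed under the few operations needed,
  and roots are counted in one variable.\<close>

definition line_poly :: "nat \<Rightarrow> ((bool \<Rightarrow> complex) list \<Rightarrow> complex) \<Rightarrow> bool" where
  "line_poly m P \<longleftrightarrow> (\<forall>v v'. length v = m \<longrightarrow> length v' = m \<longrightarrow> (\<exists>p. \<forall>s. P (line v v' s) = poly p s))"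

lemma line_poly_multilin: "line_poly m (\<lambda>v. multilin v T)"
proof -
  have "\<exists>p. \<forall>s. multilin (line v v' s) T = poly p s" if "length v = length v'" for v v'
    using that
  proof (induction v v' arbitrary: T rule: list_induct2)
    case Nil
    show ?case by (intro exI[of _ "[:T []:]"]) (simp add: line_def)
  next
    case (Cons w v w' v')
    from Cons.IH[of "\<lambda>x. T (False # x)"] obtain p
      where p: "\<And>s. multilin (line v v' s) (\<lambda>x. T (False # x)) = poly p s" by blast
    from Cons.IH[of "\<lambda>x. T (True # x)"] obtain q
      where q: "\<And>s. multilin (line v v' s) (\<lambda>x. T (True # x)) = poly q s" by blast
    have l: "line (w # v) (w' # v') s = (\<lambda>b. w b + s * (w' b - w b)) # line v v' s" for s
      by (simp add: line_def)
    show ?case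
      by (intro exI[of _ "[:w False, w' False - w False:] * p + [:w True, w' True - w True:] * q"])
        (simp add: l p q algebra_simps)
  qed
  then show ?thesis by (simp add: line_poly_def)
qed

lemma line_poly_update: "line_poly m P \<Longrightarrow> line_poly m (\<lambda>v. P (v[j := e]))"
  by (simp add: line_poly_def line_update)

lemma line_poly_mult: "line_poly m P \<Longrightarrow> line_poly m Q \<Longrightarrow> line_poly m (\<lambda>v. P v * Q v)"
  unfolding line_poly_def by (metis poly_mult)

lemma line_poly_diff: "line_poly m P \<Longrightarrow> line_poly m Q \<Longrightarrow> line_poly m (\<lambda>v. P v - Q v)"
  unfolding line_poly_def by (metis poly_diff)

text \<open>On the line through the two witnesses \<open>P\<close> is nonzero at parameter 0 and
  \<open>Q\<close> at parameter 1, so the product of their restrictions is a nonzero univariate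
  polynomial and has finitely many roots.\<close>

lemma line_poly_generic:
  assumes "line_poly m P" "line_poly m Q" "P v \<noteq> 0" "Q v' \<noteq> 0" "length v = m" "length v' = m"
  shows "\<exists>u. length u = m \<and> P u \<noteq> 0 \<and> Q u \<noteq> 0"
proof -
  obtain p where p: "\<And>s. P (line v v' s) = poly p s"
    using assms(1,5,6) unfolding line_poly_def by blast
  obtain q where q: "\<And>s. Q (line v v' s) = poly q s"
    using assms(2,5,6) unfolding line_poly_def by blast
  have "p \<noteq> 0" using p[of 0] assms by (auto simp: line_0)
  moreover have "q \<noteq> 0" using q[of 1] assms by (auto simp: line_1)
  ultimately have "finite {s. poly (p * q) s = 0}"
    by (intro poly_roots_finite) simp
  then obtain s where "poly (p * q) s \<noteq> 0"
    using infinite_UNIV_char_0 by (metis (mono_tags, lifting) ex_new_if_finite mem_Collect_eq)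
  then show ?thesis
    using p[of s] q[of s] assms by (intro exI[of _ "line v v' s"]) simp
qed

text \<open>A matrix indexed by the first variable and by the variable \<open>j\<close> of the tail,
  everything else being summed with the weights \<open>v\<close>. The entry of \<open>v\<close> at
  position \<open>j\<close> is overwritten.\<close>

definition slice :: "(bool list \<Rightarrow> complex) \<Rightarrow> nat \<Rightarrow> (bool \<Rightarrow> complex) list \<Rightarrow> bool \<Rightarrow> bool \<Rightarrow> complex" where
  "slice f j v b c = multilin (v[j := pin c]) (\<lambda>x. f (b # x))"

definition detm :: "(bool \<Rightarrow> bool \<Rightarrow> complex) \<Rightarrow> complex" where
  "detm B = B False False * B True True - B False True * B True False"

text \<open>Besides rank one, this excludes the matrices supported on the diagonal or on the
  antidiagonal, that is, the weighted forms of \<open>EQ\<close> and \<open>XOR\<close>.\<close>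

definition nondeg :: "(bool \<Rightarrow> bool \<Rightarrow> complex) \<Rightarrow> bool" where
  "nondeg B \<longleftrightarrow> detm B \<noteq> 0 \<and> (B False False \<noteq> 0 \<or> B True True \<noteq> 0) \<and> (B False True \<noteq> 0 \<or> B True False \<noteq> 0)"

lemma line_poly_slice: "line_poly m (\<lambda>v. slice f j v b c)"
  unfolding slice_def by (intro line_poly_update line_poly_multilin)

lemma line_poly_detm: "line_poly m (\<lambda>v. detm (slice f j v))"
  unfolding detm_def by (intro line_poly_diff line_poly_mult line_poly_slice)

text \<open>If fixing the second variable to some bit leaves a function that is not separable, the
  induction hypothesis applies. Otherwise each of the two restrictions splits, as
  \<open>h c b * g c y\<close>, and the second variable itself is the partner: its two columns
  \<open>h False\<close> and \<open>h True\<close> must be independent.\<close>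

lemma exists_det:
  "\<not> separable m f \<Longrightarrow> \<exists>j<m. \<exists>v. length v = m \<and> detm (slice f j v) \<noteq> 0"
proof (induction m arbitrary: f)
  case 0
  have "separable 0 f" by (rule separableI[of _ _ "\<lambda>b. f [b]" "\<lambda>_. 1"]) simp
  with 0 show ?case by blast
next
  case (Suc m)
  show ?case
  proof (cases "\<exists>c. \<not> separable m (\<lambda>x. f (hd x # c # tl x))")
    case True
    then obtain c where "\<not> separable m (\<lambda>x. f (hd x # c # tl x))" by blast
    from Suc.IH[OF this] obtain j v where jv: "j < m" "length v = m"
      "detm (slice (\<lambda>x. f (hd x # c # tl x)) j v) \<noteq> 0" by blast
    have "slice f (Suc j) (pin c # v) = slice (\<lambda>x. f (hd x # c # tl x)) j v"
      by (cases c) (simp_all add: slice_def fun_eq_iff pin_def)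
    with jv show ?thesis by (intro exI[of _ "Suc j"] conjI exI[of _ "pin c # v"]) auto
  next
    case False
    then have "\<forall>c. \<exists>h g. \<forall>b y. length y = m \<longrightarrow> f (b # c # y) = h b * g y"
      unfolding separable_def by simp
    then obtain h g where hg: "\<And>c b y. length y = m \<Longrightarrow> f (b # c # y) = h c b * g c y"
      by metis
    \<comment> \<open>If \<open>g c\<close> were identically zero, only the other value of the
      second variable would survive, and the first variable would split off from
      \<open>f\<close>.\<close>
    have ex: "\<exists>y. length y = m \<and> g c y \<noteq> 0" for c
    proof (rule ccontr)
      assume no: "\<not> (\<exists>y. length y = m \<and> g c y \<noteq> 0)"
      have "separable (Suc m) f"
        by (rule separableI[of _ _ "h (\<not> c)" "\<lambda>y. of_bool (hd y \<noteq> c) * g (\<not> c) (tl y)"])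
           (use no in \<open>cases c; auto simp: length_Suc_conv hg\<close>)
      with Suc.prems show False ..
    qed
    \<comment> \<open>Proportional \<open>h False\<close> and \<open>h True\<close> would give a
      function \<open>k\<close> of the first variable common to both restrictions, hence
      separability.\<close>
    have dh: "h False False * h True True \<noteq> h True False * h False True"
    proof
      assume eq: "h False False * h True True = h True False * h False True"
      have "\<exists>k a. \<forall>c b. h c b = a c * (k b :: complex)"
      proof (cases "h False = (\<lambda>_. 0)")
        case True
        then have "\<forall>c' c. h c' c = of_bool c' * h True c" by simp
        then show ?thesis by (intro exI)
      next
        case False
        then obtain b where b: "h False b \<noteq> 0" by auto
        have *: "h True c * h False b = h True b * h False c" for c
          using eq by (cases b; cases c) (simp_all add: mult.commute)
        then have "h True c = h True b / h False b * h False c" for c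
          using b *[of c] by (simp add: nonzero_eq_divide_eq)
        then obtain r where "\<And>c. h True c = r * h False c" by blast
        then have "\<forall>c' c. h c' c = (if c' then r else 1) * h False c"
          by simp
        then show ?thesis by (intro exI)
      qed
      then obtain k a where ka: "\<And>b c. h c b = a c * k b" by blast
      have "separable (Suc m) f"
        by (rule separableI[of _ _ k "\<lambda>y. a (hd y) * g (hd y) (tl y)"])
           (auto simp: length_Suc_conv hg ka)
      with Suc.prems show False ..
    qed
    obtain y0 y1 where "length y0 = m" "g False y0 \<noteq> 0" "length y1 = m" "g True y1 \<noteq> 0"
      using ex by meson
    then obtain v where v: "length v = m" "multilin v (g False) \<noteq> 0" "multilin v (g True) \<noteq> 0"
      using line_poly_generic[OF line_poly_multilin line_poly_multilin, of "map pin y0" "g False" "map pin y1" "g True" m]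
      by (auto simp: multilin_pin)
    have "multilin v (\<lambda>x. f (b # c # x)) = h c b * multilin v (g c)" for b c
      by (subst multilin_scale[symmetric], rule multilin_cong) (simp add: hg v)
    then have "slice f 0 (pin False # v) b c = h c b * multilin v (g c)" for b c
      by (cases c) (simp_all add: slice_def pin_def)
    \<comment> \<open>Column \<open>c\<close> of the slice is \<open>h c\<close> scaled by
      \<open>multilin v (g c)\<close>, so the determinant is a product of three nonzero numbers. The
      leading \<open>pin False\<close> is a placeholder at the overwritten position 0.\<close>
    then have "detm (slice f 0 (pin False # v)) =
        multilin v (g False) * multilin v (g True) * (h False False * h True True - h True False * h False True)"
      by (simp add: detm_def algebra_simps)
    with v dh show ?thesis by (intro exI[of _ 0] conjI exI[of _ "pin False # v"]) auto
  qed
qed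

text \<open>The determinant chooses \<open>j\<close>. Failure of both links to that same
  \<open>j\<close> yields support points off and on the diagonal, where the corresponding entries
  are nonzero for pinned weights. Two applications of the line argument merge the three witnesses
  into one weight vector.\<close>

lemma exists_nondeg:
  assumes "\<not> separable m f" "\<And>j q. j < m \<Longrightarrow> \<not> linked m f j q"
  shows "\<exists>j<m. \<exists>v. length v = m \<and> nondeg (slice f j v)"
proof -
  obtain j v where j: "j < m" and v: "length v = m" "detm (slice f j v) \<noteq> 0"
    using exists_det[OF assms(1)] by blast
  \<comment> \<open>The entry in row \<open>b\<close> and column \<open>b = (\<not> q)\<close> lies
    off the diagonal for \<open>q = True\<close> and on it for \<open>q = False\<close>.\<close>
  have "\<exists>b v. length v = m \<and> slice f j v b (b = (\<not> q)) \<noteq> 0" for q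
  proof -
    from assms(2)[OF j, of q] obtain b y where y: "length y = m" "f (b # y) \<noteq> 0" "(b = y ! j) \<noteq> q"
      unfolding linked_def by blast
    then have yj: "y ! j = (b = (\<not> q))" by auto
    have "(map pin y)[j := pin (b = (\<not> q))] = map pin y"
      using list_update_id[of "map pin y" j] y j unfolding yj[symmetric] by simp
    with y(1,2) show ?thesis
      by (intro exI[of _ b] exI[of _ "map pin y"]) (simp add: slice_def multilin_pin)
  qed
  from this[of True] this[of False] obtain b w b' w'
    where w: "length w = m" "slice f j w b (\<not> b) \<noteq> 0" and w': "length w' = m" "slice f j w' b' b' \<noteq> 0"
    by auto
  obtain u where u: "length u = m" "detm (slice f j u) * slice f j u b (\<not> b) \<noteq> 0"
    using line_poly_generic[OF line_poly_detm line_poly_slice v(2) w(2) v(1) w(1)] by auto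
  obtain z where "length z = m" "detm (slice f j z) * slice f j z b (\<not> b) \<noteq> 0" "slice f j z b' b' \<noteq> 0"
    using line_poly_generic[OF line_poly_mult[OF line_poly_detm line_poly_slice] line_poly_slice u(2) w'(2) u(1) w'(1)] by auto
  then have "nondeg (slice f j z)"
    by (cases b; cases b') (auto simp: nondeg_def)
  with \<open>length z = m\<close> j show ?thesis by blast
qed

lemma psum_Inr: "psum (map Inr v) f \<sigma> = multilin v f"
  by (induction v arbitrary: f) auto

lemma psum_update:
  "j < length v \<Longrightarrow> psum ((map Inr v)[j := Inl x]) f \<sigma> = multilin (v[j := pin (\<sigma> x)]) f"
proof (induction v arbitrary: f j)
  case (Cons w v)
  then show ?case
    by (cases j; cases "\<sigma> x") (auto simp: psum_Inr pin_def)
qed simp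

definition two_values :: "bool \<Rightarrow> bool \<Rightarrow> nat \<Rightarrow> bool" where
  "two_values a b i = (if i = 0 then a else b)"

text \<open>Induction on the arity, by the behaviour of the first variable. If it splits off, it is
  fixed at a bit where its factor is nonzero; if it is linked, it is summed out with weight 1.
  Either way the smaller function is not factorable, since otherwise \<open>f\<close> would be. In
  the remaining case it is kept, and \<open>exists_nondeg\<close> supplies the second kept
  variable.\<close>

lemma exists_gadget:
  "\<not> factorable k f \<Longrightarrow> \<exists>ps. length ps = k \<and> (\<forall>x. Inl x \<in> set ps \<longrightarrow> x < 2) \<and> nondeg (\<lambda>a b. psum ps f (two_values a b))"
proof (induction k arbitrary: f)
  case 0
  have "factorable 0 f" by (rule factorable_cong[OF factorable_const[of _ "f []"]]) simp
  with 0 show ?case by blast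
next
  case (Suc k)
  consider "separable k f" | j q where "j < k" "linked k f j q" | "\<not> separable k f" "\<And>j q. j < k \<Longrightarrow> \<not> linked k f j q"
    by blast
  then show ?case
  proof cases
    case 1
    then obtain h g where hg: "\<And>b y. length y = k \<Longrightarrow> f (b # y) = h b * g y"
      unfolding separable_def by blast
    have "\<exists>b. h b \<noteq> 0"
    proof (rule ccontr)
      assume no: "\<not> (\<exists>b. h b \<noteq> 0)"
      have "factorable (Suc k) f"
        by (rule factorable_cong[OF factorable_const[of _ 0]]) (use no hg in \<open>auto simp: length_Suc_conv\<close>)
      with Suc.prems show False ..
    qed
    then obtain b where b: "h b \<noteq> 0" by blast
    have "\<not> factorable k (\<lambda>y. f (b # y))"
    proof
      assume "factorable k (\<lambda>y. f (b # y))"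
      then have "factorable k g"
        by (rule factorable_cong[OF factorable_mult[OF factorable_const[of _ "1 / h b"]]]) (use b in \<open>simp add: hg\<close>)
      with Suc.prems show False using factorable_separable hg by blast
    qed
    from Suc.IH[OF this] obtain ps where "length ps = k" "\<forall>x. Inl x \<in> set ps \<longrightarrow> x < 2"
      "nondeg (\<lambda>a c. psum ps (\<lambda>y. f (b # y)) (two_values a c))" by blast
    then show ?thesis
      by (intro exI[of _ "Inr (pin b) # ps"]; cases b) (auto simp: pin_def)
  next
    case 2
    then have "\<not> factorable k (\<lambda>y. f (False # y) + f (True # y))"
      using factorable_linked Suc.prems by blast
    from Suc.IH[OF this] obtain ps where ps: "length ps = k" "\<forall>x. Inl x \<in> set ps \<longrightarrow> x < 2"
      "nondeg (\<lambda>a c. psum ps (\<lambda>y. f (False # y) + f (True # y)) (two_values a c))" by blast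
    have "psum ps (\<lambda>y. F y + G y) \<sigma> = psum ps F \<sigma> + psum ps G \<sigma>" for F G \<sigma>
      by (induction ps arbitrary: F G) (auto split: sum.split simp: algebra_simps)
    with ps show ?thesis
      by (intro exI[of _ "Inr (\<lambda>_. 1) # ps"]) simp
  next
    case 3
    from exists_nondeg[OF this] obtain j v where
      j: "j < k" "length v = k" "nondeg (slice f j v)" by blast
    have "psum (Inl 0 # (map Inr v)[j := Inl 1]) f (two_values a b) = slice f j v a b" for a b
      using j by (simp add: psum_update two_values_def slice_def)
    with j show ?thesis
      by (intro exI[of _ "Inl 0 # (map Inr v)[j := Inl 1]"])
        (auto dest!: set_update_subset_insert[THEN subsetD])
  qed
qed

section \<open>Functions realizable by summing over auxiliary variables\<close>

text \<open>Assignments are total functions on \<open>nat\<close>, updated at the \<open>m\<close>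
  variables from \<open>n\<close> on, so nested sums need no bookkeeping of domains. Only
  \<open>vsum_sum_PiE\<close> compares the result with a sum over extensional functions.\<close>

primrec vsum :: "nat \<Rightarrow> nat \<Rightarrow> ((nat \<Rightarrow> bool) \<Rightarrow> complex) \<Rightarrow> (nat \<Rightarrow> bool) \<Rightarrow> complex" where
  "vsum n 0 P \<sigma> = P \<sigma>"
| "vsum n (Suc m) P \<sigma> =
     vsum (Suc n) m P (\<sigma>(n := False)) + vsum (Suc n) m P (\<sigma>(n := True))"

text \<open>Stands in for a finite domain: what depends only on the variables below \<open>n\<close>
  can be pulled out of sums over later ones.\<close>

definition dep :: "nat \<Rightarrow> ((nat \<Rightarrow> bool) \<Rightarrow> 'a) \<Rightarrow> bool" where
  "dep n P \<longleftrightarrow> (\<forall>\<sigma> \<tau>. (\<forall>i<n. \<sigma> i = \<tau> i) \<longrightarrow> P \<sigma> = P \<tau>)"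

lemma depD: "dep n P \<Longrightarrow> (\<And>i. i < n \<Longrightarrow> \<sigma> i = \<tau> i) \<Longrightarrow> P \<sigma> = P \<tau>"
  by (simp add: dep_def)

lemma dep_mono: "dep n P \<Longrightarrow> n \<le> m \<Longrightarrow> dep m P"
  by (simp add: dep_def)

lemma dep_mult: "dep n P \<Longrightarrow> dep n Q \<Longrightarrow> dep n (\<lambda>\<sigma>. P \<sigma> * Q \<sigma>)"
  by (simp add: dep_def) metis

lemma dep_upd: "dep n P \<Longrightarrow> n \<le> m \<Longrightarrow> P (\<sigma>(m := b)) = P \<sigma>"
  by (erule depD) auto

lemma vsum_add: "vsum n (m1 + m2) P \<sigma> = vsum n m1 (vsum (n + m1) m2 P) \<sigma>"
  by (induction m1 arbitrary: n \<sigma>) simp_all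

lemma dep_vsum: "dep (n + m) P \<Longrightarrow> dep n (vsum n m P)"
proof (induction m arbitrary: n)
  case (Suc m)
  then have d: "dep (Suc n) (vsum (Suc n) m P)" by simp
  show ?case
    unfolding dep_def
  proof (intro allI impI)
    fix \<sigma> \<tau> :: "nat \<Rightarrow> bool"
    assume *: "\<forall>i<n. \<sigma> i = \<tau> i"
    have "vsum (Suc n) m P (\<sigma>(n := b)) = vsum (Suc n) m P (\<tau>(n := b))" for b
      by (rule depD[OF d]) (use * in auto)
    then show "vsum n (Suc m) P \<sigma> = vsum n (Suc m) P \<tau>" by simp
  qed
qed (auto simp: dep_def)

lemma vsum_mult_right:
  "dep n C \<Longrightarrow> vsum n m (\<lambda>\<sigma>. P \<sigma> * C \<sigma>) \<sigma> = vsum n m P \<sigma> * C \<sigma>"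
proof (induction m arbitrary: n \<sigma>)
  case (Suc m)
  from Suc.IH[OF dep_mono[OF Suc.prems]] show ?case
    by (simp add: dep_upd[OF Suc.prems] algebra_simps)
qed simp

lemma vsum_mult_left:
  "dep n C \<Longrightarrow> vsum n m (\<lambda>\<sigma>. C \<sigma> * P \<sigma>) \<sigma> = C \<sigma> * vsum n m P \<sigma>"
  using vsum_mult_right[of n C m P \<sigma>] by (simp add: mult.commute)

lemma vsum_cong: "(\<And>\<tau>. (\<And>i. i < n \<Longrightarrow> \<tau> i = \<sigma> i) \<Longrightarrow> P \<tau> = Q \<tau>) \<Longrightarrow> vsum n m P \<sigma> = vsum n m Q \<sigma>"
proof (induction m arbitrary: n \<sigma>)
  case (Suc m)
  have "vsum (Suc n) m P (\<sigma>(n := b)) = vsum (Suc n) m Q (\<sigma>(n := b))" for b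
    by (rule Suc.IH, rule Suc.prems) auto
  then show ?case by simp
qed simp

text \<open>By hypothesis a summed variable is hit by the renaming only from the variable with the
  same offset, so updating before the renaming and updating after it agree.\<close>

lemma vsum_rename:
  "(\<And>p i. i < m \<Longrightarrow> \<rho> p = n' + i \<longleftrightarrow> p = n + i) \<Longrightarrow>
   vsum n' m (\<lambda>\<sigma>. P (\<sigma> \<circ> \<rho>)) \<sigma> = vsum n m P (\<sigma> \<circ> \<rho>)"
proof (induction m arbitrary: n n' \<sigma>)
  case (Suc m)
  have "\<rho> p = n' \<longleftrightarrow> p = n" for p using Suc.prems[of 0 p] by simp
  then have u: "\<sigma>(n' := b) \<circ> \<rho> = (\<sigma> \<circ> \<rho>)(n := b)" for b
    by (auto simp: fun_eq_iff)
  have "vsum (Suc n') m (\<lambda>\<sigma>. P (\<sigma> \<circ> \<rho>)) \<tau> = vsum (Suc n) m P (\<tau> \<circ> \<rho>)" for \<tau>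
    by (rule Suc.IH) (use Suc.prems[of "Suc _"] in simp)
  then show ?case by (simp only: vsum.simps u)
qed simp

definition cweight :: "(constraint \<times> nat list) list \<Rightarrow> (nat \<Rightarrow> bool) \<Rightarrow> complex" where
  "cweight cs \<sigma> = (\<Prod>(h, xs)\<leftarrow>cs. app h (map \<sigma> xs))"

lemma cweight_simps [simp]: "cweight [] \<sigma> = 1" "cweight ((h, xs) # cs) \<sigma> = app h (map \<sigma> xs) * cweight cs \<sigma>"
  "cweight (cs @ ds) \<sigma> = cweight cs \<sigma> * cweight ds \<sigma>"
  by (simp_all add: cweight_def)

definition csp_over :: "constraint set \<Rightarrow> nat \<Rightarrow> (constraint \<times> nat list) list \<Rightarrow> bool" where
  "csp_over F n cs \<longleftrightarrow> (\<forall>(h, xs) \<in> set cs. h \<in> F \<union> unary \<and> length xs = arity h \<and> set xs \<subseteq> {..<n})"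

lemma csp_over_simps [simp]: "csp_over F n []"
  "csp_over F n ((h, xs) # cs) \<longleftrightarrow> h \<in> F \<union> unary \<and> length xs = arity h \<and> set xs \<subseteq> {..<n} \<and> csp_over F n cs"
  "csp_over F n (cs @ ds) \<longleftrightarrow> csp_over F n cs \<and> csp_over F n ds"
  by (auto simp: csp_over_def)

lemma csp_over_mono: "csp_over F n cs \<Longrightarrow> n \<le> m \<Longrightarrow> csp_over F m cs"
  unfolding csp_over_def by fastforce

lemma dep_cweight: "csp_over F n cs \<Longrightarrow> dep n (cweight cs)"
proof (induction cs)
  case (Cons c cs)
  obtain h xs where c: "c = (h, xs)" by (cases c)
  have "dep n (\<lambda>\<sigma>. app h (map \<sigma> xs))"
    unfolding dep_def
  proof (intro allI impI)
    fix \<sigma> \<tau> :: "nat \<Rightarrow> bool"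
    assume "\<forall>i<n. \<sigma> i = \<tau> i"
    then have "map \<sigma> xs = map \<tau> xs" using Cons.prems by (auto simp: c)
    then show "app h (map \<sigma> xs) = app h (map \<tau> xs)" by (rule arg_cong)
  qed
  moreover have "cweight (c # cs) = (\<lambda>\<sigma>. app h (map \<sigma> xs) * cweight cs \<sigma>)"
    by (simp add: c fun_eq_iff)
  ultimately show ?case
    using Cons by (auto simp: c intro: dep_mult)
qed (simp add: dep_def)

definition rename :: "(nat \<Rightarrow> nat) \<Rightarrow> (constraint \<times> nat list) list \<Rightarrow> (constraint \<times> nat list) list" where
  "rename \<rho> = map (\<lambda>(h, xs). (h, map \<rho> xs))"

lemma cweight_rename: "cweight (rename \<rho> cs) \<sigma> = cweight cs (\<sigma> \<circ> \<rho>)"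
  by (induction cs) (auto simp: rename_def o_def)

lemma csp_over_rename: "csp_over F n cs \<Longrightarrow> (\<And>i. i < n \<Longrightarrow> \<rho> i < m) \<Longrightarrow> csp_over F m (rename \<rho> cs)"
  unfolding csp_over_def rename_def by fastforce

text \<open>The equality is exact, without a scalar factor, so gadgets can be multiplied and nested
  with no normalization to track.\<close>

definition realizable :: "constraint set \<Rightarrow> nat \<Rightarrow> ((nat \<Rightarrow> bool) \<Rightarrow> complex) \<Rightarrow> bool" where
  "realizable F n r \<longleftrightarrow> (\<exists>m cs. csp_over F (n + m) cs \<and> (\<forall>\<sigma>. r \<sigma> = vsum n m (cweight cs) \<sigma>))"

lemma realizable_app: "h \<in> F \<union> unary \<Longrightarrow> length xs = arity h \<Longrightarrow> set xs \<subseteq> {..<n} \<Longrightarrow>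
    realizable F n (\<lambda>\<sigma>. app h (map \<sigma> xs))"
  unfolding realizable_def by (intro exI[of _ 0] exI[of _ "[(h, xs)]"]) simp

lemma realizable_unary: "i < n \<Longrightarrow> realizable F n (\<lambda>\<sigma>. w (\<sigma> i))"
  using realizable_app[of "(1, \<lambda>x. w (hd x))" F "[i]" n] by (simp add: unary_def)

lemma realizable_sum: "realizable F (Suc n) r \<Longrightarrow> realizable F n (\<lambda>\<sigma>. r (\<sigma>(n := False)) + r (\<sigma>(n := True)))"
proof -
  assume "realizable F (Suc n) r"
  then obtain m cs where "csp_over F (Suc n + m) cs" "\<forall>\<sigma>. r \<sigma> = vsum (Suc n) m (cweight cs) \<sigma>"
    unfolding realizable_def by blast
  then show ?thesis
    unfolding realizable_def by (intro exI[of _ "Suc m"] exI[of _ cs]) simp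
qed

lemma realizable_mult:
  assumes "realizable F n r" "realizable F n s"
  shows "realizable F n (\<lambda>\<sigma>. r \<sigma> * s \<sigma>)"
proof -
  obtain m1 cs where cs: "csp_over F (n + m1) cs" "\<And>\<sigma>. r \<sigma> = vsum n m1 (cweight cs) \<sigma>"
    using assms(1) unfolding realizable_def by blast
  obtain m2 ds where ds: "csp_over F (n + m2) ds" "\<And>\<sigma>. s \<sigma> = vsum n m2 (cweight ds) \<sigma>"
    using assms(2) unfolding realizable_def by blast
  \<comment> \<open>The auxiliary variables of \<open>ds\<close> are shifted past the
    \<open>m1\<close> auxiliary variables of \<open>cs\<close>; the two gadgets then share only the
    first \<open>n\<close> variables, and the double sum factors.\<close>
  define \<rho> where "\<rho> i = (if i < n then i else i + m1)" for i
  have dc: "dep (n + m1) (cweight cs)" and dd: "dep n (vsum n m2 (cweight ds))"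
    using cs(1) ds(1) by (auto intro: dep_cweight dep_vsum)
  have "vsum (n + m1) m2 (cweight (cs @ rename \<rho> ds)) \<sigma> = cweight cs \<sigma> * s \<sigma>" for \<sigma>
  proof -
    have "vsum (n + m1) m2 (cweight (cs @ rename \<rho> ds)) \<sigma>
        = vsum (n + m1) m2 (\<lambda>\<sigma>. cweight cs \<sigma> * cweight ds (\<sigma> \<circ> \<rho>)) \<sigma>"
      by (rule vsum_cong) (simp add: cweight_rename)
    also have "\<dots> = cweight cs \<sigma> * vsum (n + m1) m2 (\<lambda>\<sigma>. cweight ds (\<sigma> \<circ> \<rho>)) \<sigma>"
      by (rule vsum_mult_left[OF dc])
    also have "vsum (n + m1) m2 (\<lambda>\<sigma>. cweight ds (\<sigma> \<circ> \<rho>)) \<sigma> = vsum n m2 (cweight ds) (\<sigma> \<circ> \<rho>)"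
      by (rule vsum_rename) (auto simp: \<rho>_def)
    also have "\<dots> = s \<sigma>"
      unfolding ds(2) by (rule depD[OF dd]) (simp add: \<rho>_def)
    finally show ?thesis .
  qed
  then have "vsum n (m1 + m2) (cweight (cs @ rename \<rho> ds)) \<sigma> = vsum n m1 (\<lambda>\<sigma>. cweight cs \<sigma> * s \<sigma>) \<sigma>" for \<sigma>
    unfolding vsum_add by (intro vsum_cong)
  also have "\<dots> \<sigma> = r \<sigma> * s \<sigma>" for \<sigma>
    unfolding cs(2) ds(2) by (rule vsum_mult_right[OF dd])
  finally have "vsum n (m1 + m2) (cweight (cs @ rename \<rho> ds)) \<sigma> = r \<sigma> * s \<sigma>" for \<sigma> .
  moreover have "csp_over F (n + (m1 + m2)) (cs @ rename \<rho> ds)"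
    using csp_over_mono[OF cs(1)] csp_over_rename[OF ds(1), of \<rho>] by (simp add: \<rho>_def)
  ultimately show ?thesis
    unfolding realizable_def by metis
qed

lemma realizable_prod: "finite A \<Longrightarrow> 1 \<le> n \<Longrightarrow> (\<And>a. a \<in> A \<Longrightarrow> realizable F n (r a)) \<Longrightarrow> realizable F n (\<lambda>\<sigma>. \<Prod>a\<in>A. r a \<sigma>)"
proof (induction A rule: finite_induct)
  case empty
  then show ?case using realizable_unary[of 0 n F "\<lambda>_. 1"] by simp
next
  case (insert a A)
  then show ?case by (simp add: realizable_mult)
qed

lemma psum_cong: "(\<And>x. Inl x \<in> set ps \<Longrightarrow> \<sigma> x = \<tau> x) \<Longrightarrow> psum ps f \<sigma> = psum ps f \<tau>"
  by (induction ps arbitrary: f) (auto split: sum.split)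

lemma psum_Inl: "psum (map Inl xs) f \<sigma> = f (map \<sigma> xs)"
  by (induction xs arbitrary: f) auto

lemma psum_map: "psum (map (map_sum \<rho> id) ps) f \<sigma> = psum ps f (\<sigma> \<circ> \<rho>)"
  by (induction ps arbitrary: f) (auto split: sum.split)

text \<open>A summed argument is traded for a fresh variable \<open>n\<close>, and its weight
  becomes a unary factor on that variable.\<close>

lemma psum_append_Inr: "psum (map Inl xs @ Inr w # ps) f \<sigma> =
    w False * psum (map Inl xs @ Inl n # ps) f (\<tau>(n := False)) +
    w True * psum (map Inl xs @ Inl n # ps) f (\<tau>(n := True))"
  if "n \<notin> set xs" "Inl n \<notin> set ps" "\<And>x. x \<in> set xs \<or> Inl x \<in> set ps \<Longrightarrow> \<sigma> x = \<tau> x"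
  using that
proof (induction xs arbitrary: f)
  case Nil
  have "psum ps (\<lambda>y. f (b # y)) (\<tau>(n := b)) = psum ps (\<lambda>y. f (b # y)) \<sigma>" for b
    by (rule psum_cong) (use Nil in auto)
  then show ?case by (simp only: list.map append.simps psum.simps sum.case fun_upd_same)
next
  case (Cons x xs)
  have "(\<tau>(n := b)) x = \<sigma> x" for b using Cons.prems by auto
  moreover have "psum (map Inl xs @ Inr w # ps) f' \<sigma> =
    w False * psum (map Inl xs @ Inl n # ps) f' (\<tau>(n := False)) +
    w True * psum (map Inl xs @ Inl n # ps) f' (\<tau>(n := True))" for f'
    by (rule Cons.IH) (use Cons.prems in auto)
  ultimately show ?case by (simp only: list.map append.simps psum.simps sum.case)
qed

lemma realizable_psum:
  assumes "h \<in> F" "length ps = arity h" "\<And>x. Inl x \<in> set ps \<Longrightarrow> x < n"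
  shows "realizable F n (psum ps (app h))"
proof -
  \<comment> \<open>The arguments in \<open>xs\<close> have already been made variables. The
    induction moves the others over from \<open>ps\<close>, opening a new variable \<open>n\<close>
    for each summed one.\<close>
  have "realizable F n (psum (map Inl xs @ ps) (app h))"
    if "length xs + length ps = arity h" "set xs \<subseteq> {..<n}" "\<And>x. Inl x \<in> set ps \<Longrightarrow> x < n" for xs
    using that
  proof (induction ps arbitrary: xs n)
    case Nil
    then show ?case
      using realizable_app[of h F xs n] assms(1) by (simp add: psum_Inl[abs_def])
  next
    case (Cons p ps)
    show ?case
    proof (cases p)
      case (Inl x)
      then show ?thesis using Cons.IH[of "xs @ [x]" n] Cons.prems by simp
    next
      case (Inr w)
      have "realizable F (Suc n) (psum (map Inl (xs @ [n]) @ ps) (app h))"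
        by (rule Cons.IH) (use Cons.prems in \<open>auto simp: less_Suc_eq\<close>)
      then have "realizable F (Suc n) (\<lambda>\<sigma>. w (\<sigma> n) * psum (map Inl (xs @ [n]) @ ps) (app h) \<sigma>)"
        by (intro realizable_mult realizable_unary) simp
      from realizable_sum[OF this]
      have "realizable F n (\<lambda>\<sigma>. w False * psum (map Inl xs @ Inl n # ps) (app h) (\<sigma>(n := False)) +
          w True * psum (map Inl xs @ Inl n # ps) (app h) (\<sigma>(n := True)))"
        by (simp only: fun_upd_same map_append list.map append.simps append_assoc)
      moreover have "psum (map Inl xs @ Inr w # ps) (app h) =
          (\<lambda>\<sigma>. w False * psum (map Inl xs @ Inl n # ps) (app h) (\<sigma>(n := False)) +
          w True * psum (map Inl xs @ Inl n # ps) (app h) (\<sigma>(n := True)))"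
        by (intro ext psum_append_Inr) (use Cons.prems in \<open>auto simp: Inr\<close>)
      ultimately show ?thesis by (simp only: Inr)
    qed
  qed
  from this[of "[]"] assms show ?thesis by simp
qed

section \<open>Binary functions: from a nondegenerate matrix to OR, NAND and literals\<close>

type_synonym bin = "bool \<Rightarrow> bool \<Rightarrow> complex"

definition bin_realizable :: "constraint set \<Rightarrow> bin \<Rightarrow> bool" where
  "bin_realizable F B \<longleftrightarrow> (\<forall>n. \<forall>i<n. \<forall>j<n. realizable F n (\<lambda>\<sigma>. B (\<sigma> i) (\<sigma> j)))"

lemma bin_realizable_transpose: "bin_realizable F B \<Longrightarrow> bin_realizable F (\<lambda>x y. B y x)"
  unfolding bin_realizable_def by blast

lemma bin_realizable_scale: "bin_realizable F B \<Longrightarrow> bin_realizable F (\<lambda>x y. u x * B x y * w y)"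
  unfolding bin_realizable_def by (intro allI impI realizable_mult) (auto intro: realizable_unary)

text \<open>This is the matrix product of \<open>A\<close>, the diagonal matrix of \<open>w\<close>,
  and \<open>B\<close>; the inner index is the auxiliary variable.\<close>

lemma bin_realizable_chain:
  assumes "bin_realizable F A" "bin_realizable F B"
  shows "bin_realizable F (\<lambda>x y. A x False * w False * B False y + A x True * w True * B True y)"
  unfolding bin_realizable_def
proof (intro allI impI)
  fix n i j :: nat
  assume ij: "i < n" "j < n"
  have "realizable F (Suc n) (\<lambda>\<sigma>. A (\<sigma> i) (\<sigma> n) * w (\<sigma> n) * B (\<sigma> n) (\<sigma> j))"
    using assms ij unfolding bin_realizable_def by (intro realizable_mult realizable_unary) auto
  from realizable_sum[OF this] show "realizable F n (\<lambda>\<sigma>. A (\<sigma> i) False * w False * B False (\<sigma> j)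
      + A (\<sigma> i) True * w True * B True (\<sigma> j))"
    using ij by simp
qed

lemma bin_realizable_cong: "bin_realizable F A \<Longrightarrow> (\<And>x y. A x y = B x y) \<Longrightarrow> bin_realizable F B"
  by (metis (full_types) ext)

text \<open>OR for \<open>r = False\<close> and NAND for \<open>r = True\<close>.\<close>

definition or_like :: "bool \<Rightarrow> bin" where
  "or_like r x y = of_bool (\<not> (x = r \<and> y = r))"

text \<open>With rows \<open>(1, 1)\<close> and \<open>(c, e)\<close>, the matrix \<open>g diag(1, -1) g\<^sup>T\<close> has entry \<open>0\<close> at \<open>(r, r)\<close>, off-diagonal
  entries \<open>c - e\<close> and remaining entry \<open>(c - e) (c + e)\<close>; unary factors normalize it.\<close>

lemma or_like_of_row:
  assumes g: "bin_realizable F g" and row: "g r False = 1" "g r True = 1"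
    and d: "g (\<not> r) False \<noteq> g (\<not> r) True" "g (\<not> r) False + g (\<not> r) True \<noteq> 0"
  shows "bin_realizable F (or_like r)"
proof -
  define c where "c = g (\<not> r) False"
  define e where "e = g (\<not> r) True"
  let ?A = "\<lambda>x y. g x False * (if False then - 1 else 1) * g y False + g x True * (if True then - 1 else 1) * g y True"
  have A: "bin_realizable F ?A"
    using bin_realizable_chain[OF g bin_realizable_transpose[OF g], of "\<lambda>b. if b then - 1 else 1"] by simp
  have ce: "c - e \<noteq> 0" "c + e \<noteq> 0" using d by (simp_all add: c_def e_def)
  let ?u = "\<lambda>x. if x = r then (c + e) else 1"
  have "bin_realizable F (\<lambda>x y. ?u x * ?A x y * (?u y / ((c - e) * (c + e))))"
    by (rule bin_realizable_scale[OF A])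
  then show ?thesis
  proof (rule bin_realizable_cong)
    fix x y
    have "c * c - e * e = (c - e) * (c + e)" by algebra
    then show "?u x * ?A x y * (?u y / ((c - e) * (c + e))) = or_like r x y"
      using ce row by (cases "x = r"; cases "y = r") (auto simp: or_like_def c_def e_def)
  qed
qed

text \<open>Dividing the columns by the entries of row \<open>r\<close> makes that row
  \<open>(1, 1)\<close> and the other one \<open>(a, b)\<close>, with \<open>a \<noteq> b\<close> by
  the determinant. The only obstruction left is \<open>a + b = 0\<close>, and one more matrix
  product removes it.\<close>

lemma or_like_of_full_row:
  assumes g: "bin_realizable F g" and row: "g r False \<noteq> 0" "g r True \<noteq> 0" and d: "detm g \<noteq> 0"
  shows "bin_realizable F (or_like r)"
proof -
  define a where "a = g (\<not> r) False / g r False"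
  define b where "b = g (\<not> r) True / g r True"
  have "g (\<not> r) False * g r True \<noteq> g (\<not> r) True * g r False"
    using d by (cases r) (auto simp: detm_def mult.commute)
  then have ab: "a \<noteq> b"
    using row by (auto simp: a_def b_def field_simps)
  have "bin_realizable F (\<lambda>x y. 1 * g x y * (1 / g r y))"
    by (rule bin_realizable_scale[OF g])
  then have g1: "bin_realizable F (\<lambda>x y. g x y / g r y)" by simp
  show ?thesis
  proof (cases "a + b = 0")
    case False
    then show ?thesis
      using or_like_of_row[OF g1] ab row by (simp add: a_def b_def)
  next
    case True
    define g' where "g' x y = (if x = r then 1 else if y then b else a)" for x y
    have "bin_realizable F g'"
      by (rule bin_realizable_cong[OF g1]) (use row in \<open>auto simp: g'_def a_def b_def\<close>)
    \<comment> \<open>With \<open>b = - a\<close>, the product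
      \<open>g' diag(2, 1) g'\<^sup>T\<close> has entry 3 at \<open>(r, r)\<close>, off-diagonal
      entries \<open>a\<close> and remaining entry \<open>3 * a\<^sup>2\<close>. Dividing column
      \<open>r\<close> by 3 and the other column by \<open>a\<close> gives row \<open>r\<close> the
      entries \<open>(1, 1)\<close> again, while the other row has \<open>a / 3\<close> in column
      \<open>r\<close> and \<open>3 * a\<close> in the other column: distinct, with nonzero
      sum.\<close>
    from bin_realizable_chain[OF this bin_realizable_transpose[OF this], of "\<lambda>b. if b then 1 else 2"]
    have "bin_realizable F (\<lambda>x y. g' x False * 2 * g' y False + g' x True * g' y True)" by simp
    from bin_realizable_scale[OF this, of "\<lambda>_. 1" "\<lambda>y. if y = r then 1 / 3 else 1 / a"]
    have g2: "bin_realizable F (\<lambda>x y. (g' x False * 2 * g' y False + g' x True * g' y True)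
      * (if y = r then 1 / 3 else 1 / a))" by simp
    have b: "b = - a" using True by (simp add: add_eq_0_iff)
    then have "a \<noteq> 0" using ab by auto
    show ?thesis
    proof (rule or_like_of_row[OF g2])
      show "(g' (\<not> r) False * 2 * g' False False + g' (\<not> r) True * g' False True) * (if False = r then 1 / 3 else 1 / a)
         \<noteq> (g' (\<not> r) False * 2 * g' True False + g' (\<not> r) True * g' True True) * (if True = r then 1 / 3 else 1 / a)"
        using \<open>a \<noteq> 0\<close> by (cases r) (auto simp: g'_def b field_simps)
      show "(g' (\<not> r) False * 2 * g' False False + g' (\<not> r) True * g' False True) * (if False = r then 1 / 3 else 1 / a)
         + (g' (\<not> r) False * 2 * g' True False + g' (\<not> r) True * g' True True) * (if True = r then 1 / 3 else 1 / a) \<noteq> 0"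
        using \<open>a \<noteq> 0\<close> by (cases r) (auto simp: g'_def b field_simps)
    qed (use \<open>a \<noteq> 0\<close> in \<open>auto simp: g'_def b field_simps\<close>)
  qed
qed

text \<open>With weight -1 at the middle value \<open>r\<close>, the two paths between
  \<open>\<not> r\<close> and \<open>\<not> r\<close> cancel. Every other pair of ends admits only
  the middle value \<open>\<not> r\<close>, with weight 1.\<close>

lemma or_like_flip:
  assumes "bin_realizable F (or_like r)"
  shows "bin_realizable F (or_like (\<not> r))"
  by (rule bin_realizable_cong[OF bin_realizable_chain[OF assms assms, of "\<lambda>z. if z = r then - 1 else 1"]])
     (cases r; auto simp: or_like_def)

text \<open>At least three of the four entries are nonzero, so some row \<open>q\<close> is full; a
  flip changes \<open>q\<close> into the desired \<open>r\<close> if necessary.\<close>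

lemma or_like_of_nondeg:
  assumes g: "bin_realizable F g" and nd: "nondeg g"
  shows "bin_realizable F (or_like r)"
proof -
  have "\<exists>q. g q False \<noteq> 0 \<and> g q True \<noteq> 0"
    using nd by (auto simp: nondeg_def detm_def ex_bool_eq)
  then obtain q where "bin_realizable F (or_like q)"
    using or_like_of_full_row[OF g] nd by (auto simp: nondeg_def)
  then show ?thesis
    using or_like_flip[of F q] by (cases q; cases r) auto
qed

text \<open>The second argument is a switch, to be an auxiliary variable shared by several
  literals.\<close>

definition literal :: "bool \<Rightarrow> bin" where
  "literal p x y = (if y then of_bool (x = p) else 1)"

lemma bin_realizable_literal:
  assumes "\<And>r. bin_realizable F (or_like r)"
  shows "bin_realizable F (literal p)"
proof (cases p)
  case False
  then show ?thesis
    by (intro bin_realizable_cong[OF assms[of True]]) (auto simp: or_like_def literal_def)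
next
  case True
  \<comment> \<open>OR followed by NAND through a middle variable has rows \<open>(1, 0)\<close> and
    \<open>(2, 1)\<close>; the factors 1/2 on \<open>x\<close> and 2 on \<open>y\<close> turn this
    into the implication from \<open>y\<close> to \<open>x\<close>.\<close>
  have "bin_realizable F (\<lambda>x y. (if x then 1 / 2 else 1) * (or_like False x False * 1 * or_like True False y
      + or_like False x True * 1 * or_like True True y) * (if y then 2 else 1))"
    by (rule bin_realizable_scale, rule bin_realizable_chain[where w = "\<lambda>_. 1", OF assms assms])
  then show ?thesis
    by (rule bin_realizable_cong) (use True in \<open>auto simp: or_like_def literal_def\<close>)
qed

text \<open>With weights \<open>(1, c)\<close> on an auxiliary variable, the sum of the products of three literals is
  \<open>1 + c\<close> at one pattern and \<open>1\<close> elsewhere; every function is a product of such factors.\<close>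

lemma realizable_pattern:
  assumes L: "\<And>p. bin_realizable F (literal p)"
  shows "realizable F 3 (\<lambda>\<sigma>. 1 + c * of_bool (\<sigma> 0 = p0 \<and> \<sigma> 1 = p1 \<and> \<sigma> 2 = p2))"
proof -
  let ?r = "\<lambda>\<sigma>. (if \<sigma> 3 then c else 1) *
    (literal p0 (\<sigma> 0) (\<sigma> 3) * (literal p1 (\<sigma> 1) (\<sigma> 3) * literal p2 (\<sigma> (2::nat)) (\<sigma> 3)))"
  have "realizable F (Suc 3) ?r"
    using L unfolding bin_realizable_def by (intro realizable_mult realizable_unary) auto
  from realizable_sum[OF this] have "realizable F 3 (\<lambda>\<sigma>. ?r (\<sigma>(3 := False)) + ?r (\<sigma>(3 := True)))" .
  moreover have "(\<lambda>\<sigma>. ?r (\<sigma>(3 := False)) + ?r (\<sigma>(3 := True)))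
      = (\<lambda>\<sigma>. 1 + c * of_bool (\<sigma> 0 = p0 \<and> \<sigma> 1 = p1 \<and> \<sigma> 2 = p2))"
    by (auto simp: fun_eq_iff literal_def)
  ultimately show ?thesis by metis
qed

lemma realizable_ternary:
  assumes L: "\<And>p. bin_realizable F (literal p)"
  shows "realizable F 3 (\<lambda>\<sigma>. R (\<sigma> 0) (\<sigma> 1) (\<sigma> 2))"
proof -
  \<comment> \<open>Choosing \<open>c\<close> as \<open>R p0 p1 p2 - 1\<close> makes each pattern
    contribute its value of \<open>R\<close>; zeros of \<open>R\<close> are the case
    \<open>c = -1\<close>.\<close>
  have "realizable F 3 (\<lambda>\<sigma>. \<Prod>p\<in>UNIV. case p of (p0, p1, p2) \<Rightarrow>
      1 + (R p0 p1 p2 - 1) * of_bool (\<sigma> 0 = p0 \<and> \<sigma> 1 = p1 \<and> \<sigma> 2 = p2))"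
  proof (rule realizable_prod)
    fix p :: "bool \<times> bool \<times> bool"
    show "realizable F 3 (\<lambda>\<sigma>. case p of (p0, p1, p2) \<Rightarrow>
      1 + (R p0 p1 p2 - 1) * of_bool (\<sigma> 0 = p0 \<and> \<sigma> 1 = p1 \<and> \<sigma> 2 = p2))"
      by (cases p) (simp only: prod.case realizable_pattern[OF L])
  qed auto
  moreover have "(\<Prod>p\<in>UNIV. case p of (p0, p1, p2) \<Rightarrow>
      1 + (R p0 p1 p2 - 1) * of_bool (\<sigma> 0 = p0 \<and> \<sigma> 1 = p1 \<and> \<sigma> 2 = p2)) = R (\<sigma> 0) (\<sigma> 1) (\<sigma> 2)"
    for \<sigma> :: "nat \<Rightarrow> bool"
  proof -
    have "(\<Prod>p\<in>UNIV. case p of (p0, p1, p2) \<Rightarrow>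
      1 + (R p0 p1 p2 - 1) * of_bool (\<sigma> 0 = p0 \<and> \<sigma> 1 = p1 \<and> \<sigma> 2 = p2))
      = (\<Prod>p\<in>UNIV. if p = (\<sigma> 0, \<sigma> 1, \<sigma> 2) then R (\<sigma> 0) (\<sigma> 1) (\<sigma> 2) else 1)"
      by (rule prod.cong) (auto split: prod.split)
    then show ?thesis by simp
  qed
  ultimately show ?thesis by simp
qed

lemma realizable_ternary_of_not_ED:
  assumes "F \<subseteq> constraints" "\<not> F \<subseteq> ED"
  shows "realizable F 3 (\<lambda>\<sigma>. R (\<sigma> 0) (\<sigma> 1) (\<sigma> 2))"
proof -
  from assms obtain f where f: "f \<in> F" "\<not> factorable (arity f) (app f)"
    unfolding constraints_def using ED_iff_factorable by blast
  from exists_gadget[OF f(2)] obtain ps where ps: "length ps = arity f"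
    "\<forall>x. Inl x \<in> set ps \<longrightarrow> x < 2" "nondeg (\<lambda>a b. psum ps (app f) (two_values a b))" by blast
  have "bin_realizable F (\<lambda>a b. psum ps (app f) (two_values a b))"
    unfolding bin_realizable_def
  proof (intro allI impI)
    fix n i j :: nat
    assume ij: "i < n" "j < n"
    define \<rho> where "\<rho> x = (if x = 0 then i else j)" for x :: nat
    have "realizable F n (psum (map (map_sum \<rho> id) ps) (app f))"
      by (rule realizable_psum[OF f(1)]) (use ps ij in \<open>auto simp: \<rho>_def map_sum_def split: sum.splits\<close>)
    moreover have "psum (map (map_sum \<rho> id) ps) (app f) = (\<lambda>\<sigma>. psum ps (app f) (two_values (\<sigma> i) (\<sigma> j)))"
      by (auto simp: psum_map \<rho>_def two_values_def fun_eq_iff intro!: psum_cong)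
    ultimately show "realizable F n (\<lambda>\<sigma>. psum ps (app f) (two_values (\<sigma> i) (\<sigma> j)))" by simp
  qed
  from or_like_of_nondeg[OF this ps(3)] show ?thesis
    by (intro realizable_ternary bin_realizable_literal)
qed

section \<open>Polynomial-time functions\<close>

text \<open>Big-step semantics for programs without \<open>Flip\<close> and \<open>Query\<close>,
  counting exactly the steps of the machine.\<close>

inductive exec :: "com \<Rightarrow> store \<Rightarrow> nat \<Rightarrow> store \<Rightarrow> bool" where
  exec_Skip: "exec Skip s 1 s"
| exec_Assign: "exec (Assign x e) s 1 (s(x := eval_exp e s))"
| exec_Seq: "exec c s t s' \<Longrightarrow> exec d s' u s'' \<Longrightarrow> exec (Seq c d) s (t + u + 1) s''"
| exec_Cond: "exec (if eval_test b s then c else d) s t s' \<Longrightarrow> exec (Cond b c d) s (t + 1) s'"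
| exec_While_end: "\<not> eval_test b s \<Longrightarrow> exec (While b c) s 1 s"
| exec_While: "eval_test b s \<Longrightarrow> exec c s t s' \<Longrightarrow> exec (While b c) s' u s'' \<Longrightarrow>
    exec (While b c) s (t + u + 1) s''"

text \<open>The waiting commands \<open>K\<close> and the spare steps \<open>n\<close> make the
  statement compose. The oracle \<open>M\<close> is arbitrary, since no rule of \<open>exec\<close>
  consults it.\<close>

lemma exec_run: "exec c s t s' \<Longrightarrow> run M (t + n) (c # K, s) = run M n (K, s')"
proof (induction arbitrary: n K rule: exec.induct)
  case (exec_Seq c s t s' d u s'')
  have "run M (t + u + 1 + n) (Seq c d # K, s) = run M (t + (u + n)) (c # d # K, s)"
    by (simp add: bind_return_pmf add.assoc)
  then show ?case by (simp only: exec_Seq.IH)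
next
  case (exec_Cond b s c d t s')
  have "run M (t + 1 + n) (Cond b c d # K, s) = run M (t + n) ((if eval_test b s then c else d) # K, s)"
    by (simp add: bind_return_pmf)
  then show ?case by (simp only: exec_Cond.IH)
next
  case (exec_While b s c t s' u s'')
  have "run M (t + u + 1 + n) (While b c # K, s) = run M (t + (u + n)) (c # While b c # K, s)"
    using exec_While.hyps by (simp add: bind_return_pmf add.assoc)
  then show ?case by (simp only: exec_While.IH)
qed (simp_all add: bind_return_pmf)

text \<open>The accuracy condition on a reduction concerns every reachable configuration, hence a
  statement about the intermediate steps. The bound is strict because after \<open>t\<close> steps
  the head of \<open>K\<close> may be a query.\<close>

lemma exec_no_query:
  "exec c s t s' \<Longrightarrow> i < t \<Longrightarrow> \<exists>C. run M i (c # K, s) = return_pmf C \<and> pending_query C = None"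
proof (induction arbitrary: i K rule: exec.induct)
  case (exec_Seq c s t s' d u s'')
  show ?case
  proof (cases i)
    case 0
    then show ?thesis by simp
  next
    case (Suc j)
    then have r: "run M i (Seq c d # K, s) = run M j (c # d # K, s)"
      by (simp add: bind_return_pmf)
    show ?thesis
    proof (cases "j < t")
      case True
      then show ?thesis unfolding r by (rule exec_Seq.IH)
    next
      case False
      then obtain m where m: "j = t + m" by (metis add_diff_inverse_nat)
      with exec_Seq.prems Suc have "m < u" by simp
      then show ?thesis unfolding r m exec_run[OF exec_Seq.hyps(1)] by (rule exec_Seq.IH)
    qed
  qed
next
  case (exec_Cond b s c d t s')
  show ?case
  proof (cases i)
    case 0
    then show ?thesis by simp
  next
    case (Suc j)
    then have "run M i (Cond b c d # K, s) = run M j ((if eval_test b s then c else d) # K, s)"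
      by (simp add: bind_return_pmf)
    with exec_Cond Suc show ?thesis by simp
  qed
next
  case (exec_While b s c t s' u s'')
  show ?case
  proof (cases i)
    case 0
    then show ?thesis by simp
  next
    case (Suc j)
    then have r: "run M i (While b c # K, s) = run M j (c # While b c # K, s)"
      using exec_While.hyps by (simp add: bind_return_pmf)
    show ?thesis
    proof (cases "j < t")
      case True
      then show ?thesis unfolding r by (rule exec_While.IH)
    next
      case False
      then obtain m where m: "j = t + m" by (metis add_diff_inverse_nat)
      with exec_While.prems Suc have "m < u" by simp
      then show ?thesis unfolding r m exec_run[OF exec_While.hyps(2)] by (rule exec_While.IH)
    qed
  qed
qed simp_all

section \<open>Programs with polynomial bounds on time and output size\<close>

lemma poly_nat_mono: "a \<le> b \<Longrightarrow> poly (p :: nat poly) a \<le> poly p b"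
  by (induction p) (auto intro: add_mono mult_mono)

lemma le_poly_trans: "x \<le> poly p (a::nat) \<Longrightarrow> a \<le> b \<Longrightarrow> x \<le> poly p b"
  using poly_nat_mono order_trans by blast

text \<open>Input and output are in variable \<open>0\<close>. As the variables from \<open>N\<close> on are left alone, a program can
  save values there while it runs another one.\<close>

definition computes_in :: "com \<Rightarrow> nat \<Rightarrow> nat poly \<Rightarrow> (val \<Rightarrow> val) \<Rightarrow> bool" where
  "computes_in c N p f \<longleftrightarrow> (\<forall>s. \<exists>t s'. exec c s t s' \<and> s' 0 = f (s 0) \<and> (\<forall>i\<ge>N. s' i = s i) \<and>
     t \<le> poly p (vsize (s 0)) \<and> vsize (f (s 0)) \<le> poly p (vsize (s 0)))"

definition ptime :: "(val \<Rightarrow> val) \<Rightarrow> bool" where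
  "ptime f \<longleftrightarrow> (\<exists>c N p. deterministic c \<and> computes_in c N p f)"

lemma ptimeI:
  assumes "deterministic c"
    "\<And>s. \<exists>t s'. exec c s t s' \<and> s' 0 = f (s 0) \<and> (\<forall>i\<ge>N. s' i = s i) \<and> t \<le> poly p (vsize (s 0)) \<and>
      vsize (f (s 0)) \<le> poly q (vsize (s 0))"
  shows "ptime f"
proof -
  have "computes_in c N (p + q) f"
    unfolding computes_in_def
  proof
    fix s :: store
    from assms(2)[of s] show "\<exists>t s'. exec c s t s' \<and> s' 0 = f (s 0) \<and> (\<forall>i\<ge>N. s' i = s i) \<and>
       t \<le> poly (p + q) (vsize (s 0)) \<and> vsize (f (s 0)) \<le> poly (p + q) (vsize (s 0))"
      by (metis poly_add trans_le_add1 trans_le_add2)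
  qed
  with assms(1) show ?thesis unfolding ptime_def by blast
qed

lemma computes_inD:
  assumes "computes_in c N p f"
  shows "\<exists>t s'. exec c s t s' \<and> s' 0 = f (s 0) \<and> (\<forall>i\<ge>N. s' i = s i) \<and> t \<le> poly p (vsize (s 0))"
    and "vsize (f v) \<le> poly p (vsize v)"
proof -
  show "\<exists>t s'. exec c s t s' \<and> s' 0 = f (s 0) \<and> (\<forall>i\<ge>N. s' i = s i) \<and> t \<le> poly p (vsize (s 0))"
    using assms unfolding computes_in_def by blast
  show "vsize (f v) \<le> poly p (vsize v)"
    using assms[unfolded computes_in_def, THEN spec, of "\<lambda>_. v"] by auto
qed

lemma ptime_assign:
  assumes "\<And>s. eval_exp e s = f (s 0)" "\<And>v. vsize (f v) \<le> poly q (vsize v)"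
  shows "ptime f"
proof (rule ptimeI[of "Assign 0 e" _ 1 1 q])
  fix s :: store
  have "exec (Assign 0 e) s 1 (s(0 := f (s 0)))"
    using exec_Assign[of 0 e s] by (simp add: assms(1))
  then show "\<exists>t s'. exec (Assign 0 e) s t s' \<and> s' 0 = f (s 0) \<and> (\<forall>i\<ge>1. s' i = s i) \<and>
      t \<le> poly 1 (vsize (s 0)) \<and> vsize (f (s 0)) \<le> poly q (vsize (s 0))"
    by (intro exI[of _ 1] exI[of _ "s(0 := f (s 0))"] conjI) (simp_all add: assms(2))
qed simp

lemma ptime_comp:
  assumes "ptime f" "ptime g"
  shows "ptime (\<lambda>v. g (f v))"
proof -
  obtain c N p where c1: "deterministic c" and c2: "computes_in c N p f"
    using assms(1) unfolding ptime_def by blast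
  note c = c1 computes_inD[OF c2]
  obtain d M q where d1: "deterministic d" and d2: "computes_in d M q g"
    using assms(2) unfolding ptime_def by blast
  note d = d1 computes_inD[OF d2]
  show ?thesis
  proof (rule ptimeI[of "Seq c d" _ "max N M" "p + pcompose q p + 1" "pcompose q p"])
    fix s :: store
    obtain t s' where 1: "exec c s t s'" "s' 0 = f (s 0)" "\<forall>i\<ge>N. s' i = s i" "t \<le> poly p (vsize (s 0))"
      using c(2) by blast
    obtain u s'' where 2: "exec d s' u s''" "s'' 0 = g (s' 0)" "\<forall>i\<ge>M. s'' i = s' i"
      "u \<le> poly q (vsize (s' 0))"
      using d(2) by blast
    have *: "u \<le> poly q (poly p (vsize (s 0)))" "vsize (g (f (s 0))) \<le> poly q (poly p (vsize (s 0)))"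
      using le_poly_trans[OF 2(4)] le_poly_trans[OF d(3)] c(3) 1(2) by auto
    show "\<exists>t s'. exec (Seq c d) s t s' \<and> s' 0 = g (f (s 0)) \<and> (\<forall>i\<ge>max N M. s' i = s i) \<and>
        t \<le> poly (p + pcompose q p + 1) (vsize (s 0)) \<and>
        vsize (g (f (s 0))) \<le> poly (pcompose q p) (vsize (s 0))"
      using exec_Seq[OF 1(1) 2(1)] 1 2 *
      by (intro exI[of _ "t + u + 1"] exI[of _ s'']) (auto simp: poly_pcompose)
  qed (use c d in simp)
qed

lemma ptime_Cell:
  assumes "ptime f" "ptime g"
  shows "ptime (\<lambda>v. Cell (f v) (g v))"
proof -
  obtain c N p where c1: "deterministic c" and c2: "computes_in c N p f"
    using assms(1) unfolding ptime_def by blast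
  note c = c1 computes_inD[OF c2]
  obtain d M q where d1: "deterministic d" and d2: "computes_in d M q g"
    using assms(2) unfolding ptime_def by blast
  note d = d1 computes_inD[OF d2]
  \<comment> \<open>\<open>L\<close> and \<open>Suc L\<close> lie beyond the variables of both
    programs: the first keeps the input while \<open>c\<close> runs, the second the result of
    \<open>f\<close> while \<open>d\<close> runs.\<close>
  define L where "L = max 1 (max N M)"
  let ?c = "Seq (Assign L (Var 0)) (Seq c (Seq (Assign (Suc L) (Var 0)) (Seq (Assign 0 (Var L))
    (Seq d (Assign 0 (Mk (Var (Suc L)) (Var 0)))))))"
  show ?thesis
  proof (rule ptimeI[of ?c _ "L + 2" "p + q + 9" "p + q + 1"])
    fix s :: store
    define s1 where "s1 = s(L := s 0)"
    obtain t s' where 1: "exec c s1 t s'" "s' 0 = f (s 0)" "\<forall>i\<ge>N. s' i = s1 i" "t \<le> poly p (vsize (s 0))"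
      using c(2)[of s1] by (auto simp: s1_def L_def)
    define s2 where "s2 = s'(Suc L := f (s 0), 0 := s 0)"
    obtain u s'' where 2: "exec d s2 u s''" "s'' 0 = g (s 0)" "\<forall>i\<ge>M. s'' i = s2 i"
      "u \<le> poly q (vsize (s 0))"
      using d(2)[of s2] by (auto simp: s2_def)
    have a: "exec (Assign L (Var 0)) s 1 s1"
      using exec_Assign[of L "Var 0" s] by (simp add: s1_def)
    have b: "exec (Assign (Suc L) (Var 0)) s' 1 (s'(Suc L := f (s 0)))"
      using exec_Assign[of "Suc L" "Var 0" s'] 1 by simp
    have b': "exec (Assign 0 (Var L)) (s'(Suc L := f (s 0))) 1 s2"
      using exec_Assign[of 0 "Var L" "s'(Suc L := f (s 0))"] 1 by (simp add: s2_def s1_def L_def)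
    have e: "exec (Assign 0 (Mk (Var (Suc L)) (Var 0))) s'' 1 (s''(0 := Cell (f (s 0)) (g (s 0))))"
      using exec_Assign[of 0 "Mk (Var (Suc L)) (Var 0)" s''] 2 by (simp add: s2_def L_def)
    have x: "exec ?c s (1 + (t + (1 + (1 + (u + 1 + 1) + 1) + 1) + 1) + 1) (s''(0 := Cell (f (s 0)) (g (s 0))))"
      by (rule exec_Seq[OF a exec_Seq[OF 1(1) exec_Seq[OF b exec_Seq[OF b' exec_Seq[OF 2(1) e]]]]])
    show "\<exists>t s'. exec ?c s t s' \<and> s' 0 = Cell (f (s 0)) (g (s 0)) \<and> (\<forall>i\<ge>L + 2. s' i = s i) \<and>
        t \<le> poly (p + q + 9) (vsize (s 0)) \<and>
        vsize (Cell (f (s 0)) (g (s 0))) \<le> poly (p + q + 1) (vsize (s 0))"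
    proof (intro exI conjI)
      show "exec ?c s (1 + (t + (1 + (1 + (u + 1 + 1) + 1) + 1) + 1) + 1) (s''(0 := Cell (f (s 0)) (g (s 0))))"
        by (rule x)
      show "1 + (t + (1 + (1 + (u + 1 + 1) + 1) + 1) + 1) + 1 \<le> poly (p + q + 9) (vsize (s 0))"
        using 1(4) 2(4) by simp
      show "vsize (Cell (f (s 0)) (g (s 0))) \<le> poly (p + q + 1) (vsize (s 0))"
        using add_mono[OF c(3)[of "s 0"] d(3)[of "s 0"]] by simp
      show "\<forall>i\<ge>L + 2. (s''(0 := Cell (f (s 0)) (g (s 0)))) i = s i"
        using 1(3) 2(3) by (auto simp: s2_def s1_def L_def)
    qed simp
  qed (use c d in simp)
qed

lemma ptime_id: "ptime (\<lambda>v. v)"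
  by (rule ptime_assign[of "Var 0" _ "[:0, 1:]"]) simp_all

lemma ptime_const: "ptime (\<lambda>v. K)"
proof (induction K)
  case (Num z)
  show ?case by (rule ptime_assign[of "Const z" _ 1]) simp_all
next
  case Null
  show ?case by (rule ptime_assign[of Empty _ 1]) simp_all
next
  case (Cell a b)
  then show ?case by (rule ptime_Cell)
qed

lemma vsize_pos: "1 \<le> vsize v"
  by (cases v) auto

lemma vsize_left: "vsize (left v) \<le> vsize v" and vsize_right: "vsize (right v) \<le> vsize v"
  by (cases v; simp)+

lemma vsize_left_right: "vsize (left v) + vsize (right v) \<le> vsize v + 1"
  by (cases v) auto

lemma ptime_left: "ptime f \<Longrightarrow> ptime (\<lambda>v. left (f v))"
  by (erule ptime_comp, rule ptime_assign[of "Fst (Var 0)" _ "[:0, 1:]"]) (simp_all add: vsize_left)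

lemma ptime_right: "ptime f \<Longrightarrow> ptime (\<lambda>v. right (f v))"
  by (erule ptime_comp, rule ptime_assign[of "Snd (Var 0)" _ "[:0, 1:]"]) (simp_all add: vsize_right)

definition ptime_num :: "(val \<Rightarrow> complex) \<Rightarrow> bool" where
  "ptime_num e \<longleftrightarrow> ptime (\<lambda>v. Num (e v))"

lemma ptime_Num: "ptime_num e \<Longrightarrow> ptime (\<lambda>v. Num (e v))"
  by (simp add: ptime_num_def)

lemma ptime_num_num: "ptime f \<Longrightarrow> ptime_num (\<lambda>v. num (f v))"
  unfolding ptime_num_def
  by (erule ptime_comp, rule ptime_assign[of "Add (Const 0) (Var 0)" _ 1]) simp_all

lemma ptime_num_const: "ptime_num (\<lambda>v. c)"
  unfolding ptime_num_def by (rule ptime_const)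

lemma ptime_num_arith:
  assumes "ptime_num e" "ptime_num d"
  shows ptime_num_add: "ptime_num (\<lambda>v. e v + d v)" and ptime_num_diff: "ptime_num (\<lambda>v. e v - d v)"
    and ptime_num_mult: "ptime_num (\<lambda>v. e v * d v)" and ptime_num_div: "ptime_num (\<lambda>v. e v / d v)"
proof -
  have *: "ptime (\<lambda>v. Cell (Num (e v)) (Num (d v)))"
    using assms unfolding ptime_num_def by (rule ptime_Cell)
  have "ptime (\<lambda>w. Num (num (left w) + num (right w)))"
    by (rule ptime_assign[of "Add (Fst (Var 0)) (Snd (Var 0))" _ 1]) simp_all
  from ptime_comp[OF * this] show "ptime_num (\<lambda>v. e v + d v)" by (simp add: ptime_num_def)
  have "ptime (\<lambda>w. Num (num (left w) - num (right w)))"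
    by (rule ptime_assign[of "Sub (Fst (Var 0)) (Snd (Var 0))" _ 1]) simp_all
  from ptime_comp[OF * this] show "ptime_num (\<lambda>v. e v - d v)" by (simp add: ptime_num_def)
  have "ptime (\<lambda>w. Num (num (left w) * num (right w)))"
    by (rule ptime_assign[of "Mult (Fst (Var 0)) (Snd (Var 0))" _ 1]) simp_all
  from ptime_comp[OF * this] show "ptime_num (\<lambda>v. e v * d v)" by (simp add: ptime_num_def)
  have "ptime (\<lambda>w. Num (num (left w) / num (right w)))"
    by (rule ptime_assign[of "Div (Fst (Var 0)) (Snd (Var 0))" _ 1]) simp_all
  from ptime_comp[OF * this] show "ptime_num (\<lambda>v. e v / d v)" by (simp add: ptime_num_def)
qed

definition ptime_test :: "(val \<Rightarrow> bool) \<Rightarrow> bool" where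
  "ptime_test b \<longleftrightarrow> ptime (\<lambda>v. Num (of_bool (b v)))"

lemma ptime_test:
  assumes "\<And>s. eval_test b s \<longleftrightarrow> B (s 0)" "order_free b"
  shows "ptime_test B"
  unfolding ptime_test_def
proof (rule ptimeI[of "Cond b (Assign 0 (Const 1)) (Assign 0 (Const 0))" _ 1 2 1])
  fix s :: store
  let ?e = "Const (if B (s 0) then 1 else 0)"
  have "exec (if eval_test b s then Assign 0 (Const 1) else Assign 0 (Const 0)) s 1 (s(0 := eval_exp ?e s))"
    using exec_Assign[of 0 ?e s] by (cases "B (s 0)") (simp_all add: assms)
  from exec_Cond[OF this] show "\<exists>t s'. exec (Cond b (Assign 0 (Const 1)) (Assign 0 (Const 0))) s t s' \<and>
      s' 0 = Num (of_bool (B (s 0))) \<and> (\<forall>i\<ge>1. s' i = s i) \<and> t \<le> poly 2 (vsize (s 0)) \<and>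
      vsize (Num (of_bool (B (s 0)))) \<le> poly 1 (vsize (s 0))"
    by (intro exI[of _ "1 + 1"] exI[of _ "s(0 := eval_exp ?e s)"] conjI) auto
qed (use assms in simp)

primrec isc :: "val \<Rightarrow> bool" where
  "isc (Num z) \<longleftrightarrow> False"
| "isc Null \<longleftrightarrow> False"
| "isc (Cell a b) \<longleftrightarrow> True"

lemma isc_iff: "isc v \<longleftrightarrow> (\<exists>a b. v = Cell a b)"
  by (cases v) auto

lemma ptime_test_comp: "ptime f \<Longrightarrow> ptime_test b \<Longrightarrow> ptime_test (\<lambda>v. b (f v))"
  unfolding ptime_test_def by (rule ptime_comp)

lemma ptime_test_isc: "ptime f \<Longrightarrow> ptime_test (\<lambda>v. isc (f v))"
  by (erule ptime_test_comp, rule ptime_test[of "IsCell (Var 0)"]) (simp_all add: isc_iff)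

lemma ptime_test_eq: "ptime_num e \<Longrightarrow> ptime_num d \<Longrightarrow> ptime_test (\<lambda>v. e v = d v)"
proof -
  assume "ptime_num e" "ptime_num d"
  then have *: "ptime (\<lambda>v. Cell (Num (e v)) (Num (d v)))"
    unfolding ptime_num_def by (rule ptime_Cell)
  have "ptime_test (\<lambda>w. num (left w) = num (right w))"
    by (rule ptime_test[of "Equal (Fst (Var 0)) (Snd (Var 0))"]) simp_all
  from ptime_test_comp[OF * this] show ?thesis by simp
qed

lemma ptime_if:
  assumes "ptime_test b" "ptime f" "ptime g"
  shows "ptime (\<lambda>v. if b v then f v else g v)"
proof -
  \<comment> \<open>The truth value travels together with the input, so that the chosen branch still
    finds the input after the test has overwritten variable \<open>0\<close>.\<close>
  from assms(1) have bb: "ptime (\<lambda>v. Cell (Num (of_bool (b v))) v)"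
    unfolding ptime_test_def by (rule ptime_Cell[OF _ ptime_id])
  obtain c N p where c1: "deterministic c" and c2: "computes_in c N p f"
    using assms(2) unfolding ptime_def by blast
  note c = c1 computes_inD[OF c2]
  obtain d M q where d1: "deterministic d" and d2: "computes_in d M q g"
    using assms(3) unfolding ptime_def by blast
  note d = d1 computes_inD[OF d2]
  let ?c = "Cond (Equal (Fst (Var 0)) (Const 1)) (Seq (Assign 0 (Snd (Var 0))) c) (Seq (Assign 0 (Snd (Var 0))) d)"
  have "ptime (\<lambda>w. if num (left w) = 1 then f (right w) else g (right w))"
  proof (rule ptimeI[of ?c _ "max N (max M 1)" "p + q + 3" "p + q"])
    fix s :: store
    let ?s = "s(0 := right (s 0))"
    have a: "exec (Assign 0 (Snd (Var 0))) s 1 ?s"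
      using exec_Assign[of 0 "Snd (Var 0)" s] by simp
    let ?b = "num (left (s 0)) = 1"
    have "\<exists>t s'. exec (if ?b then c else d) ?s t s' \<and> s' 0 = (if ?b then f (right (s 0)) else g (right (s 0))) \<and>
        (\<forall>i\<ge>max N M. s' i = ?s i) \<and> t \<le> poly (p + q) (vsize (right (s 0)))"
      using c(2)[of ?s] d(2)[of ?s] by fastforce
    then obtain t s' where 1: "exec (if ?b then c else d) ?s t s'"
      "s' 0 = (if ?b then f (right (s 0)) else g (right (s 0)))"
      "\<forall>i\<ge>max N M. s' i = ?s i" "t \<le> poly (p + q) (vsize (right (s 0)))" by blast
    have "exec (if eval_test (Equal (Fst (Var 0)) (Const 1)) s then Seq (Assign 0 (Snd (Var 0))) c
       else Seq (Assign 0 (Snd (Var 0))) d) s (1 + t + 1) s'"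
      using exec_Seq[OF a 1(1)] by (auto split: if_splits)
    note x = exec_Cond[OF this]
    have "t \<le> poly (p + q) (vsize (s 0))" by (rule le_poly_trans[OF 1(4) vsize_right])
    moreover have "vsize (if ?b then f (right (s 0)) else g (right (s 0))) \<le> poly (p + q) (vsize (s 0))"
      using le_poly_trans[OF c(3)[of "right (s 0)"] vsize_right] le_poly_trans[OF d(3)[of "right (s 0)"] vsize_right]
      by (simp add: trans_le_add1 trans_le_add2)
    ultimately show "\<exists>t s'. exec ?c s t s' \<and> s' 0 = (if ?b then f (right (s 0)) else g (right (s 0))) \<and>
        (\<forall>i\<ge>max N (max M 1). s' i = s i) \<and> t \<le> poly (p + q + 3) (vsize (s 0)) \<and>
        vsize (if ?b then f (right (s 0)) else g (right (s 0))) \<le> poly (p + q) (vsize (s 0))"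
      using x 1 by (intro exI[of _ "1 + t + 1 + 1"] exI[of _ s'] conjI) auto
  qed (use c d in simp)
  from ptime_comp[OF bb this] show ?thesis
    by (rule back_subst[of ptime]) (auto simp: fun_eq_iff)
qed

lemma ptime_num_if: "ptime_test b \<Longrightarrow> ptime_num e \<Longrightarrow> ptime_num d \<Longrightarrow> ptime_num (\<lambda>v. if b v then e v else d v)"
  unfolding ptime_num_def using ptime_if[of b "\<lambda>v. Num (e v)" "\<lambda>v. Num (d v)"] by (simp add: if_distrib[of Num])

lemma ptime_test_conj: "ptime_test a \<Longrightarrow> ptime_test b \<Longrightarrow> ptime_test (\<lambda>v. a v \<and> b v)"
  unfolding ptime_test_def
  using ptime_num_mult[unfolded ptime_num_def, of "\<lambda>v. of_bool (a v)" "\<lambda>v. of_bool (b v)"] by (simp add: of_bool_conj)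

lemma ptime_test_not: "ptime_test a \<Longrightarrow> ptime_test (\<lambda>v. \<not> a v)"
  unfolding ptime_test_def
  using ptime_num_diff[unfolded ptime_num_def, OF ptime_const[of "Num 1"], of "\<lambda>v. of_bool (a v)"] by (simp add: of_bool_not_iff)

lemma ptime_test_disj: "ptime_test a \<Longrightarrow> ptime_test b \<Longrightarrow> ptime_test (\<lambda>v. a v \<or> b v)"
  using ptime_test_not[OF ptime_test_conj[OF ptime_test_not ptime_test_not], of a b] by simp

section \<open>Loops, folds and recursion on trees\<close>

inductive iterates :: "(val \<Rightarrow> val) \<Rightarrow> nat \<Rightarrow> nat \<Rightarrow> val \<Rightarrow> val \<Rightarrow> bool" for g B where
  iterates_0: "vsize S \<le> B \<Longrightarrow> iterates g B 0 S S"
| iterates_Suc: "isc (left S) \<Longrightarrow> vsize S \<le> B \<Longrightarrow> iterates g B n (g S) S' \<Longrightarrow> iterates g B (Suc n) S S'"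

lemma iterates_mono: "iterates g B n S S' \<Longrightarrow> B \<le> C \<Longrightarrow> iterates g C n S S'"
  by (induction rule: iterates.induct) (auto intro: iterates.intros order_trans)

lemma iterates_trans: "iterates g B n S S' \<Longrightarrow> iterates g B m S' S'' \<Longrightarrow> iterates g B (n + m) S S''"
  by (induction rule: iterates.induct) (auto intro: iterates.intros)

lemma iterates_end: "iterates g B n S S' \<Longrightarrow> vsize S' \<le> B"
  by (induction rule: iterates.induct) auto

text \<open>Every state on the way has size at most \<open>B\<close>, so each round costs at most
  \<open>poly q B + 1\<close>; the last 1 is the failing test.\<close>

lemma iterates_exec:
  assumes "iterates g B n S S'" "computes_in c N q g" "\<not> isc (left S')" "s 0 = S"
  shows "\<exists>t s'. exec (While (IsCell (Fst (Var 0))) c) s t s' \<and> s' 0 = S' \<and> (\<forall>i\<ge>N. s' i = s i) \<and>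
    t \<le> n * (poly q B + 1) + 1"
  using assms(1,3,4)
proof (induction arbitrary: s rule: iterates.induct)
  case (iterates_0 S)
  then have "exec (While (IsCell (Fst (Var 0))) c) s 1 s"
    by (intro exec_While_end) (simp add: isc_iff)
  with iterates_0 show ?case by (intro exI[of _ 1] exI[of _ s]) simp
next
  case (iterates_Suc S n S')
  obtain t s' where 1: "exec c s t s'" "s' 0 = g S" "\<forall>i\<ge>N. s' i = s i" "t \<le> poly q (vsize S)"
    using computes_inD(1)[OF assms(2), of s] iterates_Suc.prems by auto
  obtain u s'' where 2: "exec (While (IsCell (Fst (Var 0))) c) s' u s''" "s'' 0 = S'"
    "\<forall>i\<ge>N. s'' i = s' i" "u \<le> n * (poly q B + 1) + 1"
    using iterates_Suc.IH[where s = s'] iterates_Suc.prems(1) 1(2) by auto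
  have "exec (While (IsCell (Fst (Var 0))) c) s (t + u + 1) s''"
    using iterates_Suc by (intro exec_While[OF _ 1(1) 2(1)]) (simp add: isc_iff)
  moreover have "t \<le> poly q B" using le_poly_trans[OF 1(4)] iterates_Suc.hyps by blast
  ultimately show ?case using 1 2 by (intro exI[of _ "t + u + 1"] exI[of _ s'']) auto
qed

lemma ptime_while:
  assumes "ptime h" "ptime g"
    and L: "\<And>v. \<exists>n \<le> poly p (vsize v). iterates g (poly p (vsize v)) n (h v) (L v) \<and> \<not> isc (left (L v))"
  shows "ptime L"
proof -
  obtain c N p1 where c1: "deterministic c" and c2: "computes_in c N p1 h"
    using assms(1) unfolding ptime_def by blast
  obtain d M p2 where d1: "deterministic d" and d2: "computes_in d M p2 g"
    using assms(2) unfolding ptime_def by blast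
  let ?W = "While (IsCell (Fst (Var 0))) d"
  show ?thesis
  proof (rule ptimeI[of "Seq c ?W" _ "max N M" "p1 + p * (pcompose p2 p + 1) + 2" p])
    fix s :: store
    obtain t s' where 1: "exec c s t s'" "s' 0 = h (s 0)" "\<forall>i\<ge>N. s' i = s i" "t \<le> poly p1 (vsize (s 0))"
      using computes_inD(1)[OF c2] by blast
    obtain n where n: "n \<le> poly p (vsize (s 0))" "iterates g (poly p (vsize (s 0))) n (h (s 0)) (L (s 0))"
      "\<not> isc (left (L (s 0)))" using L by blast
    obtain u s'' where 2: "exec ?W s' u s''" "s'' 0 = L (s 0)" "\<forall>i\<ge>M. s'' i = s' i"
      "u \<le> n * (poly p2 (poly p (vsize (s 0))) + 1) + 1"
      using iterates_exec[where s = s', OF n(2) d2 n(3) 1(2)] by blast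
    have "u \<le> poly p (vsize (s 0)) * (poly p2 (poly p (vsize (s 0))) + 1) + 1"
      using 2(4) mult_right_mono[OF n(1), of "poly p2 (poly p (vsize (s 0))) + 1"] by linarith
    moreover have "vsize (L (s 0)) \<le> poly p (vsize (s 0))"
      by (rule iterates_end[OF n(2)])
    ultimately show "\<exists>t s'. exec (Seq c ?W) s t s' \<and> s' 0 = L (s 0) \<and> (\<forall>i\<ge>max N M. s' i = s i) \<and>
        t \<le> poly (p1 + p * (pcompose p2 p + 1) + 2) (vsize (s 0)) \<and> vsize (L (s 0)) \<le> poly p (vsize (s 0))"
      using exec_Seq[OF 1(1) 2(1)] 1 2
      by (intro exI[of _ "t + u + 1"] exI[of _ s'']) (auto simp: poly_pcompose)
  qed (use c1 d1 in simp)
qed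

text \<open>Several arguments are packed into one tree. A function is shown to be
  \<open>ptime\<close> once in packed form, and these rules then admit arbitrary
  \<open>ptime\<close> arguments.\<close>

lemma ptime2: "ptime (\<lambda>w. f (left w) (right w)) \<Longrightarrow> ptime a \<Longrightarrow> ptime b \<Longrightarrow> ptime (\<lambda>v. f (a v) (b v))"
  using ptime_comp[OF ptime_Cell[of a b], of "\<lambda>w. f (left w) (right w)"] by simp

lemma ptime_test2: "ptime_test (\<lambda>w. f (left w) (right w)) \<Longrightarrow> ptime a \<Longrightarrow> ptime b \<Longrightarrow> ptime_test (\<lambda>v. f (a v) (b v))"
  using ptime_test_comp[OF ptime_Cell[of a b], of "\<lambda>w. f (left w) (right w)"] by simp

lemma ptime3: "ptime (\<lambda>w. f (left w) (left (right w)) (right (right w))) \<Longrightarrow> ptime a \<Longrightarrow> ptime b \<Longrightarrow> ptime c \<Longrightarrow>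
    ptime (\<lambda>v. f (a v) (b v) (c v))"
  using ptime_comp[OF ptime_Cell[OF _ ptime_Cell, of a b c], of "\<lambda>w. f (left w) (left (right w)) (right (right w))"]
  by simp

lemma ptime4: "ptime (\<lambda>w. f (left w) (left (right w)) (left (right (right w))) (right (right (right w)))) \<Longrightarrow>
    ptime a \<Longrightarrow> ptime b \<Longrightarrow> ptime c \<Longrightarrow> ptime d \<Longrightarrow> ptime (\<lambda>v. f (a v) (b v) (c v) (d v))"
  using ptime_comp[OF ptime_Cell[OF _ ptime_Cell[OF _ ptime_Cell], of a b c d],
    of "\<lambda>w. f (left w) (left (right w)) (left (right (right w))) (right (right (right w)))"]
  by simp

lemmas ptime_basics = ptime_Cell ptime_left ptime_right ptime_Num ptime_num_if ptime_num_num ptime_num_add ptime_num_diff ptime_num_mult ptime_num_div ptime_num_const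
  ptime_test_isc ptime_test_conj ptime_test_disj ptime_test_not ptime_test_eq ptime_if ptime_id ptime_const

text \<open>The step function receives the whole remaining list and not just its head: splitting off
  a variable of a table has to look at the later variables.\<close>

fun vfold :: "(val \<Rightarrow> val \<Rightarrow> val) \<Rightarrow> val \<Rightarrow> val \<Rightarrow> val" where
  "vfold G (Cell a b) acc = vfold G b (G (Cell a b) acc)"
| "vfold G Null acc = acc"
| "vfold G (Num z) acc = acc"

primrec vlen :: "val \<Rightarrow> nat" where
  "vlen (Cell a b) = Suc (vlen b)"
| "vlen Null = 0"
| "vlen (Num z) = 0"

lemma vlen_le: "vlen l \<le> vsize l"
  by (induction l) auto

lemma ptime_poly: "ptime f \<Longrightarrow> \<exists>p. \<forall>v. vsize (f v) \<le> poly p (vsize v)"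
  unfolding ptime_def using computes_inD(2) by blast

text \<open>A polynomial size bound for one step may compound over the rounds. The invariant
  \<open>I\<close> therefore has to bound every accumulator in terms of the original input
  \<open>v\<close>, typically by charging growth against the rest of the list.\<close>

lemma ptime_fold:
  assumes G: "ptime (\<lambda>w. G (left w) (left (right w)) (right (right w)))" and l: "ptime l" and a: "ptime a"
    and I0: "\<And>v. I v (l v) (a v)"
    and I1: "\<And>v x y acc. I v (Cell x y) acc \<Longrightarrow> I v y (G v (Cell x y) acc)"
    and I2: "\<And>v l acc. I v l acc \<Longrightarrow> vsize acc \<le> poly q (vsize v)"
  shows "ptime (\<lambda>v. vfold (G v) (l v) (a v))"
proof -
  define g where "g S = Cell (right (left S)) (Cell (left (right S))
    (G (left (right S)) (left S) (right (right S))))" for S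
  obtain p where p: "\<And>v. vsize (l v) \<le> poly p (vsize v)" using ptime_poly[OF l] by blast
  have run: "\<exists>e. iterates g (vsize l + vsize v + poly q (vsize v) + 2) (vlen l) (Cell l (Cell v acc))
      (Cell e (Cell v (vfold (G v) l acc))) \<and> \<not> isc e" if "I v l acc" for v l acc
    using that
  proof (induction l arbitrary: acc)
    case (Cell x y)
    have "\<exists>e. iterates g (vsize y + vsize v + poly q (vsize v) + 2) (vlen y) (Cell y (Cell v (G v (Cell x y) acc)))
      (Cell e (Cell v (vfold (G v) y (G v (Cell x y) acc)))) \<and> \<not> isc e"
      by (rule Cell.IH(2)) (rule I1[OF Cell.prems])
    then obtain e where e: "iterates g (vsize y + vsize v + poly q (vsize v) + 2) (vlen y)
      (Cell y (Cell v (G v (Cell x y) acc)))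
      (Cell e (Cell v (vfold (G v) y (G v (Cell x y) acc))))" "\<not> isc e" by blast
    have "iterates g (vsize (Cell x y) + vsize v + poly q (vsize v) + 2) (Suc (vlen y)) (Cell (Cell x y) (Cell v acc))
      (Cell e (Cell v (vfold (G v) (Cell x y) acc)))"
      using I2[OF Cell.prems] iterates_mono[OF e(1)] by (intro iterates_Suc) (auto simp: g_def)
    with e(2) show ?case by auto
  qed (use I2 in \<open>force intro: iterates_0\<close>)+
  have "ptime g"
    unfolding g_def by (intro ptime_basics ptime3[OF G])
  \<comment> \<open>Choice only names the final state. Its first component depends on whether the
    list ends in \<open>Null\<close> or in a number, and does not matter.\<close>
  define L where "L v = (SOME S. iterates g (vsize (l v) + vsize v + poly q (vsize v) + 2) (vlen (l v))
    (Cell (l v) (Cell v (a v))) S \<and> \<not> isc (left S) \<and> right (right S) = vfold (G v) (l v) (a v))" for v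
  have L: "iterates g (vsize (l v) + vsize v + poly q (vsize v) + 2) (vlen (l v))
    (Cell (l v) (Cell v (a v))) (L v) \<and> \<not> isc (left (L v)) \<and> right (right (L v)) = vfold (G v) (l v) (a v)" for v
    unfolding L_def by (rule someI_ex) (use run[OF I0, of v] in force)
  have "ptime L"
  proof (rule ptime_while[OF _ \<open>ptime g\<close>, of _ "p + [:2, 1:] + q"])
    show "ptime (\<lambda>v. Cell (l v) (Cell v (a v)))" by (intro ptime_basics l a)
    fix v
    show "\<exists>n\<le>poly (p + [:2, 1:] + q) (vsize v). iterates g (poly (p + [:2, 1:] + q) (vsize v)) n
      (Cell (l v) (Cell v (a v))) (L v) \<and> \<not> isc (left (L v))"
      using L[of v] p[of v] vlen_le[of "l v"]
      by (intro exI[of _ "vlen (l v)"] conjI) (auto elim!: iterates_mono)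
  qed
  from ptime_right[OF ptime_right[OF this]] show ?thesis
    using L by simp
qed

text \<open>The recursion is run on a stack of tasks: \<open>Cell Null v\<close> asks for \<open>R e v\<close>, and
  \<open>Cell (Cell Null Null) v\<close> asks to combine the two topmost results.\<close>

lemma ptime_rec:
  assumes eq: "\<And>e v. R e v = (if leaf e v then L e v else N e v (R e (A e v)) (R e (B e v)))"
    and leaf: "ptime_test (\<lambda>w. leaf (left w) (right w))" and PL: "ptime (\<lambda>w. L (left w) (right w))"
    and PA: "ptime (\<lambda>w. A (left w) (right w))" and ptime_test: "ptime (\<lambda>w. B (left w) (right w))"
    and ptime_num: "ptime (\<lambda>w. N (left w) (left (right w)) (left (right (right w))) (right (right (right w))))"
    and \<mu>: "\<And>e v. \<not> leaf e v \<Longrightarrow> \<mu> (A e v) + \<mu> (B e v) < (\<mu> v :: nat)" "\<And>v. \<mu> v \<le> vsize v"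
    and A: "\<And>e v. \<not> leaf e v \<Longrightarrow> vsize (A e v) \<le> vsize v"
    and B: "\<And>e v. \<not> leaf e v \<Longrightarrow> vsize (B e v) \<le> vsize v"
    and R: "\<And>e v. vsize (R e v) \<le> poly q (vsize e + vsize v)"
    and a: "ptime a" and b: "ptime b"
  shows "ptime (\<lambda>v. R (a v) (b v))"
proof -
  let ?e = "\<lambda>S. left (right S)" and ?v = "\<lambda>S. right (left (left S))" and ?W = "\<lambda>S. right (left S)"
    and ?V = "\<lambda>S. right (right S)"
  \<comment> \<open>The result for \<open>B\<close> lies above that for \<open>A\<close> on the
    stack of results, which explains the order of the arguments of \<open>N\<close>.\<close>
  define g where "g S = (if isc (left (left (left S)))
      then Cell (?W S) (Cell (?e S) (Cell (N (?e S) (?v S) (left (right (?V S))) (left (?V S))) (right (right (?V S)))))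
      else if leaf (?e S) (?v S) then Cell (?W S) (Cell (?e S) (Cell (L (?e S) (?v S)) (?V S)))
      else Cell (Cell (Cell Null (A (?e S) (?v S))) (Cell (Cell Null (B (?e S) (?v S)))
        (Cell (Cell (Cell Null Null) (?v S)) (?W S)))) (Cell (?e S) (?V S)))" for S
  have "ptime g"
    unfolding g_def by (intro ptime_basics ptime_test2[OF leaf] ptime2[OF PL] ptime2[OF PA] ptime2[OF ptime_test] ptime4[OF ptime_num])
  \<comment> \<open>An inner node costs one round to expand and one to combine. As the measures of
    its two parts add up to less than its own, \<open>3 * \<mu> v + 1\<close> absorbs both
    rounds.\<close>
  have run: "\<exists>n \<le> 3 * \<mu> v + 1. iterates g (vsize W + vsize V + vsize e + 3 + (3 * \<mu> v + 2) * (K + poly q (vsize e + K) + 6)) n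
      (Cell (Cell (Cell Null v) W) (Cell e V)) (Cell W (Cell e (Cell (R e v) V)))"
    if "vsize v \<le> K" for e v W V K
    using that
  proof (induction "\<mu> v" arbitrary: v W V rule: less_induct)
    case less
    \<comment> \<open>\<open>D\<close> bounds what a single task or a single result adds to the
      state.\<close>
    define D where "D = K + poly q (vsize e + K) + 6"
    have Rs: "vsize (R e u) \<le> poly q (vsize e + K)" if "vsize u \<le> K" for u
      using that by (intro le_poly_trans[OF R]) simp
    show ?case
    proof (cases "leaf e v")
      case True
      have "iterates g (vsize W + vsize V + vsize e + 3 + (3 * \<mu> v + 2) * D) (Suc 0)
        (Cell (Cell (Cell Null v) W) (Cell e V)) (Cell W (Cell e (Cell (R e v) V)))"
        using True Rs[OF less.prems] less.prems by (intro iterates_Suc) (auto simp: g_def eq[of e v] D_def intro!: iterates_0)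
      then show ?thesis by (intro exI[of _ "Suc 0"]) (simp add: D_def)
    next
      case False
      note m = \<mu>(1)[OF False]
      let ?A = "A e v" and ?B = "B e v"
      have AK: "vsize ?A \<le> K" "vsize ?B \<le> K" using A[OF False] B[OF False] less.prems by auto
      let ?W2 = "Cell (Cell (Cell Null Null) v) W"
      let ?W1 = "Cell (Cell Null ?B) ?W2"
      let ?bd = "vsize W + vsize V + vsize e + 3 + (3 * \<mu> v + 2) * D"
      obtain n1 where n1: "n1 \<le> 3 * \<mu> ?A + 1" "iterates g (vsize ?W1 + vsize V + vsize e + 3 + (3 * \<mu> ?A + 2) * D) n1
         (Cell (Cell (Cell Null ?A) ?W1) (Cell e V)) (Cell ?W1 (Cell e (Cell (R e ?A) V)))"
        using less.hyps[OF _ AK(1), of ?W1 V] m by (auto simp: D_def)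
      obtain n2 where n2: "n2 \<le> 3 * \<mu> ?B + 1" "iterates g (vsize ?W2 + vsize (Cell (R e ?A) V) + vsize e + 3 + (3 * \<mu> ?B + 2) * D) n2
         (Cell (Cell (Cell Null ?B) ?W2) (Cell e (Cell (R e ?A) V))) (Cell ?W2 (Cell e (Cell (R e ?B) (Cell (R e ?A) V))))"
        using less.hyps[OF _ AK(2), of ?W2 "Cell (R e ?A) V"] m by (auto simp: D_def)
      obtain k where k: "\<mu> v = Suc k" "\<mu> ?A \<le> k" "\<mu> ?B \<le> k" using m by (cases "\<mu> v") auto
      have mA: "\<mu> ?A * D \<le> k * D" "\<mu> ?B * D \<le> k * D" using k by (auto intro: mult_right_mono)
      have bd: "?bd = vsize W + vsize V + vsize e + 3 + 3 * (k * D) + 5 * D"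
        by (simp add: k algebra_simps)
      have e1: "(3 * m + 2) * D = 3 * (m * D) + 2 * D" for m :: nat
        by (simp add: algebra_simps)
      have b1: "vsize ?W1 + vsize V + vsize e + 3 + (3 * \<mu> ?A + 2) * D \<le> ?bd"
        unfolding bd unfolding e1 vsize.simps using mA AK less.prems D_def by linarith
      have b2: "vsize ?W2 + vsize (Cell (R e ?A) V) + vsize e + 3 + (3 * \<mu> ?B + 2) * D \<le> ?bd"
        unfolding bd unfolding e1 vsize.simps using mA AK less.prems Rs[OF AK(1)] D_def by linarith
      have r3: "iterates g ?bd (Suc 0) (Cell ?W2 (Cell e (Cell (R e ?B) (Cell (R e ?A) V)))) (Cell W (Cell e (Cell (R e v) V)))"
      proof (intro iterates_Suc)
        show "vsize (Cell ?W2 (Cell e (Cell (R e ?B) (Cell (R e ?A) V)))) \<le> ?bd"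
          unfolding bd unfolding vsize.simps using less.prems Rs[OF AK(1)] Rs[OF AK(2)] D_def by linarith
        have "vsize (Cell W (Cell e (Cell (R e v) V))) \<le> ?bd"
          unfolding bd unfolding vsize.simps using Rs[OF less.prems] D_def by linarith
        then show "iterates g ?bd 0 (g (Cell ?W2 (Cell e (Cell (R e ?B) (Cell (R e ?A) V))))) (Cell W (Cell e (Cell (R e v) V)))"
          using False by (auto simp: g_def eq[of e v] intro!: iterates_0)
      qed simp
      have "iterates g ?bd (n1 + (n2 + Suc 0)) (Cell (Cell (Cell Null ?A) ?W1) (Cell e V)) (Cell W (Cell e (Cell (R e v) V)))"
        by (rule iterates_trans[OF iterates_mono[OF n1(2) b1] iterates_trans[OF iterates_mono[OF n2(2) b2] r3]])
      then have "iterates g ?bd (Suc (n1 + (n2 + Suc 0))) (Cell (Cell (Cell Null v) W) (Cell e V)) (Cell W (Cell e (Cell (R e v) V)))"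
      proof (intro iterates_Suc)
        show "vsize (Cell (Cell (Cell Null v) W) (Cell e V)) \<le> ?bd"
          unfolding bd unfolding vsize.simps using less.prems D_def by linarith
      qed (use False in \<open>simp_all add: g_def\<close>)
      moreover have "Suc (n1 + (n2 + Suc 0)) \<le> 3 * \<mu> v + 1" using n1(1) n2(1) m by simp
      ultimately show ?thesis unfolding D_def by blast
    qed
  qed
  obtain pa pb where p: "\<And>v. vsize (a v) \<le> poly pa (vsize v)" "\<And>v. vsize (b v) \<le> poly pb (vsize v)"
    using ptime_poly[OF a] ptime_poly[OF b] by blast
  let ?p = "pa + 5 + (3 * pb + 2) * (pb + pcompose q (pa + pb) + 6)"
  have "ptime (\<lambda>v. Cell Null (Cell (a v) (Cell (R (a v) (b v)) Null)))"
  proof (rule ptime_while[OF _ \<open>ptime g\<close>, of _ ?p])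
    show "ptime (\<lambda>v. Cell (Cell (Cell Null (b v)) Null) (Cell (a v) Null))" by (intro ptime_basics a b)
    fix v
    from run[of "b v" "vsize (b v)" Null Null "a v"] obtain n where n: "n \<le> 3 * \<mu> (b v) + 1"
      "iterates g (1 + 1 + vsize (a v) + 3 + (3 * \<mu> (b v) + 2) * (vsize (b v) + poly q (vsize (a v) + vsize (b v)) + 6)) n
      (Cell (Cell (Cell Null (b v)) Null) (Cell (a v) Null)) (Cell Null (Cell (a v) (Cell (R (a v) (b v)) Null)))"
      by auto
    have mb: "\<mu> (b v) \<le> poly pb (vsize v)" using \<mu>(2)[of "b v"] p(2)[of v] by simp
    have x: "poly q (vsize (a v) + vsize (b v)) \<le> poly q (poly pa (vsize v) + poly pb (vsize v))"
      by (rule poly_nat_mono) (intro add_mono p)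
    have y: "(3 * \<mu> (b v) + 2) * (vsize (b v) + poly q (vsize (a v) + vsize (b v)) + 6)
      \<le> (3 * poly pb (vsize v) + 2) * (poly pb (vsize v) + poly q (poly pa (vsize v) + poly pb (vsize v)) + 6)"
      by (intro mult_mono add_mono x p mb mult_left_mono) simp_all
    have z: "1 + 1 + vsize (a v) + 3 + (3 * \<mu> (b v) + 2) * (vsize (b v) + poly q (vsize (a v) + vsize (b v)) + 6)
      \<le> poly ?p (vsize v)"
      using y p(1)[of v] by (simp add: poly_pcompose)
    have "3 * \<mu> (b v) + 1 \<le> (3 * \<mu> (b v) + 2) * (vsize (b v) + poly q (vsize (a v) + vsize (b v)) + 6)"
      by (simp add: algebra_simps)
    then have "n \<le> poly ?p (vsize v)" using n(1) z by linarith
    with iterates_mono[OF n(2) z] show "\<exists>n\<le>poly ?p (vsize v). iterates g (poly ?p (vsize v)) n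
      (Cell (Cell (Cell Null (b v)) Null) (Cell (a v) Null)) (Cell Null (Cell (a v) (Cell (R (a v) (b v)) Null))) \<and>
      \<not> isc (left (Cell Null (Cell (a v) (Cell (R (a v) (b v)) Null))))"
      by auto
  qed
  from ptime_left[OF ptime_right[OF ptime_right[OF this]]] show ?thesis by simp
qed

text \<open>A case of \<open>ptime_rec\<close>: the argument is wrapped in a \<open>Cell\<close>, so
  that the bare \<open>Null\<close> can serve as a trivial second subproblem of measure 0.\<close>

lemma ptime_lin:
  assumes eq: "\<And>e v. R e v = (if leaf e v then L e v else N e v (R e (A e v)))"
    and leaf: "ptime_test (\<lambda>w. leaf (left w) (right w))" and PL: "ptime (\<lambda>w. L (left w) (right w))"
    and PA: "ptime (\<lambda>w. A (left w) (right w))"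
    and ptime_num: "ptime (\<lambda>w. N (left w) (left (right w)) (right (right w)))"
    and \<mu>: "\<And>e v. \<not> leaf e v \<Longrightarrow> \<mu> (A e v) < (\<mu> v :: nat)" "\<And>v. \<mu> v \<le> vsize v"
    and A: "\<And>e v. \<not> leaf e v \<Longrightarrow> vsize (A e v) \<le> vsize v"
    and R: "\<And>e v. vsize (R e v) \<le> poly q (vsize e + vsize v)"
    and a: "ptime a" and b: "ptime b"
  shows "ptime (\<lambda>v. R (a v) (b v))"
proof -
  define R' where "R' e v = (if isc v then R e (left v) else Null)" for e v
  have "ptime (\<lambda>v. R' (a v) (Cell (b v) Null))"
  proof (rule ptime_rec[where R = R' and leaf = "\<lambda>e v. if isc v then leaf e (left v) else True"
        and L = "\<lambda>e v. if isc v then L e (left v) else Null" and A = "\<lambda>e v. Cell (A e (left v)) Null"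
        and B = "\<lambda>e v. Null" and N = "\<lambda>e v x y. N e (left v) x" and \<mu> = "\<lambda>v. if isc v then \<mu> (left v) else 0"
        and q = "q + 1"])
    show "R' e v = (if if isc v then leaf e (left v) else True then if isc v then L e (left v) else Null
        else N e (left v) (R' e (Cell (A e (left v)) Null)))" for e v
      by (auto simp: R'_def eq[of e "left v"])
    have "ptime_test (\<lambda>w. isc (right w) \<and> leaf (left w) (left (right w)) \<or> \<not> isc (right w))"
      by (intro ptime_basics ptime_test2[OF leaf])
    then show "ptime_test (\<lambda>w. if isc (right w) then leaf (left w) (left (right w)) else True)"
      by (rule back_subst[of ptime_test]) (auto simp: fun_eq_iff)
    show "ptime (\<lambda>w. if isc (right w) then L (left w) (left (right w)) else Null)"
      by (intro ptime_basics ptime2[OF PL])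
    show "ptime (\<lambda>w. Cell (A (left w) (left (right w))) Null)" by (intro ptime_basics ptime2[OF PA])
    show "ptime (\<lambda>w. N (left w) (left (left (right w))) (left (right (right w))))"
      by (intro ptime_basics ptime3[OF ptime_num])
    show "vsize (R' e v) \<le> poly (q + 1) (vsize e + vsize v)" for e v
      using le_poly_trans[OF R[of e "left v"], of "vsize e + vsize v"] vsize_left[of v]
      by (auto simp: R'_def)
    show "(if isc v then \<mu> (left v) else 0) \<le> vsize v" for v
      using \<mu>(2)[of "left v"] vsize_left[of v] by simp
    show "vsize (Cell (A e (left v)) Null) \<le> vsize v"
      if "\<not> (if isc v then leaf e (left v) else True)" for e v
      using that A[of e "left v"] vsize_pos[of "right v"] by (cases v) auto
    show "vsize Null \<le> vsize v" for v using vsize_pos[of v] by simp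
    show "(if isc (Cell (A e (left v)) Null) then \<mu> (left (Cell (A e (left v)) Null)) else 0)
        + (if isc Null then \<mu> (left Null) else 0) < (if isc v then \<mu> (left v) else 0)"
      if "\<not> (if isc v then leaf e (left v) else True)" for e v
      using that \<mu>(1)[of e "left v"] by (simp split: if_splits)
  qed (intro ptime_basics a b)+
  then show ?thesis by (simp add: R'_def)
qed

section \<open>The tractable case\<close>

lemma ptime_bool: "ptime_test b \<Longrightarrow> ptime (\<lambda>v. Num (of_bool (b v)))"
  by (simp add: ptime_test_def)

lemma ptime_test_const: "ptime_test (\<lambda>v. c)"
  unfolding ptime_test_def by (rule ptime_const)

lemmas ptime_rules = ptime_bool ptime_basics ptime_test_const

section \<open>Inspecting truth tables\<close>

primrec all_zero :: "val \<Rightarrow> bool" where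
  "all_zero (Cell a b) \<longleftrightarrow> all_zero a \<and> all_zero b"
| "all_zero Null \<longleftrightarrow> True"
| "all_zero (Num z) \<longleftrightarrow> z = 0"

lemma ptime_test_all_zero: "ptime f \<Longrightarrow> ptime_test (\<lambda>v. all_zero (f v))"
  unfolding ptime_test_def
proof (rule ptime_rec[where R = "\<lambda>e v. Num (of_bool (all_zero v))" and leaf = "\<lambda>e v. \<not> isc v"
      and L = "\<lambda>e v. Num (of_bool (num v = 0))" and A = "\<lambda>e v. left v" and B = "\<lambda>e v. right v"
      and N = "\<lambda>e v x y. Num (num x * num y)" and \<mu> = vsize and q = 1 and a = "\<lambda>v. Null"])
  show "Num (of_bool (all_zero v)) = (if \<not> isc v then Num (of_bool (num v = 0))
      else Num (num (Num (of_bool (all_zero (left v)))) * num (Num (of_bool (all_zero (right v))))))" for v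
    by (cases v) auto
qed (intro ptime_rules | force simp: isc_iff)+

text \<open>The position is a complex number, counted down to 0 along the levels of the tree,
  because the machine has no other numbers and equality as its only comparison here.\<close>

primrec zero_where :: "bool \<Rightarrow> val \<Rightarrow> complex \<Rightarrow> bool" where
  "zero_where b (Cell s t) j \<longleftrightarrow> (if j = 0 then all_zero (if b then t else s) else zero_where b s (j - 1) \<and> zero_where b t (j - 1))"
| "zero_where b Null j \<longleftrightarrow> True"
| "zero_where b (Num z) j \<longleftrightarrow> True"

lemma ptime_test_zero_where: "ptime f \<Longrightarrow> ptime_num g \<Longrightarrow> ptime_test (\<lambda>v. zero_where b (f v) (g v))"
proof -
  assume fg: "ptime f" "ptime_num g"
  have "ptime (\<lambda>v. Num (of_bool (zero_where b (left (Cell (f v) (Num (g v)))) (num (right (Cell (f v) (Num (g v))))))))"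
  proof (rule ptime_rec[where R = "\<lambda>e v. Num (of_bool (zero_where b (left v) (num (right v))))"
      and leaf = "\<lambda>e v. \<not> isc (left v) \<or> num (right v) = 0"
      and L = "\<lambda>e v. Num (of_bool (\<not> isc (left v) \<or> all_zero (if b then right (left v) else left (left v))))"
      and A = "\<lambda>e v. Cell (left (left v)) (Num (num (right v) - 1))"
      and B = "\<lambda>e v. Cell (right (left v)) (Num (num (right v) - 1))"
      and N = "\<lambda>e v x y. Num (num x * num y)" and \<mu> = "\<lambda>v. vsize (left v)" and q = 1 and a = "\<lambda>v. Null"])
    show "Num (of_bool (zero_where b (left v) (num (right v)))) =
      (if \<not> isc (left v) \<or> num (right v) = 0
       then Num (of_bool (\<not> isc (left v) \<or> all_zero (if b then right (left v) else left (left v))))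
       else Num (num (Num (of_bool (zero_where b (left (Cell (left (left v)) (Num (num (right v) - 1))))
              (num (right (Cell (left (left v)) (Num (num (right v) - 1)))))))) *
            num (Num (of_bool (zero_where b (left (Cell (right (left v)) (Num (num (right v) - 1))))
              (num (right (Cell (right (left v)) (Num (num (right v) - 1))))))))))" for v
      by (cases "left v") auto
    show "vsize (left v) \<le> vsize v" for v by (rule vsize_left)
    show "ptime_test (\<lambda>w. \<not> isc (left (right w)) \<or> num (right (right w)) = 0)"
      "ptime (\<lambda>w. Num (of_bool (\<not> isc (left (right w)) \<or>
        all_zero (if b then right (left (right w)) else left (left (right w))))))"
      by (intro ptime_rules ptime_test_all_zero)+
    show "vsize (Cell (left (left v)) (Num (num (right v) - 1))) \<le> vsize v"
      "vsize (Cell (right (left v)) (Num (num (right v) - 1))) \<le> vsize v"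
      if "\<not> (\<not> isc (left v) \<or> num (right v) = 0)" for v
      using that vsize_pos[of "right v"] by (cases v; cases "left v"; auto)+
  qed (intro ptime_rules fg | force simp: isc_iff)+
  then show ?thesis by (simp add: ptime_test_def)
qed

text \<open>The values of two tables at the first argument where they do not both vanish.\<close>

primrec first_nonzero :: "val \<Rightarrow> val \<Rightarrow> val" where
  "first_nonzero (Cell a b) t = (if num (left (first_nonzero a (left t))) = 0 \<and> num (right (first_nonzero a (left t))) = 0
     then first_nonzero b (right t) else first_nonzero a (left t))"
| "first_nonzero Null t = Cell (Num 0) (Num (num t))"
| "first_nonzero (Num z) t = Cell (Num z) (Num (num t))"

lemma vsize_first_nonzero: "vsize (first_nonzero s t) = 3"
  by (induction s arbitrary: t) auto

lemma ptime_first_nonzero: "ptime f \<Longrightarrow> ptime g \<Longrightarrow> ptime (\<lambda>v. first_nonzero (f v) (g v))"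
proof -
  assume fg: "ptime f" "ptime g"
  have "ptime (\<lambda>v. first_nonzero (left (Cell (f v) (g v))) (right (Cell (f v) (g v))))"
  proof (rule ptime_rec[where R = "\<lambda>e v. first_nonzero (left v) (right v)"
      and leaf = "\<lambda>e v. \<not> isc (left v)" and L = "\<lambda>e v. Cell (Num (num (left v))) (Num (num (right v)))"
      and A = "\<lambda>e v. Cell (left (left v)) (left (right v))"
      and B = "\<lambda>e v. Cell (right (left v)) (right (right v))"
      and N = "\<lambda>e v x y. if num (left x) = 0 \<and> num (right x) = 0 then y else x"
      and \<mu> = "\<lambda>v. vsize (left v)" and q = 3 and a = "\<lambda>v. Null"])
    show "first_nonzero (left v) (right v) = (if \<not> isc (left v) then Cell (Num (num (left v))) (Num (num (right v)))
      else if num (left (first_nonzero (left (Cell (left (left v)) (left (right v)))) (right (Cell (left (left v)) (left (right v)))))) = 0 \<and>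
         num (right (first_nonzero (left (Cell (left (left v)) (left (right v)))) (right (Cell (left (left v)) (left (right v)))))) = 0
         then first_nonzero (left (Cell (right (left v)) (right (right v)))) (right (Cell (right (left v)) (right (right v))))
         else first_nonzero (left (Cell (left (left v)) (left (right v)))) (right (Cell (left (left v)) (left (right v)))))" for v
      by (cases "left v") auto
    show "vsize (left v) \<le> vsize v" for v by (rule vsize_left)
    show "vsize (Cell (left (left v)) (left (right v))) \<le> vsize v"
      "vsize (Cell (right (left v)) (right (right v))) \<le> vsize v" if "\<not> \<not> isc (left v)" for v
      using that vsize_left[of "right v"] vsize_right[of "right v"] by (cases v; cases "left v"; auto)+
  qed (intro ptime_rules fg | force simp: isc_iff vsize_first_nonzero)+
  then show ?thesis by simp
qed

primrec table_add :: "val \<Rightarrow> val \<Rightarrow> val" where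
  "table_add (Cell a b) t = Cell (table_add a (left t)) (table_add b (right t))"
| "table_add Null t = Num (num t)"
| "table_add (Num z) t = Num (z + num t)"

lemma vsize_table_add: "vsize (table_add s t) \<le> vsize s"
  by (induction s arbitrary: t) (auto intro: add_mono)

lemma ptime_table_add: "ptime f \<Longrightarrow> ptime g \<Longrightarrow> ptime (\<lambda>v. table_add (f v) (g v))"
proof -
  assume fg: "ptime f" "ptime g"
  have "ptime (\<lambda>v. table_add (left (Cell (f v) (g v))) (right (Cell (f v) (g v))))"
  proof (rule ptime_rec[where R = "\<lambda>e v. table_add (left v) (right v)"
      and leaf = "\<lambda>e v. \<not> isc (left v)" and L = "\<lambda>e v. Num (num (left v) + num (right v))"
      and A = "\<lambda>e v. Cell (left (left v)) (left (right v))"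
      and B = "\<lambda>e v. Cell (right (left v)) (right (right v))"
      and N = "\<lambda>e v x y. Cell x y"
      and \<mu> = "\<lambda>v. vsize (left v)" and q = "[:0, 1:]" and a = "\<lambda>v. Null"])
    show "table_add (left v) (right v) = (if \<not> isc (left v) then Num (num (left v) + num (right v))
      else Cell (table_add (left (Cell (left (left v)) (left (right v)))) (right (Cell (left (left v)) (left (right v)))))
         (table_add (left (Cell (right (left v)) (right (right v)))) (right (Cell (right (left v)) (right (right v))))))" for v
      by (cases "left v") auto
    show "vsize (left v) \<le> vsize v" for v by (rule vsize_left)
    show "vsize (Cell (left (left v)) (left (right v))) \<le> vsize v"
      "vsize (Cell (right (left v)) (right (right v))) \<le> vsize v" if "\<not> \<not> isc (left v)" for v
      using that vsize_left[of "right v"] vsize_right[of "right v"] by (cases v; cases "left v"; auto)+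
    show "vsize (table_add (left v) (right v)) \<le> poly [:0, 1:] (vsize e + vsize v)" for e v
      using vsize_table_add[of "left v" "right v"] vsize_left[of v] by simp
  qed (intro ptime_rules fg | force simp: isc_iff)+
  then show ?thesis by simp
qed

text \<open>\<open>s\<close> and \<open>t\<close> are the halves of a table for first bit
  \<open>False\<close> and \<open>True\<close>; \<open>j\<close> is the position of the head of the
  list. The variable found comes with 1 for equality or 0 for disequality.\<close>

primrec find_link :: "val \<Rightarrow> val \<Rightarrow> val \<Rightarrow> complex \<Rightarrow> val" where
  "find_link s t (Cell y ys) j = (if zero_where True s j \<and> zero_where False t j then Cell (Num (num y)) (Num 1)
     else if zero_where False s j \<and> zero_where True t j then Cell (Num (num y)) (Num 0)
     else find_link s t ys (j + 1))"
| "find_link s t Null j = Null"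
| "find_link s t (Num z) j = Null"

lemma vsize_find_link: "vsize (find_link s t ys j) \<le> 3"
  by (induction ys arbitrary: j) auto

lemma ptime_find_link: "ptime f \<Longrightarrow> ptime g \<Longrightarrow> ptime h \<Longrightarrow> ptime (\<lambda>v. find_link (f v) (g v) (h v) 0)"
proof -
  assume fg: "ptime f" "ptime g" "ptime h"
  let ?c = "\<lambda>e v. zero_where True (left e) (num (right v)) \<and> zero_where False (right e) (num (right v))"
  let ?d = "\<lambda>e v. zero_where False (left e) (num (right v)) \<and> zero_where True (right e) (num (right v))"
  have "ptime (\<lambda>v. find_link (left (Cell (f v) (g v))) (right (Cell (f v) (g v)))
     (left (Cell (h v) (Num 0))) (num (right (Cell (h v) (Num 0)))))"
  proof (rule ptime_lin[where R = "\<lambda>e v. find_link (left e) (right e) (left v) (num (right v))"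
      and leaf = "\<lambda>e v. \<not> isc (left v) \<or> ?c e v \<or> ?d e v"
      and L = "\<lambda>e v. if isc (left v) then Cell (Num (num (left (left v)))) (if ?c e v then Num 1 else Num 0) else Null"
      and A = "\<lambda>e v. Cell (right (left v)) (Num (num (right v) + 1))"
      and N = "\<lambda>e v x. x" and \<mu> = "\<lambda>v. vsize (left v)" and q = 3])
    show "find_link (left e) (right e) (left v) (num (right v)) =
      (if \<not> isc (left v) \<or> ?c e v \<or> ?d e v
       then if isc (left v) then Cell (Num (num (left (left v)))) (if ?c e v then Num 1 else Num 0) else Null
       else find_link (left e) (right e) (left (Cell (right (left v)) (Num (num (right v) + 1))))
         (num (right (Cell (right (left v)) (Num (num (right v) + 1))))))" for e v
      by (cases "left v") auto
    show "vsize (left v) \<le> vsize v" for v by (rule vsize_left)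
    show "vsize (Cell (right (left v)) (Num (num (right v) + 1))) \<le> vsize v"
      if "\<not> (\<not> isc (left v) \<or> ?c e v \<or> ?d e v)" for e v
      using that vsize_pos[of "right v"] by (cases v; cases "left v") auto
    show "vsize (left (Cell (right (left v)) (Num (num (right v) + 1)))) < vsize (left v)"
      if "\<not> (\<not> isc (left v) \<or> ?c e v \<or> ?d e v)" for e v
      using that by (cases "left v") auto
  qed (intro ptime_rules ptime_test_zero_where fg | force simp: isc_iff vsize_find_link)+
  then show ?thesis by simp
qed

section \<open>Factoring truth tables\<close>

text \<open>A factor is a pair of variables with the \<open>2 \<times> 2\<close> table of its values; unary factors have equal
  variables. Variables are complex numbers, so that every tree denotes a factor, whatever its shape.\<close>

definition mk_factor :: "complex \<Rightarrow> complex \<Rightarrow> complex \<Rightarrow> complex \<Rightarrow> complex \<Rightarrow> complex \<Rightarrow> val" where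
  "mk_factor x y a b c d = Cell (Cell (Num x) (Num y)) (Cell (Cell (Num a) (Num b)) (Cell (Num c) (Num d)))"

definition rx :: "val \<Rightarrow> complex" where "rx r = num (left (left r))"
definition ry :: "val \<Rightarrow> complex" where "ry r = num (right (left r))"
definition r00 :: "val \<Rightarrow> complex" where "r00 r = num (left (left (right r)))"
definition r01 :: "val \<Rightarrow> complex" where "r01 r = num (right (left (right r)))"
definition r10 :: "val \<Rightarrow> complex" where "r10 r = num (left (right (right r)))"
definition r11 :: "val \<Rightarrow> complex" where "r11 r = num (right (right (right r)))"

lemma mk_factor_simps [simp]: "rx (mk_factor x y a b c d) = x" "ry (mk_factor x y a b c d) = y" "r00 (mk_factor x y a b c d) = a"
  "r01 (mk_factor x y a b c d) = b" "r10 (mk_factor x y a b c d) = c" "r11 (mk_factor x y a b c d) = d" "vsize (mk_factor x y a b c d) = 11"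
  by (simp_all add: mk_factor_def rx_def ry_def r00_def r01_def r10_def r11_def)

lemma ptime_mk_factor: "ptime_num x \<Longrightarrow> ptime_num y \<Longrightarrow> ptime_num a \<Longrightarrow> ptime_num b \<Longrightarrow> ptime_num c \<Longrightarrow> ptime_num d \<Longrightarrow> ptime (\<lambda>v. mk_factor (x v) (y v) (a v) (b v) (c v) (d v))"
  unfolding mk_factor_def by (intro ptime_rules)

lemma ptime_num_fields:
  assumes "ptime f"
  shows ptime_num_rx: "ptime_num (\<lambda>v. rx (f v))" and ptime_num_ry: "ptime_num (\<lambda>v. ry (f v))" and ptime_num_r00: "ptime_num (\<lambda>v. r00 (f v))"
    and ptime_num_r01: "ptime_num (\<lambda>v. r01 (f v))" and ptime_num_r10: "ptime_num (\<lambda>v. r10 (f v))" and ptime_num_r11: "ptime_num (\<lambda>v. r11 (f v))"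
  unfolding rx_def ry_def r00_def r01_def r10_def r11_def by (intro ptime_rules assms)+

lemmas ptime_rec_rules = ptime_mk_factor ptime_num_rx ptime_num_ry ptime_num_r00 ptime_num_r01 ptime_num_r10 ptime_num_r11 ptime_rules

text \<open>Splits off the first variable \<open>x\<close> of a table with halves \<open>s\<close> and \<open>t\<close>. Either \<open>x\<close> is determined by
  another variable, and \<open>s + t\<close> is the table without it, or (for a factorable table) \<open>s\<close> and \<open>t\<close> are
  proportional.\<close>

definition pstep :: "val \<Rightarrow> val \<Rightarrow> val" where
  "pstep l acc = (let s = left (left acc); t = right (left acc); out = right acc; x = num (left l);
      k = find_link s t (right l) 0; r = first_nonzero s t in
    if isc k then Cell (table_add s t) (Cell (mk_factor x (num (left k)) (num (right k)) (1 - num (right k))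
        (1 - num (right k)) (num (right k))) out)
    else if num (left r) \<noteq> 0 then Cell s (Cell (mk_factor x x 1 0 0 (num (right r) / num (left r))) out)
    else Cell t (Cell (mk_factor x x 0 0 0 1) out))"

text \<open>Once the variables are used up, the table is a single number. It is kept as a factor
  with four equal entries, so the variable named in it is immaterial.\<close>

definition peel :: "val \<Rightarrow> val \<Rightarrow> val \<Rightarrow> val" where
  "peel xs T out = (let A = vfold pstep xs (Cell T out); z = num (left A) in
     Cell (mk_factor 0 0 z z z z) (right A))"

lemma ptime_pstep: "ptime f \<Longrightarrow> ptime g \<Longrightarrow> ptime (\<lambda>v. pstep (f v) (g v))"
  unfolding pstep_def Let_def by (intro ptime_rec_rules ptime_find_link ptime_first_nonzero ptime_table_add)

text \<open>A factor has size 11 and its list cell adds one, while the table does not grow; the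
  constants 12 in the later bounds come from here.\<close>

lemma pstep_size:
  "\<exists>T' out'. pstep l (Cell T out) = Cell T' out' \<and> vsize T' \<le> vsize T \<and> vsize out' = vsize out + 12"
  using vsize_table_add[of "left T" "right T"] vsize_left[of T] vsize_right[of T]
  by (auto simp: pstep_def Let_def)

lemma peel_size: "vsize (peel xs T out) \<le> vsize out + 12 * vlen xs + 12"
proof -
  have "\<exists>T' out'. vfold pstep xs (Cell T out) = Cell T' out' \<and> vsize out' \<le> vsize out + 12 * vlen xs"
  proof (induction xs arbitrary: T out)
    case (Cell x xs)
    obtain T' out' where *: "pstep (Cell x xs) (Cell T out) = Cell T' out'" "vsize out' = vsize out + 12"
      using pstep_size by blast
    with Cell.IH(2)[of T' out'] show ?case by auto
  qed auto
  then show ?thesis by (auto simp: peel_def Let_def)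
qed

lemma ptime_peel_aux: "ptime (\<lambda>w. peel (left w) (left (right w)) (right (right w)))"
proof -
  have "ptime (\<lambda>w. vfold pstep (left w) (Cell (left (right w)) (right (right w))))"
  proof (rule ptime_fold[where G = "\<lambda>_. pstep" and q = "[:0, 14:] + 1" and
        I = "\<lambda>w l acc. \<exists>T out. acc = Cell T out \<and> vsize T \<le> vsize w \<and> vsize out + 12 * vlen l \<le> 13 * vsize w"])
    fix w
    have "vsize (left (right w)) \<le> vsize w" "vsize (right (right w)) \<le> vsize w" "vsize (left w) \<le> vsize w"
      by (meson order_trans vsize_left vsize_right)+
    with vlen_le[of "left w"] show "\<exists>T out. Cell (left (right w)) (right (right w)) = Cell T out \<and>
       vsize T \<le> vsize w \<and> vsize out + 12 * vlen (left w) \<le> 13 * vsize w"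
      by simp
  next
    fix w x y acc
    assume "\<exists>T out. acc = Cell T out \<and> vsize T \<le> vsize w \<and> vsize out + 12 * vlen (Cell x y) \<le> 13 * vsize w"
    then obtain T out where *: "acc = Cell T out" "vsize T \<le> vsize w"
      "vsize out + 12 * vlen (Cell x y) \<le> 13 * vsize w" by blast
    with pstep_size[of "Cell x y" T out] show "\<exists>T out. pstep (Cell x y) acc = Cell T out \<and> vsize T \<le> vsize w \<and>
       vsize out + 12 * vlen y \<le> 13 * vsize w"
      by force
  qed (intro ptime_rules ptime_pstep | force)+
  then show ?thesis
    unfolding peel_def Let_def by (intro ptime_rec_rules)
qed

lemmas ptime_peel = ptime3[OF ptime_peel_aux]

definition factors :: "val \<Rightarrow> val" where
  "factors cs = vfold (\<lambda>l acc. peel (right (left l)) (left (left l)) acc) cs Null"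

lemma ptime_factors: "ptime f \<Longrightarrow> ptime (\<lambda>v. factors (f v))"
proof (erule ptime_comp)
  show "ptime factors"
    unfolding factors_def
  \<comment> \<open>Each node of the unread part of the input pays 12 in advance for a factor that
    it may produce.\<close>
  proof (rule ptime_fold[where G = "\<lambda>_ l acc. peel (right (left l)) (left (left l)) acc" and q = "[:1, 12:]" and
        I = "\<lambda>w l acc. vsize acc + 12 * vsize l \<le> 12 * vsize w + 1"])
    fix w x y acc
    assume "vsize acc + 12 * vsize (Cell x y) \<le> 12 * vsize w + 1"
    with peel_size[of "right x" "left x" acc] vlen_le[of "right x"] vsize_right[of x]
    show "vsize (peel (right (left (Cell x y))) (left (left (Cell x y))) acc) + 12 * vsize y \<le> 12 * vsize w + 1"
      by simp
  qed (intro ptime_rules ptime_peel | force)+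
qed

section \<open>Eliminating variables\<close>

primrec find_edge :: "complex \<Rightarrow> val \<Rightarrow> val" where
  "find_edge v (Cell r fs) = (if rx r = v \<and> ry r \<noteq> v then Cell (Num (ry r)) (if r01 r = 0 \<and> r10 r = 0 then Num 1 else Num 0)
     else if ry r = v \<and> rx r \<noteq> v then Cell (Num (rx r)) (if r01 r = 0 \<and> r10 r = 0 then Num 1 else Num 0)
     else find_edge v fs)"
| "find_edge v Null = Null"
| "find_edge v (Num z) = Null"

lemma vsize_find_edge: "vsize (find_edge v fs) \<le> 3"
  by (induction fs) auto

lemma ptime_find_edge: "ptime_num f \<Longrightarrow> ptime g \<Longrightarrow> ptime (\<lambda>v. find_edge (f v) (g v))"
proof -
  assume fg: "ptime_num f" "ptime g"
  let ?c = "\<lambda>e v. rx (left v) = num e \<and> ry (left v) \<noteq> num e"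
  let ?d = "\<lambda>e v. ry (left v) = num e \<and> rx (left v) \<noteq> num e"
  let ?q = "\<lambda>v. if r01 (left v) = 0 \<and> r10 (left v) = 0 then Num 1 else Num 0"
  have "ptime (\<lambda>v. find_edge (num (Num (f v))) (g v))"
  proof (rule ptime_lin[where R = "\<lambda>e v. find_edge (num e) v" and leaf = "\<lambda>e v. \<not> isc v \<or> ?c e v \<or> ?d e v"
      and L = "\<lambda>e v. if isc v then Cell (Num (if ?c e v then ry (left v) else rx (left v))) (?q v) else Null"
      and A = "\<lambda>e v. right v" and N = "\<lambda>e v x. x" and \<mu> = vsize and q = 3])
    show "find_edge (num e) v = (if \<not> isc v \<or> ?c e v \<or> ?d e v
       then if isc v then Cell (Num (if ?c e v then ry (left v) else rx (left v))) (?q v) else Null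
       else find_edge (num e) (right v))" for e v
      by (cases v) auto
  qed (intro ptime_rec_rules fg | force simp: isc_iff vsize_find_edge)+
  then show ?thesis by simp
qed

text \<open>For \<open>q\<close> other than 1 the variable \<open>v\<close> is replaced by the
  negation of \<open>y\<close>, which swaps the rows of the table, its columns, or both, according
  to where \<open>v\<close> occurs.\<close>

definition subst :: "complex \<Rightarrow> complex \<Rightarrow> complex \<Rightarrow> val \<Rightarrow> val" where
  "subst v y q r = mk_factor (if rx r = v then y else rx r) (if ry r = v then y else ry r)
     (if rx r = v \<and> q \<noteq> 1 then if ry r = v \<and> q \<noteq> 1 then r11 r else r10 r
      else if ry r = v \<and> q \<noteq> 1 then r01 r else r00 r)
     (if rx r = v \<and> q \<noteq> 1 then if ry r = v \<and> q \<noteq> 1 then r10 r else r11 r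
      else if ry r = v \<and> q \<noteq> 1 then r00 r else r01 r)
     (if rx r = v \<and> q \<noteq> 1 then if ry r = v \<and> q \<noteq> 1 then r01 r else r00 r
      else if ry r = v \<and> q \<noteq> 1 then r11 r else r10 r)
     (if rx r = v \<and> q \<noteq> 1 then if ry r = v \<and> q \<noteq> 1 then r00 r else r01 r
      else if ry r = v \<and> q \<noteq> 1 then r10 r else r11 r)"

lemma ptime_subst: "ptime_num f \<Longrightarrow> ptime_num g \<Longrightarrow> ptime_num h \<Longrightarrow> ptime k \<Longrightarrow> ptime (\<lambda>v. subst (f v) (g v) (h v) (k v))"
  unfolding subst_def by (intro ptime_rec_rules)

primrec vsubst :: "complex \<Rightarrow> complex \<Rightarrow> complex \<Rightarrow> val \<Rightarrow> val" where
  "vsubst v y q (Cell r fs) = Cell (subst v y q r) (vsubst v y q fs)"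
| "vsubst v y q Null = Null"
| "vsubst v y q (Num z) = Null"

text \<open>Every factor is rebuilt with size 11, so the size depends on the number of factors alone
  and repeated substitutions do not accumulate.\<close>

lemma vsize_vsubst: "vsize (vsubst v y q fs) = 12 * vlen fs + 1" and vlen_vsubst: "vlen (vsubst v y q fs) = vlen fs"
  by (induction fs) (auto simp: subst_def)

lemma ptime_vsubst: "ptime_num f \<Longrightarrow> ptime_num g \<Longrightarrow> ptime_num h \<Longrightarrow> ptime k \<Longrightarrow> ptime (\<lambda>v. vsubst (f v) (g v) (h v) (k v))"
proof -
  assume fg: "ptime_num f" "ptime_num g" "ptime_num h" "ptime k"
  let ?e = "\<lambda>v. Cell (Num (f v)) (Cell (Num (g v)) (Num (h v)))"
  have "ptime (\<lambda>v. vsubst (num (left (?e v))) (num (left (right (?e v)))) (num (right (right (?e v)))) (k v))"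
  proof (rule ptime_lin[where R = "\<lambda>e v. vsubst (num (left e)) (num (left (right e))) (num (right (right e))) v"
      and leaf = "\<lambda>e v. \<not> isc v" and L = "\<lambda>e v. Null" and A = "\<lambda>e v. right v"
      and N = "\<lambda>e v x. Cell (subst (num (left e)) (num (left (right e))) (num (right (right e))) (left v)) x"
      and \<mu> = vsize and q = "[:1, 12:]"])
    show "vsubst a b c v = (if \<not> isc v then Null else Cell (subst a b c (left v)) (vsubst a b c (right v)))" for a b c v
      by (cases v) auto
    show "vsize (vsubst a b c v) \<le> poly [:1, 12:] (vsize e + vsize v)" for a b c e v
      using vlen_le[of v] by (simp add: vsize_vsubst)
  qed (intro ptime_rec_rules ptime_subst fg | force simp: isc_iff)+
  then show ?thesis by simp
qed

primrec prodat :: "bool \<Rightarrow> complex \<Rightarrow> val \<Rightarrow> complex" where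
  "prodat b v (Cell r fs) = (if rx r = v then (if b then r11 r else r00 r) * prodat b v fs else prodat b v fs)"
| "prodat b v Null = 1"
| "prodat b v (Num z) = 1"

lemma ptime_num_prodat: "ptime_num f \<Longrightarrow> ptime g \<Longrightarrow> ptime_num (\<lambda>v. prodat b (f v) (g v))"
  unfolding ptime_num_def
proof -
  assume fg: "ptime (\<lambda>v. Num (f v))" "ptime g"
  have "ptime (\<lambda>v. Num (prodat b (num (Num (f v))) (g v)))"
  proof (rule ptime_lin[where R = "\<lambda>e v. Num (prodat b (num e) v)" and leaf = "\<lambda>e v. \<not> isc v"
      and L = "\<lambda>e v. Num 1" and A = "\<lambda>e v. right v"
      and N = "\<lambda>e v x. Num (if rx (left v) = num e then (if b then r11 (left v) else r00 (left v)) * num x else num x)"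
      and \<mu> = vsize and q = 1])
    show "Num (prodat b (num e) v) = (if \<not> isc v then Num 1 else Num (if rx (left v) = num e
      then (if b then r11 (left v) else r00 (left v)) * num (Num (prodat b (num e) (right v)))
      else num (Num (prodat b (num e) (right v)))))" for e v
      by (cases v) auto
  qed (intro ptime_rec_rules fg | force simp: isc_iff)+
  then show "ptime (\<lambda>v. Num (prodat b (f v) (g v)))" by simp
qed

primrec drop_factors :: "complex \<Rightarrow> val \<Rightarrow> val" where
  "drop_factors v (Cell r fs) = (if rx r = v then drop_factors v fs else Cell r (drop_factors v fs))"
| "drop_factors v Null = Null"
| "drop_factors v (Num z) = Null"

lemma vsize_drop_factors: "vsize (drop_factors v fs) \<le> vsize fs" and vlen_drop_factors: "vlen (drop_factors v fs) \<le> vlen fs"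
  by (induction fs) auto

lemma ptime_drop_factors: "ptime_num f \<Longrightarrow> ptime g \<Longrightarrow> ptime (\<lambda>v. drop_factors (f v) (g v))"
proof -
  assume fg: "ptime_num f" "ptime g"
  have "ptime (\<lambda>v. drop_factors (num (Num (f v))) (g v))"
  proof (rule ptime_lin[where R = "\<lambda>e v. drop_factors (num e) v" and leaf = "\<lambda>e v. \<not> isc v"
      and L = "\<lambda>e v. Null" and A = "\<lambda>e v. right v"
      and N = "\<lambda>e v x. if rx (left v) = num e then x else Cell (left v) x"
      and \<mu> = vsize and q = "[:0, 1:]"])
    show "drop_factors (num e) v = (if \<not> isc v then Null else if rx (left v) = num e then drop_factors (num e) (right v)
        else Cell (left v) (drop_factors (num e) (right v)))" for e v
      by (cases v) auto
    show "vsize (drop_factors (num e) v) \<le> poly [:0, 1:] (vsize e + vsize v)" for e v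
      using vsize_drop_factors[of "num e" v] by simp
  qed (intro ptime_rec_rules fg | force simp: isc_iff)+
  then show ?thesis by simp
qed

text \<open>Sums over the variable \<open>v\<close>: it is replaced by a variable to which some factor ties it, or else all
  factors on \<open>v\<close> are unary and their sum is a constant.\<close>

definition elim :: "complex \<Rightarrow> val \<Rightarrow> val" where
  "elim v fs = (let k = find_edge v fs; z = prodat False v fs + prodat True v fs in
     if isc k then vsubst v (num (left k)) (num (right k)) fs else Cell (mk_factor 0 0 z z z z) (drop_factors v fs))"

lemma ptime_elim: "ptime_num f \<Longrightarrow> ptime g \<Longrightarrow> ptime (\<lambda>v. elim (f v) (g v))"
  unfolding elim_def Let_def by (intro ptime_rec_rules ptime_find_edge ptime_vsubst ptime_num_prodat ptime_drop_factors)

text \<open>The product at the all-false assignment. After the elimination of all variables of an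
  instance the product no longer depends on the assignment, so this is its value.\<close>

primrec finprod :: "val \<Rightarrow> complex" where
  "finprod (Cell r fs) = r00 r * finprod fs"
| "finprod Null = 1"
| "finprod (Num z) = 1"

lemma ptime_num_finprod: "ptime g \<Longrightarrow> ptime_num (\<lambda>v. finprod (g v))"
  unfolding ptime_num_def
proof (rule ptime_lin[where R = "\<lambda>e v. Num (finprod v)" and leaf = "\<lambda>e v. \<not> isc v"
      and L = "\<lambda>e v. Num 1" and A = "\<lambda>e v. right v"
      and N = "\<lambda>e v x. Num (r00 (left v) * num x)"
      and \<mu> = vsize and q = 1 and a = "\<lambda>v. Null"])
  show "Num (finprod v) = (if \<not> isc v then Num 1 else Num (r00 (left v) * num (Num (finprod (right v)))))" for v
    by (cases v) auto
qed (intro ptime_rec_rules | force simp: isc_iff)+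

definition elims :: "val \<Rightarrow> val \<Rightarrow> val" where
  "elims vs fs = vfold (\<lambda>l acc. elim (num (left l)) acc) vs fs"

lemma ptime_elims_aux: "ptime (\<lambda>w. elims (left w) (right w))"
  unfolding elims_def
\<comment> \<open>Two measures are needed: \<open>vlen\<close>, because a substitution brings the
  list to size \<open>12 * vlen + 1\<close>, and \<open>vsize\<close>, because factors kept as they
  are may have any shape. An elimination adds at most one factor.\<close>
proof (rule ptime_fold[where G = "\<lambda>_ l acc. elim (num (left l)) acc" and q = "[:1, 36:]" and
        I = "\<lambda>w l acc. vlen acc + vlen l \<le> 2 * vsize w \<and> vsize acc + 12 * vlen l \<le> 36 * vsize w + 1"])
    fix w
    show "vlen (right w) + vlen (left w) \<le> 2 * vsize w \<and> vsize (right w) + 12 * vlen (left w) \<le> 36 * vsize w + 1"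
      using vsize_left[of w] vsize_right[of w] vlen_le[of "left w"] vlen_le[of "right w"] by simp
  next
    fix w x y acc
    assume "vlen acc + vlen (Cell x y) \<le> 2 * vsize w \<and> vsize acc + 12 * vlen (Cell x y) \<le> 36 * vsize w + 1"
    then show "vlen (elim (num (left (Cell x y))) acc) + vlen y \<le> 2 * vsize w \<and>
        vsize (elim (num (left (Cell x y))) acc) + 12 * vlen y \<le> 36 * vsize w + 1"
      using vsize_drop_factors[of "num x" acc] vlen_drop_factors[of "num x" acc]
      by (auto simp: elim_def Let_def vsize_vsubst vlen_vsubst)
qed (intro ptime_rules ptime_elim | force)+

lemmas ptime_elims = ptime2[OF ptime_elims_aux]

definition solve :: "val \<Rightarrow> val" where
  "solve v = Num (finprod (elims (left v) (factors (right v))))"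

lemma ptime_solve: "ptime solve"
  unfolding solve_def by (intro ptime_rules ptime_num_finprod ptime_elims ptime_factors)

section \<open>Correctness of the factorization\<close>

lemma all_length_Suc: "(\<forall>y :: bool list. length y = Suc k \<longrightarrow> P y) \<longleftrightarrow>
    (\<forall>y. length y = k \<longrightarrow> P (False # y)) \<and> (\<forall>y. length y = k \<longrightarrow> P (True # y))"
proof safe
  fix y :: "bool list"
  assume *: "\<forall>y. length y = k \<longrightarrow> P (False # y)" "\<forall>y. length y = k \<longrightarrow> P (True # y)" "length y = Suc k"
  then obtain b z where "y = b # z" "length z = k" by (auto simp: length_Suc_conv)
  with * show "P y" by (cases b) simp_all
qed simp_all

lemma all_zero_table: "all_zero (enc_table k f) \<longleftrightarrow> (\<forall>y. length y = k \<longrightarrow> f y = 0)"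
proof (induction k arbitrary: f)
  case (Suc k)
  then show ?case by (simp add: all_length_Suc)
qed simp

lemma zero_where_table: "j < k \<Longrightarrow>
    zero_where b (enc_table k f) (of_nat j) \<longleftrightarrow> (\<forall>y. length y = k \<longrightarrow> y ! j = b \<longrightarrow> f y = 0)"
proof (induction k arbitrary: f j)
  case (Suc k)
  show ?case
  proof (cases j)
    case 0
    then show ?thesis by (cases b) (simp_all add: all_zero_table all_length_Suc)
  next
    case (Suc i)
    then have i: "i < k" "of_nat j - (1 :: complex) = of_nat i" "of_nat j \<noteq> (0 :: complex)"
      using Suc.prems Suc of_nat_neq_0[of i, where 'a = complex] by simp_all
    show ?thesis
      unfolding enc_table.simps zero_where.simps i(2) all_length_Suc using Suc.IH[OF i(1)] i(3) Suc by simp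
  qed
qed simp

lemma first_nonzero_table: "\<exists>y. length y = k \<and> first_nonzero (enc_table k f) (enc_table k g) = Cell (Num (f y)) (Num (g y)) \<and>
    (f y = 0 \<and> g y = 0 \<longrightarrow> (\<forall>z. length z = k \<longrightarrow> f z = 0 \<and> g z = 0))"
proof (induction k arbitrary: f g)
  case (Suc k)
  obtain y0 where y0: "length y0 = k" "first_nonzero (enc_table k (\<lambda>x. f (False # x))) (enc_table k (\<lambda>x. g (False # x))) =
      Cell (Num (f (False # y0))) (Num (g (False # y0)))"
      "f (False # y0) = 0 \<and> g (False # y0) = 0 \<longrightarrow> (\<forall>z. length z = k \<longrightarrow> f (False # z) = 0 \<and> g (False # z) = 0)"
    using Suc.IH[of "\<lambda>x. f (False # x)" "\<lambda>x. g (False # x)"] by blast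
  obtain y1 where y1: "length y1 = k" "first_nonzero (enc_table k (\<lambda>x. f (True # x))) (enc_table k (\<lambda>x. g (True # x))) =
      Cell (Num (f (True # y1))) (Num (g (True # y1)))"
      "f (True # y1) = 0 \<and> g (True # y1) = 0 \<longrightarrow> (\<forall>z. length z = k \<longrightarrow> f (True # z) = 0 \<and> g (True # z) = 0)"
    using Suc.IH[of "\<lambda>x. f (True # x)" "\<lambda>x. g (True # x)"] by blast
  show ?case
  proof (cases "f (False # y0) = 0 \<and> g (False # y0) = 0")
    case True
    have "\<forall>z. length z = k \<longrightarrow> f (False # z) = 0 \<and> g (False # z) = 0"
      using True y0(3) by blast
    then have "f (True # y1) = 0 \<and> g (True # y1) = 0 \<longrightarrow> (\<forall>z. length z = Suc k \<longrightarrow> f z = 0 \<and> g z = 0)"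
      unfolding all_length_Suc using y1(3) by blast
    moreover have "first_nonzero (enc_table (Suc k) f) (enc_table (Suc k) g) = Cell (Num (f (True # y1))) (Num (g (True # y1)))"
      using True y0(2) y1(2) by simp
    moreover have "length (True # y1) = Suc k" using y1(1) by simp
    ultimately show ?thesis by blast
  next
    case False
    then have "first_nonzero (enc_table (Suc k) f) (enc_table (Suc k) g) = Cell (Num (f (False # y0))) (Num (g (False # y0)))"
      using False y0(2) by auto
    with False y0(1) show ?thesis by (intro exI[of _ "False # y0"] conjI) auto
  qed
qed simp

lemma table_add_table: "table_add (enc_table k f) (enc_table k g) = enc_table k (\<lambda>x. f x + g x)"
  by (induction k arbitrary: f g) auto

lemma zero_where_linked: "j < k \<Longrightarrow> zero_where q (enc_table k (\<lambda>x. f (False # x))) (of_nat j) \<and>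
    zero_where (\<not> q) (enc_table k (\<lambda>x. f (True # x))) (of_nat j) \<longleftrightarrow> linked k f j q"
  unfolding linked_def by (cases q) (auto simp: zero_where_table all_bool_eq)

lemma find_link_table:
  assumes "length ys + j = k"
  shows "(\<exists>i q. j \<le> i \<and> i < k \<and> linked k f i q \<and>
      find_link (enc_table k (\<lambda>x. f (False # x))) (enc_table k (\<lambda>x. f (True # x))) (enc_list (map enc_nat ys)) (of_nat j)
        = Cell (enc_nat (ys ! (i - j))) (Num (of_bool q))) \<or>
    (\<forall>i q. j \<le> i \<longrightarrow> i < k \<longrightarrow> \<not> linked k f i q) \<and>
      find_link (enc_table k (\<lambda>x. f (False # x))) (enc_table k (\<lambda>x. f (True # x))) (enc_list (map enc_nat ys)) (of_nat j) = Null"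
  using assms
proof (induction ys arbitrary: j)
  case (Cons y ys)
  then have jk: "j < k" by simp
  note L = zero_where_linked[OF jk, of True f] zero_where_linked[OF jk, of False f]
  show ?case
  proof (cases "\<exists>q. linked k f j q")
    case True
    then show ?thesis
      using L jk by (intro disjI1 exI[of _ j] exI[of _ "linked k f j True"]) (auto simp: enc_nat_def ex_bool_eq)
  next
    case False
    have "of_nat j + 1 = (of_nat (Suc j) :: complex)" by simp
    then have e: "find_link (enc_table k (\<lambda>x. f (False # x))) (enc_table k (\<lambda>x. f (True # x))) (enc_list (map enc_nat (y # ys))) (of_nat j)
       = find_link (enc_table k (\<lambda>x. f (False # x))) (enc_table k (\<lambda>x. f (True # x))) (enc_list (map enc_nat ys)) (of_nat (Suc j))"
      using False L by (auto simp del: of_nat_Suc)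
    from Cons.IH[of "Suc j"] Cons.prems consider i q where "Suc j \<le> i" "i < k" "linked k f i q"
      "find_link (enc_table k (\<lambda>x. f (False # x))) (enc_table k (\<lambda>x. f (True # x))) (enc_list (map enc_nat ys)) (of_nat (Suc j))
        = Cell (enc_nat (ys ! (i - Suc j))) (Num (of_bool q))"
      | "\<forall>i q. Suc j \<le> i \<longrightarrow> i < k \<longrightarrow> \<not> linked k f i q"
      "find_link (enc_table k (\<lambda>x. f (False # x))) (enc_table k (\<lambda>x. f (True # x))) (enc_list (map enc_nat ys)) (of_nat (Suc j)) = Null"
      by auto
    then show ?thesis
    proof cases
      case (1 i q)
      then have "i - j = Suc (i - Suc j)" by simp
      then have "(y # ys) ! (i - j) = ys ! (i - Suc j)" by simp
      moreover have "j \<le> i" using 1(1) by simp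
      ultimately show ?thesis
        unfolding e using 1 by (intro disjI1 exI[of _ i] exI[of _ q]) (simp del: of_nat_Suc)
    next
      case 2
      with False show ?thesis unfolding e by (metis Suc_leI le_neq_implies_less)
    qed
  qed
qed auto

definition fvalue :: "val \<Rightarrow> (complex \<Rightarrow> bool) \<Rightarrow> complex" where
  "fvalue r \<sigma> = (if \<sigma> (rx r) then if \<sigma> (ry r) then r11 r else r10 r
     else if \<sigma> (ry r) then r01 r else r00 r)"

primrec wprod :: "val \<Rightarrow> (complex \<Rightarrow> bool) \<Rightarrow> complex" where
  "wprod (Cell r fs) \<sigma> = fvalue r \<sigma> * wprod fs \<sigma>"
| "wprod Null \<sigma> = 1"
| "wprod (Num z) \<sigma> = 1"

text \<open>The invariant behind the elimination: a factor on two different variables is diagonal or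
  antidiagonal, so where it is nonzero each of its variables determines the other.\<close>

definition good :: "val \<Rightarrow> bool" where
  "good r \<longleftrightarrow> rx r = ry r \<or> r01 r = 0 \<and> r10 r = 0 \<or> r00 r = 0 \<and> r11 r = 0"

primrec goods :: "val \<Rightarrow> bool" where
  "goods (Cell r fs) \<longleftrightarrow> good r \<and> goods fs"
| "goods Null \<longleftrightarrow> True"
| "goods (Num z) \<longleftrightarrow> True"

lemma fvalue_unary: "fvalue (mk_factor x x a b c d) \<sigma> = (if \<sigma> x then d else a)"
  by (simp add: fvalue_def)

text \<open>The program follows \<open>factorable_Suc_cases\<close>: if no link is found, the table
  is separable. Its halves are then proportional, and one half together with the ratio at a single
  position suffices.\<close>

lemma pstep_table:
  assumes f: "factorable (Suc k) f" and k: "length xs = k"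
  shows "\<exists>g out'. pstep (enc_list (map enc_nat (x # xs))) (Cell (enc_table (Suc k) f) out) = Cell (enc_table k g) out' \<and>
    factorable k g \<and> (goods out \<longrightarrow> goods out') \<and>
    (\<forall>\<sigma>. g (map (\<lambda>x. \<sigma> (of_nat x)) xs) * wprod out' \<sigma> = f (map (\<lambda>x. \<sigma> (of_nat x)) (x # xs)) * wprod out \<sigma>)"
proof -
  let ?s = "enc_table k (\<lambda>x. f (False # x))" and ?t = "enc_table k (\<lambda>x. f (True # x))"
  let ?k = "find_link ?s ?t (enc_list (map enc_nat xs)) 0"
  have len: "length (map (\<lambda>x. \<sigma> (of_nat x)) xs) = k" for \<sigma> :: "complex \<Rightarrow> bool" using k by simp
  from find_link_table[of xs 0 k f] k consider i q where "i < k" "linked k f i q"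
      "?k = Cell (enc_nat (xs ! i)) (Num (of_bool q))"
    | "\<forall>i q. i < k \<longrightarrow> \<not> linked k f i q" "?k = Null"
    by auto
  then show ?thesis
  proof cases
    case (1 i q)
    let ?g = "\<lambda>y. f (False # y) + f (True # y)"
    let ?r = "mk_factor (of_nat x) (of_nat (xs ! i)) (of_bool q) (1 - of_bool q) (1 - of_bool q) (of_bool q)"
    show ?thesis
    proof (intro exI conjI allI)
      show "pstep (enc_list (map enc_nat (x # xs))) (Cell (enc_table (Suc k) f) out) = Cell (enc_table k ?g) (Cell ?r out)"
        by (simp add: pstep_def Let_def 1(3) table_add_table) (simp add: enc_nat_def)
      show "factorable k ?g" by (rule factorable_sum_linked[OF 1(2,1) f])
      show "goods out \<longrightarrow> goods (Cell ?r out)" by (cases q) (auto simp: good_def)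
      show "?g (map (\<lambda>x. \<sigma> (of_nat x)) xs) * wprod (Cell ?r out) \<sigma> = f (map (\<lambda>x. \<sigma> (of_nat x)) (x # xs)) * wprod out \<sigma>" for \<sigma>
        using linked_sum[OF 1(2) len, of "\<sigma> (of_nat x)" \<sigma>] 1(1) k
        by (cases q; cases "\<sigma> (of_nat x)"; cases "\<sigma> (of_nat (xs ! i))") (simp_all add: fvalue_def)
    qed
  next
    case 2
    then obtain h g where hg: "\<And>b y. length y = k \<Longrightarrow> f (b # y) = h b * g y"
      using factorable_Suc_cases[OF f] unfolding separable_def by blast
    obtain y where y: "length y = k" "first_nonzero ?s ?t = Cell (Num (f (False # y))) (Num (f (True # y)))"
      "f (False # y) = 0 \<and> f (True # y) = 0 \<longrightarrow> (\<forall>z. length z = k \<longrightarrow> f (False # z) = 0 \<and> f (True # z) = 0)"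
      using first_nonzero_table[of k "\<lambda>x. f (False # x)" "\<lambda>x. f (True # x)"] by blast
    show ?thesis
    proof (cases "f (False # y) = 0")
      case False
      let ?r = "mk_factor (of_nat x) (of_nat x) 1 0 0 (f (True # y) / f (False # y))"
      show ?thesis
      proof (intro exI conjI allI)
        show "pstep (enc_list (map enc_nat (x # xs))) (Cell (enc_table (Suc k) f) out) = Cell ?s (Cell ?r out)"
          using False by (simp add: pstep_def Let_def 2(2) y(2)) (simp add: enc_nat_def)
        show "factorable k (\<lambda>x. f (False # x))" by (rule factorable_restrict[OF f])
        show "goods out \<longrightarrow> goods (Cell ?r out)" by (auto simp: good_def)
        have "h False \<noteq> 0" "g y \<noteq> 0" using False hg[OF y(1)] by auto
        then show "f (False # map (\<lambda>x. \<sigma> (of_nat x)) xs) * wprod (Cell ?r out) \<sigma> = f (map (\<lambda>x. \<sigma> (of_nat x)) (x # xs)) * wprod out \<sigma>" for \<sigma>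
          by (cases "\<sigma> (of_nat x)") (simp_all add: fvalue_unary hg[OF y(1)] hg[OF len])
      qed
    next
      case True
      let ?r = "mk_factor (of_nat x) (of_nat x) 0 0 0 1"
      show ?thesis
      proof (intro exI conjI allI)
        show "pstep (enc_list (map enc_nat (x # xs))) (Cell (enc_table (Suc k) f) out) = Cell ?t (Cell ?r out)"
          using True by (simp add: pstep_def Let_def 2(2) y(2)) (simp add: enc_nat_def)
        show "factorable k (\<lambda>x. f (True # x))" by (rule factorable_restrict[OF f])
        show "goods out \<longrightarrow> goods (Cell ?r out)" by (auto simp: good_def)
        \<comment> \<open>Either both halves vanish identically, or the entry at
          \<open>True # y\<close> is nonzero. In that case \<open>g y \<noteq> 0\<close>, so
          \<open>h False = 0\<close> and the whole half at \<open>False\<close> is zero.\<close>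
        have "f (False # z) = 0" if "length z = k" for z
          using True y(3) hg[OF y(1)] hg[OF that] that by (cases "h False = 0") auto
        then show "f (True # map (\<lambda>x. \<sigma> (of_nat x)) xs) * wprod (Cell ?r out) \<sigma> = f (map (\<lambda>x. \<sigma> (of_nat x)) (x # xs)) * wprod out \<sigma>" for \<sigma>
          using len[of \<sigma>] by (cases "\<sigma> (of_nat x)") (simp_all add: fvalue_unary)
      qed
    qed
  qed
qed

lemma peel_table:
  assumes "factorable k f" "length xs = k"
  shows "(goods out \<longrightarrow> goods (peel (enc_list (map enc_nat xs)) (enc_table k f) out)) \<and>
    wprod (peel (enc_list (map enc_nat xs)) (enc_table k f) out) \<sigma> = f (map (\<lambda>x. \<sigma> (of_nat x)) xs) * wprod out \<sigma>"
proof -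
  have "\<exists>z out'. vfold pstep (enc_list (map enc_nat xs)) (Cell (enc_table k f) out) = Cell (Num z) out' \<and>
      (goods out \<longrightarrow> goods out') \<and> (\<forall>\<sigma>. z * wprod out' \<sigma> = f (map (\<lambda>x. \<sigma> (of_nat x)) xs) * wprod out \<sigma>)"
    using assms
  proof (induction xs arbitrary: k f out)
    case (Cons x xs)
    then obtain k' where k: "k = Suc k'" "length xs = k'" by auto
    obtain g out' where 1: "pstep (enc_list (map enc_nat (x # xs))) (Cell (enc_table k f) out) = Cell (enc_table k' g) out'"
      "factorable k' g" "goods out \<longrightarrow> goods out'"
      "\<forall>\<sigma>. g (map (\<lambda>x. \<sigma> (of_nat x)) xs) * wprod out' \<sigma> = f (map (\<lambda>x. \<sigma> (of_nat x)) (x # xs)) * wprod out \<sigma>"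
      using pstep_table[of k' f xs x out] Cons.prems k by auto
    from Cons.IH[OF 1(2) k(2), of out'] 1(1,3,4) show ?case by fastforce
  qed simp
  then show ?thesis
    by (auto simp: peel_def Let_def good_def fvalue_def)
qed

lemma vfold_left: "vfold (\<lambda>l acc. h (left l) acc) (enc_list vs) acc = fold h vs acc"
  by (induction vs arbitrary: acc) auto

lemma factors_csp:
  assumes "\<And>h xs. (h, xs) \<in> set cs \<Longrightarrow> factorable (arity h) (app h) \<and> length xs = arity h"
  shows "goods (factors (enc_list (map (\<lambda>(h, xs). Cell (enc_table (arity h) (app h)) (enc_list (map enc_nat xs))) cs))) \<and>
    wprod (factors (enc_list (map (\<lambda>(h, xs). Cell (enc_table (arity h) (app h)) (enc_list (map enc_nat xs))) cs))) \<sigma>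
      = (\<Prod>(h, xs)\<leftarrow>cs. app h (map (\<lambda>x. \<sigma> (of_nat x)) xs))"
proof -
  let ?e = "\<lambda>(h, xs). Cell (enc_table (arity h) (app h)) (enc_list (map enc_nat xs))"
  let ?F = "\<lambda>l acc. peel (right l) (left l) acc"
  have "(goods out \<longrightarrow> goods (fold ?F (map ?e cs) out)) \<and>
      wprod (fold ?F (map ?e cs) out) \<sigma> = (\<Prod>(h, xs)\<leftarrow>cs. app h (map (\<lambda>x. \<sigma> (of_nat x)) xs)) * wprod out \<sigma>" for out
    using assms
  proof (induction cs arbitrary: out)
    case (Cons c cs)
    obtain h xs where c: "c = (h, xs)" by (cases c)
    have "factorable (arity h) (app h)" "length xs = arity h"
      using Cons.prems[of h xs] by (simp_all add: c)
    note p = peel_table[OF this, of out \<sigma>]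
    have "(goods (peel (enc_list (map enc_nat xs)) (enc_table (arity h) (app h)) out) \<longrightarrow>
        goods (fold ?F (map ?e cs) (peel (enc_list (map enc_nat xs)) (enc_table (arity h) (app h)) out))) \<and>
      wprod (fold ?F (map ?e cs) (peel (enc_list (map enc_nat xs)) (enc_table (arity h) (app h)) out)) \<sigma>
      = (\<Prod>(h, xs)\<leftarrow>cs. app h (map (\<lambda>x. \<sigma> (of_nat x)) xs)) * wprod (peel (enc_list (map enc_nat xs)) (enc_table (arity h) (app h)) out) \<sigma>"
      by (rule Cons.IH, rule Cons.prems) simp
    with p show ?case by (auto simp: c)
  qed simp
  from this[of Null] show ?thesis
    unfolding factors_def vfold_left[of ?F] by simp
qed

section \<open>Correctness of the elimination\<close>

lemma fvalue_subst: "fvalue (subst v y (of_bool q) r) \<sigma> = fvalue r (\<sigma>(v := (\<sigma> y = q)))"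
  by (cases q; cases "rx r = v"; cases "ry r = v"; cases "\<sigma> y") (simp_all add: fvalue_def subst_def)

lemma good_subst: "good r \<Longrightarrow> good (subst v y q r)"
  unfolding good_def subst_def mk_factor_simps by auto

lemma wprod_vsubst: "wprod (vsubst v y (of_bool q) fs) \<sigma> = wprod fs (\<sigma>(v := (\<sigma> y = q)))"
  by (induction fs) (simp_all only: vsubst.simps wprod.simps fvalue_subst)

lemma goods_vsubst: "goods fs \<Longrightarrow> goods (vsubst v y q fs)"
  by (induction fs) (simp_all add: good_subst)

lemma goods_drop_factors: "goods fs \<Longrightarrow> goods (drop_factors v fs)"
  by (induction fs) simp_all

lemma find_edge_Cell:
  "goods fs \<Longrightarrow> isc (find_edge v fs) \<Longrightarrow> \<exists>y q. find_edge v fs = Cell (Num y) (Num (of_bool q)) \<and> y \<noteq> v \<and>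
    (\<forall>\<sigma>. wprod fs \<sigma> \<noteq> 0 \<longrightarrow> \<sigma> v = (\<sigma> y = q))"
proof (induction fs)
  case (Cell r fs)
  define q where "q \<longleftrightarrow> r01 r = 0 \<and> r10 r = 0"
  have q: "(if r01 r = 0 \<and> r10 r = 0 then Num 1 else Num 0) = Num (of_bool q)" by (simp add: q_def)
  have gd: "fvalue r \<sigma> \<noteq> 0 \<longrightarrow> (\<sigma> (rx r) = \<sigma> (ry r)) = q" if "rx r \<noteq> ry r" for \<sigma>
    using Cell.prems(1) that by (auto simp: good_def fvalue_def q_def)
  consider "rx r = v \<and> ry r \<noteq> v" | "ry r = v \<and> rx r \<noteq> v" | "\<not> (rx r = v \<and> ry r \<noteq> v)" "\<not> (ry r = v \<and> rx r \<noteq> v)"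
    by blast
  then show ?case
  proof cases
    case 1
    then have "find_edge v (Cell r fs) = Cell (Num (ry r)) (Num (of_bool q))" by (auto simp: q_def)
    moreover have "\<forall>\<sigma>. wprod (Cell r fs) \<sigma> \<noteq> 0 \<longrightarrow> \<sigma> v = (\<sigma> (ry r) = q)"
    proof (intro allI impI)
      fix \<sigma>
      assume "wprod (Cell r fs) \<sigma> \<noteq> 0"
      then have "(\<sigma> (rx r) = \<sigma> (ry r)) = q" using gd[of \<sigma>] 1 by auto
      then show "\<sigma> v = (\<sigma> (ry r) = q)" using 1 by auto
    qed
    ultimately show ?thesis using 1 by blast
  next
    case 2
    then have "find_edge v (Cell r fs) = Cell (Num (rx r)) (Num (of_bool q))" by (auto simp: q_def)
    moreover have "\<forall>\<sigma>. wprod (Cell r fs) \<sigma> \<noteq> 0 \<longrightarrow> \<sigma> v = (\<sigma> (rx r) = q)"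
    proof (intro allI impI)
      fix \<sigma>
      assume "wprod (Cell r fs) \<sigma> \<noteq> 0"
      then have "(\<sigma> (rx r) = \<sigma> (ry r)) = q" using gd[of \<sigma>] 2 by auto
      then show "\<sigma> v = (\<sigma> (rx r) = q)" using 2 by auto
    qed
    ultimately show ?thesis using 2 by blast
  next
    case 3
    then have e: "find_edge v (Cell r fs) = find_edge v fs" by auto
    with Cell.prems have "goods fs" "isc (find_edge v fs)" by (simp_all del: find_edge.simps)
    from Cell.IH(2)[OF this] obtain y q where "find_edge v fs = Cell (Num y) (Num (of_bool q))" "y \<noteq> v"
      "\<forall>\<sigma>. wprod fs \<sigma> \<noteq> 0 \<longrightarrow> \<sigma> v = (\<sigma> y = q)" by blast
    moreover from this(3) have "\<forall>\<sigma>. wprod (Cell r fs) \<sigma> \<noteq> 0 \<longrightarrow> \<sigma> v = (\<sigma> y = q)" by simp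
    ultimately show ?thesis unfolding e by blast
  qed
qed simp_all

text \<open>Without an edge at \<open>v\<close>, each factor has \<open>v\<close> at both places or
  at neither. The former are the unary factors collected by \<open>prodat\<close>, the latter do not
  see the update at \<open>v\<close>.\<close>

lemma find_edge_Null:
  "\<not> isc (find_edge v fs) \<Longrightarrow> wprod fs (\<sigma>(v := b)) = prodat b v fs * wprod (drop_factors v fs) \<sigma>"
proof (induction fs)
  case (Cell r fs)
  then have "rx r = v \<longleftrightarrow> ry r = v" by (auto split: if_splits)
  with Cell show ?case by (auto simp: fvalue_def split: if_splits)
qed simp_all

lemma elim_correct:
  assumes "goods fs"
  shows "wprod fs (\<sigma>(v := False)) + wprod fs (\<sigma>(v := True)) = wprod (elim v fs) \<sigma>" and "goods (elim v fs)"
proof -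
  show "goods (elim v fs)"
    using assms by (auto simp: elim_def Let_def goods_vsubst goods_drop_factors good_def)
  show "wprod fs (\<sigma>(v := False)) + wprod fs (\<sigma>(v := True)) = wprod (elim v fs) \<sigma>"
  proof (cases "isc (find_edge v fs)")
    case True
    then obtain y q where yq: "find_edge v fs = Cell (Num y) (Num (of_bool q))" "y \<noteq> v"
      "\<And>\<sigma>. wprod fs \<sigma> \<noteq> 0 \<Longrightarrow> \<sigma> v = (\<sigma> y = q)"
      using find_edge_Cell[OF assms] by blast
    have "wprod fs (\<sigma>(v := b)) = 0" if "b \<noteq> (\<sigma> y = q)" for b
      using yq(3)[of "\<sigma>(v := b)"] yq(2) that by auto
    \<comment> \<open>Of the two values of \<open>v\<close> only the one dictated by
      \<open>y\<close> contributes, so the sum is the product after substitution.\<close>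
    from this[of "\<sigma> y \<noteq> q"] have "wprod fs (\<sigma>(v := False)) + wprod fs (\<sigma>(v := True)) = wprod fs (\<sigma>(v := (\<sigma> y = q)))"
      by (cases "\<sigma> y = q") auto
    then show ?thesis
      by (simp add: elim_def Let_def yq(1) wprod_vsubst)
  next
    case False
    then show ?thesis
      by (simp add: elim_def Let_def find_edge_Null[OF False] fvalue_def algebra_simps)
  qed
qed

text \<open>Bridges the variables of an instance, which are naturals, and those of factors, which
  are complex numbers. The base \<open>\<tau>\<close> stays arbitrary because eliminating one more
  variable updates it.\<close>

primrec overwrite :: "nat \<Rightarrow> (nat \<Rightarrow> bool) \<Rightarrow> (complex \<Rightarrow> bool) \<Rightarrow> complex \<Rightarrow> bool" where
  "overwrite 0 \<sigma> \<tau> = \<tau>"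
| "overwrite (Suc n) \<sigma> \<tau> = (overwrite n \<sigma> \<tau>)(of_nat n := \<sigma> n)"

lemma overwrite_nth: "i < n \<Longrightarrow> overwrite n \<sigma> \<tau> (of_nat i) = \<sigma> i"
  by (induction n) (auto simp: less_Suc_eq)

lemma overwrite_upd: "n \<le> m \<Longrightarrow> overwrite n \<sigma> (\<tau>(of_nat m := b)) = (overwrite n \<sigma> \<tau>)(of_nat m := b)"
  by (induction n) (auto simp: fun_upd_twist)

lemma overwrite_cong: "(\<And>i. i < n \<Longrightarrow> \<sigma> i = \<sigma>' i) \<Longrightarrow> overwrite n \<sigma> \<tau> = overwrite n \<sigma>' \<tau>"
  by (induction n) auto

lemma sum_PiE_Suc:
  fixes G :: "(nat \<Rightarrow> bool) \<Rightarrow> complex"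
  shows "(\<Sum>\<sigma>\<in>{..<Suc n} \<rightarrow>\<^sub>E UNIV. G \<sigma>) = (\<Sum>\<sigma>\<in>{..<n} \<rightarrow>\<^sub>E UNIV. G (\<sigma>(n := False)) + G (\<sigma>(n := True)))"
proof -
  have "(\<Sum>\<sigma>\<in>{..<Suc n} \<rightarrow>\<^sub>E UNIV. G \<sigma>) = (\<Sum>(b, \<sigma>)\<in>UNIV \<times> ({..<n} \<rightarrow>\<^sub>E UNIV). G (\<sigma>(n := b)))"
    unfolding lessThan_Suc PiE_insert_eq
    by (subst sum.reindex) (use inj_combinator[of n "{..<n}" "\<lambda>_. UNIV"] in \<open>auto simp: case_prod_beta\<close>)
  also have "\<dots> = (\<Sum>b\<in>UNIV. \<Sum>\<sigma>\<in>{..<n} \<rightarrow>\<^sub>E UNIV. G (\<sigma>(n := b)))"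
    by (simp add: sum.cartesian_product)
  also have "\<dots> = (\<Sum>\<sigma>\<in>{..<n} \<rightarrow>\<^sub>E UNIV. G (\<sigma>(n := False)) + G (\<sigma>(n := True)))"
    by (simp add: UNIV_bool sum.distrib)
  finally show ?thesis .
qed

lemma elims_correct:
  assumes "goods fs"
  shows "goods (elims (enc_list (map enc_nat [0..<n])) fs) \<and>
    wprod (elims (enc_list (map enc_nat [0..<n])) fs) \<tau> = (\<Sum>\<sigma>\<in>{..<n} \<rightarrow>\<^sub>E UNIV. wprod fs (overwrite n \<sigma> \<tau>))"
proof -
  let ?F = "\<lambda>v acc. elim (num v) acc"
  have "goods (fold ?F (map enc_nat [0..<n]) fs) \<and> (\<forall>\<tau>. wprod (fold ?F (map enc_nat [0..<n]) fs) \<tau>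
      = (\<Sum>\<sigma>\<in>{..<n} \<rightarrow>\<^sub>E UNIV. wprod fs (overwrite n \<sigma> \<tau>)))"
  proof (induction n)
    case 0
    then show ?case using assms by simp
  next
    case (Suc n)
    have "wprod (elim (of_nat n) (fold ?F (map enc_nat [0..<n]) fs)) \<tau> =
        (\<Sum>\<sigma>\<in>{..<Suc n} \<rightarrow>\<^sub>E UNIV. wprod fs (overwrite (Suc n) \<sigma> \<tau>))" for \<tau>
    proof -
      have *: "overwrite (Suc n) (\<sigma>(n := b)) \<tau> = overwrite n \<sigma> (\<tau>(of_nat n := b))" for \<sigma> b
        by (simp add: overwrite_upd overwrite_cong[of n "\<sigma>(n := b)" \<sigma>])
      show ?thesis
        unfolding sum_PiE_Suc * sum.distrib elim_correct(1)[OF Suc[THEN conjunct1], symmetric]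
        by (simp only: Suc)
    qed
    moreover have "fold ?F (map enc_nat [0..<Suc n]) fs = elim (of_nat n) (fold ?F (map enc_nat [0..<n]) fs)"
      by (simp add: enc_nat_def[of n])
    ultimately show ?case using Suc elim_correct(2) by metis
  qed
  then show ?thesis
    unfolding elims_def vfold_left[of ?F] by simp
qed

lemma finprod_eq_wprod: "finprod fs = wprod fs (\<lambda>_. False)"
  by (induction fs) (simp_all add: fvalue_def)

lemma solve_correct:
  assumes "I \<in> csp_instances F" "\<And>h. h \<in> F \<Longrightarrow> factorable (arity h) (app h)"
  shows "solve (enc_csp I) = Num (csp_count I)"
proof -
  obtain n cs where I: "I = (n, cs)" by (cases I)
  define fs where "fs = factors (enc_list (map (\<lambda>(h, xs). Cell (enc_table (arity h) (app h)) (enc_list (map enc_nat xs))) cs))"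
  have wf: "h \<in> F" "length xs = arity h" "set xs \<subseteq> {..<n}" if "(h, xs) \<in> set cs" for h xs
    using assms(1) that by (auto simp: csp_instances_def I)
  have fs: "goods fs" "wprod fs \<sigma> = (\<Prod>(h, xs)\<leftarrow>cs. app h (map (\<lambda>x. \<sigma> (of_nat x)) xs))" for \<sigma>
    using factors_csp[of cs \<sigma>] wf assms(2) unfolding fs_def by blast+
  have "wprod fs (overwrite n \<sigma> \<tau>) = (\<Prod>(h, xs)\<leftarrow>cs. app h (map \<sigma> xs))" for \<sigma> \<tau>
  proof -
    have "map (\<lambda>(h, xs). app h (map (\<lambda>x. overwrite n \<sigma> \<tau> (of_nat x)) xs)) cs = map (\<lambda>(h, xs). app h (map \<sigma> xs)) cs"
    proof (rule map_cong[OF refl], clarify)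
      fix k f xs
      assume "((k, f), xs) \<in> set cs"
      from wf(3)[OF this] have "map (\<lambda>x. overwrite n \<sigma> \<tau> (of_nat x)) xs = map \<sigma> xs"
        by (auto simp: overwrite_nth)
      then show "app (k, f) (map (\<lambda>x. overwrite n \<sigma> \<tau> (of_nat x)) xs) = app (k, f) (map \<sigma> xs)"
        by (rule arg_cong)
    qed
    then show ?thesis by (simp only: fs(2))
  qed
  with elims_correct[OF fs(1), of n] show ?thesis
    by (simp add: solve_def I enc_csp_def csp_count_def finprod_eq_wprod flip: fs_def)
qed

lemma factorable_unary_constraint: "h \<in> unary \<Longrightarrow> factorable (arity h) (app h)"
  by (rule factorable_cong[OF factorable_unary[of 0 _ "\<lambda>b. app h [b]"]]) (auto simp: unary_def length_Suc_conv)

lemma real_poly: "\<exists>q :: real poly. \<forall>n. real (poly p n) = poly q (real n)"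
proof (induction p)
  case (pCons a p)
  then obtain q where "\<forall>n. real (poly p n) = poly q (real n)" by blast
  then show ?case by (intro exI[of _ "pCons (real a) q"]) simp
qed (auto intro: exI[of _ 0])

text \<open>Unary constraints are factorable as well, so \<open>solve\<close> handles the whole of
  \<open>F \<union> unary\<close>; the program is the same for every \<open>F\<close>.\<close>

lemma ED_in_FP:
  assumes "F \<subseteq> ED"
  shows "CSP_star F \<in> FP_C"
proof -
  obtain c N p where c: "deterministic c" "computes_in c N p solve"
    using ptime_solve unfolding ptime_def by blast
  obtain q :: "real poly" where q: "\<And>n. real (poly p n) = poly q (real n)"
    using real_poly by blast
  have "\<exists>n C. real n \<le> poly q (real (vsize (enc_csp I))) \<and>
      run no_oracle n (init c (enc_csp I)) = return_pmf C \<and> halted C \<and> result C = csp_count I"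
    if I: "I \<in> csp_instances (F \<union> unary)" for I
  proof -
    let ?s = "(\<lambda>_. Null)(0 := enc_csp I)"
    obtain t s' where t: "exec c ?s t s'" "s' 0 = solve (enc_csp I)" "t \<le> poly p (vsize (enc_csp I))"
      using computes_inD(1)[OF c(2), of ?s] by auto
    have "run no_oracle t (init c (enc_csp I)) = return_pmf ([], s')"
      using exec_run[OF t(1), of no_oracle 0 "[]"] by (simp add: init_def)
    moreover have "s' 0 = Num (csp_count I)"
      unfolding t(2) using assms factorable_unary_constraint ED_iff_factorable by (intro solve_correct[OF I]) blast
    moreover have "real t \<le> poly q (real (vsize (enc_csp I)))"
      using t(3) q by (metis of_nat_le_iff)
    ultimately show ?thesis
      by (intro exI[of _ t] exI[of _ "([], s')"]) (simp add: halted_def result_def)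
  qed
  with c(1) show ?thesis
    unfolding FP_C_def CSP_star_def CSP_def by blast
qed

section \<open>Many-one reductions and the compilation of formulas\<close>

text \<open>These commands are the charge for writing out a query.\<close>

lemma run_Skips: "run M j (replicate k Skip, s) = return_pmf (replicate (k - j) Skip, s)"
proof (induction j arbitrary: k)
  case (Suc j)
  have 0: "run M j ([], s) = return_pmf ([], s)" using Suc.IH[of 0] by simp
  show ?case using Suc.IH 0 by (cases k) (simp_all add: bind_return_pmf)
qed simp

lemma run_Query: "run M (Suc j) ([Query x a d], s) =
    map_pmf (\<lambda>z. (replicate (vsize (eval_exp a s) - j) Skip, s(x := Num z)))
      (M (eval_exp a s) (Re (num (eval_exp d s))))"
  by (simp add: bind_map_pmf run_Skips) (simp add: map_pmf_def)

lemma real_poly_coeffs: "\<exists>q :: real poly poly. \<forall>n b. real (poly p n) = poly2 q (real n) b"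
proof -
  obtain q :: "real poly" where q: "\<And>n. real (poly p n) = poly q (real n)"
    using real_poly by blast
  have "\<exists>r :: real poly poly. \<forall>a b. poly2 r a b = poly q' a" for q' :: "real poly"
  proof (induction q')
    case 0
    show ?case by (intro exI[of _ 0]) (simp add: poly2_def)
  next
    case (pCons a q')
    then obtain r :: "real poly poly" where "\<forall>a b. poly2 r a b = poly q' a" by blast
    then show ?case by (intro exI[of _ "pCons [:a:] r"]) (simp add: poly2_def)
  qed
  with q show ?thesis by metis
qed

text \<open>A map that preserves the value exactly is a reduction: an approximate solution for the
  image is one for the original at the same accuracy, so the oracle's answer is returned unchanged,
  with its probability of success.\<close>

lemma AP_reducible_of_ptime:
  assumes "ptime f" and f: "\<And>v y. (v, y) \<in> P \<Longrightarrow> (f v, y) \<in> Q"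
  shows "P \<le>\<^sub>A\<^sub>P Q"
proof -
  obtain c N p where c: "computes_in c N p f"
    using assms(1) unfolding ptime_def by blast
  \<comment> \<open>The accuracy is saved in a variable that \<open>c\<close> leaves alone, and
    which differs from the input variable \<open>0\<close>.\<close>
  define L where "L = Suc N"
  define pre where "pre = Seq (Assign L (Snd (Var 0))) (Seq (Assign 0 (Fst (Var 0))) c)"
  define prog where "prog = Seq pre (Query 0 (Var 0) (Var L))"
  \<comment> \<open>One \<open>p\<close> bounds the time of \<open>c\<close> and the other the size
    of the query, which is charged again as \<open>Skip\<close>s. The 6 counts three sequencings,
    two assignments and the query.\<close>
  obtain t :: "real poly poly" where t: "\<And>n b. real (poly (2 * p + 6) n) = poly2 t (real n) b"
    using real_poly_coeffs by blast
  \<comment> \<open>This is the polynomial with \<open>poly2 r a b = b\<close>, so the accuracy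
    bound is \<open>1 / \<epsilon>\<close> itself.\<close>
  define r :: "real poly poly" where "r = [:[:0, 1:]:]"
  have "let C0 = init prog (with_accuracy v \<epsilon>); s = real (vsize v) in
      (\<exists>n. real n \<le> poly2 t s (1 / \<epsilon>) \<and> (\<forall>C \<in> set_pmf (run M n C0). halted C) \<and>
         measure_pmf.prob (run M n C0) {C. approx_solution \<epsilon> y (result C)} \<ge> 3/4) \<and>
      (\<forall>n. \<forall>C \<in> set_pmf (run M n C0). \<forall>w \<delta>. pending_query C = Some (w, \<delta>) \<longrightarrow>
         w \<in> Domain Q \<and> 0 < \<delta> \<and> \<delta> < 1 \<and> 1 / \<delta> \<le> poly2 r s (1 / \<epsilon>))"
    if M: "RAS Q M" and vy: "(v, y) \<in> P" and \<epsilon>: "0 < \<epsilon>" "\<epsilon> < 1" for M v y \<epsilon>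
  proof -
    let ?s0 = "(\<lambda>_. Null)(0 := with_accuracy v \<epsilon>)"
    let ?s1 = "?s0(L := Num (complex_of_real \<epsilon>))"
    let ?s2 = "?s1(0 := v)"
    obtain u s' where u: "exec c ?s2 u s'" "s' 0 = f v" "\<forall>i\<ge>N. s' i = ?s2 i" "u \<le> poly p (vsize v)"
      using computes_inD(1)[OF c, of ?s2] by auto
    have 1: "exec (Assign L (Snd (Var 0))) ?s0 1 ?s1"
      using exec_Assign[of L "Snd (Var 0)" ?s0] by (simp add: with_accuracy_def)
    have 2: "exec (Assign 0 (Fst (Var 0))) ?s1 1 ?s2"
      using exec_Assign[of 0 "Fst (Var 0)" ?s1] by (simp add: with_accuracy_def L_def)
    define T where "T = 1 + (1 + u + 1) + 1"
    have pre: "exec pre ?s0 T s'"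
      unfolding pre_def T_def by (rule exec_Seq[OF 1 exec_Seq[OF 2 u(1)]])
    have sL: "s' L = Num (complex_of_real \<epsilon>)" using u(3) by (simp add: L_def)
    let ?K = "[Query 0 (Var 0) (Var L)]"
    have run0: "run M (Suc i) (init prog (with_accuracy v \<epsilon>)) = run M i (pre # ?K, ?s0)" for i
      by (simp add: init_def prog_def bind_return_pmf)
    have run1: "run M (Suc (T + Suc j)) (init prog (with_accuracy v \<epsilon>)) =
        map_pmf (\<lambda>z. (replicate (vsize (f v) - j) Skip, s'(0 := Num z))) (M (f v) \<epsilon>)" for j
      unfolding run0 exec_run[OF pre] run_Query by (simp add: u(2) sL)
    show ?thesis
      unfolding Let_def
    proof (intro conjI allI ballI impI)
      let ?n = "Suc (T + Suc (vsize (f v)))"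
      have "vsize (f v) \<le> poly p (vsize v)" by (rule computes_inD(2)[OF c])
      then have "?n \<le> poly (2 * p + 6) (vsize v)"
        using u(4) by (simp add: T_def)
      then have "real ?n \<le> poly2 t (real (vsize v)) (1 / \<epsilon>)"
        by (metis of_nat_le_iff t)
      moreover have "\<forall>C \<in> set_pmf (run M ?n (init prog (with_accuracy v \<epsilon>))). halted C"
        unfolding run1 by (auto simp: halted_def)
      moreover have "measure_pmf.prob (run M ?n (init prog (with_accuracy v \<epsilon>))) {C. approx_solution \<epsilon> y (result C)} \<ge> 3/4"
      proof -
        have "measure_pmf.prob (M (f v) \<epsilon>) {w. approx_solution \<epsilon> y w} \<ge> 3/4"
          using M f[OF vy] \<epsilon> unfolding RAS_def by blast
        then show ?thesis
          unfolding run1 by (simp add: result_def vimage_def)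
      qed
      ultimately show "\<exists>n. real n \<le> poly2 t (real (vsize v)) (1 / \<epsilon>) \<and>
         (\<forall>C \<in> set_pmf (run M n (init prog (with_accuracy v \<epsilon>))). halted C) \<and>
         measure_pmf.prob (run M n (init prog (with_accuracy v \<epsilon>))) {C. approx_solution \<epsilon> y (result C)} \<ge> 3/4"
        by blast
    next
      fix n C w \<delta>
      assume C: "C \<in> set_pmf (run M n (init prog (with_accuracy v \<epsilon>)))" "pending_query C = Some (w, \<delta>)"
      have "w = f v \<and> \<delta> = \<epsilon>"
      proof (cases n)
        case 0
        with C show ?thesis by (simp add: init_def prog_def)
      next
        case (Suc i)
        show ?thesis
        proof (cases "i < T")
          case True
          with C Suc show ?thesis
            using exec_no_query[OF pre True, of M ?K] by (auto simp: run0 simp del: run.simps)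
        next
          case False
          then obtain k where k: "i = T + k" by (metis add_diff_inverse_nat)
          show ?thesis
          proof (cases k)
            case 0
            have "run M n (init prog (with_accuracy v \<epsilon>)) = return_pmf (?K, s')"
              unfolding Suc k 0 run0 exec_run[OF pre] by simp
            with C show ?thesis by (simp add: u(2) sL)
          next
            case (Suc j)
            have "pending_query (replicate m Skip, s) = None" for m s
              by (cases m) auto
            with C show ?thesis
              unfolding \<open>n = Suc i\<close> k Suc run1 by auto
          qed
        qed
      qed
      with f[OF vy] \<epsilon> show "w \<in> Domain Q" "0 < \<delta>" "\<delta> < 1" "1 / \<delta> \<le> poly2 r (real (vsize v)) (1 / \<epsilon>)"
        by (auto simp: r_def poly2_def)
    qed
  qed
  then show ?thesis
    unfolding AP_reducible_def by blast
qed

section \<open>Compiling a formula into gates\<close>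

lemma vsum_sum_PiE: "dep n P \<Longrightarrow> vsum 0 n P \<tau> = (\<Sum>\<sigma>\<in>{..<n} \<rightarrow>\<^sub>E UNIV. P \<sigma>)"
proof (induction n arbitrary: P)
  case 0
  then show ?case using depD[OF 0, of \<tau> "\<lambda>_. undefined"] by simp
next
  case (Suc n)
  let ?P = "\<lambda>\<sigma>. P (\<sigma>(n := False)) + P (\<sigma>(n := True))"
  have "dep n ?P"
    unfolding dep_def
  proof (intro allI impI)
    fix \<sigma> \<rho> :: "nat \<Rightarrow> bool"
    assume *: "\<forall>i<n. \<sigma> i = \<rho> i"
    have "P (\<sigma>(n := b)) = P (\<rho>(n := b))" for b
      by (rule depD[OF Suc.prems]) (use * in \<open>auto simp: less_Suc_eq\<close>)
    then show "?P \<sigma> = ?P \<rho>" by simp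
  qed
  moreover have "vsum 0 (Suc n) P \<tau> = vsum 0 n ?P \<tau>"
  proof -
    have "vsum (0 + n) 1 P = ?P" by (rule ext) simp
    with vsum_add[of 0 n 1 P \<tau>] show ?thesis by (simp only: Suc_eq_plus1)
  qed
  ultimately show ?case
    unfolding sum_PiE_Suc by (simp only: Suc.IH)
qed

text \<open>The codes 1, 2, 3 are the tags of negation, disjunction and conjunction in
  \<open>enc_form\<close>.\<close>

definition gate :: "nat \<Rightarrow> bool \<Rightarrow> bool \<Rightarrow> bool" where
  "gate t a b \<longleftrightarrow> (if t = 1 then \<not> a else if t = 2 then a \<or> b else a \<and> b)"

definition place :: "nat \<Rightarrow> nat \<Rightarrow> nat \<Rightarrow> nat \<Rightarrow> nat" where
  "place x1 x2 y p = (if p = 0 then x1 else if p = 1 then x2 else y + (p - 2))"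

text \<open>Fixes one gadget per gate code: variables 0 and 1 are the inputs, 2 is the output, and
  \<open>gm t\<close> more are auxiliary. Their sum is exactly the graph of the gate, as an
  indicator function.\<close>

locale gates =
  fixes F :: "constraint set" and gm :: "nat \<Rightarrow> nat" and gc :: "nat \<Rightarrow> (constraint \<times> nat list) list"
  assumes csp_over_gc: "csp_over F (3 + gm t) (gc t)"
    and vsum_gc: "vsum 3 (gm t) (cweight (gc t)) \<sigma> = of_bool (\<sigma> 2 = gate t (\<sigma> 0) (\<sigma> 1))"
begin

text \<open>\<open>Q\<close> is the context in which the output bit is used. As it involves no
  variable from \<open>y\<close> on except through that bit, the sum over output and auxiliary
  variables just plugs the value of the gate into it.\<close>

lemma gate_sum:
  assumes "x1 < y" "x2 < y" "\<And>b. dep y (Q b)"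
  shows "vsum y (Suc (gm t)) (\<lambda>\<sigma>. cweight (rename (place x1 x2 y) (gc t)) \<sigma> * Q (\<sigma> y) \<sigma>) \<sigma> =
    Q (gate t (\<sigma> x1) (\<sigma> x2)) \<sigma>"
proof -
  let ?\<rho> = "place x1 x2 y"
  let ?P = "\<lambda>\<sigma>. cweight (rename ?\<rho> (gc t)) \<sigma> * Q (\<sigma> y) \<sigma>"
  have d: "dep (Suc y) (\<lambda>\<sigma>. Q (\<sigma> y) \<sigma>)"
    unfolding dep_def
  proof (intro allI impI)
    fix \<sigma> \<tau> :: "nat \<Rightarrow> bool"
    assume *: "\<forall>i<Suc y. \<sigma> i = \<tau> i"
    then have "Q b \<sigma> = Q b \<tau>" for b by (intro depD[OF assms(3)]) simp
    with * show "Q (\<sigma> y) \<sigma> = Q (\<tau> y) \<tau>" by simp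
  qed
  have "vsum (Suc y) (gm t) ?P (\<sigma>(y := b)) = of_bool (b = gate t (\<sigma> x1) (\<sigma> x2)) * Q b \<sigma>" for b
  proof -
    let ?\<tau> = "\<sigma>(y := b)"
    have "vsum (Suc y) (gm t) ?P ?\<tau> = vsum (Suc y) (gm t) (\<lambda>\<sigma>. cweight (gc t) (\<sigma> \<circ> ?\<rho>)) ?\<tau> * Q (?\<tau> y) ?\<tau>"
      unfolding cweight_rename by (rule vsum_mult_right[OF d])
    also have "vsum (Suc y) (gm t) (\<lambda>\<sigma>. cweight (gc t) (\<sigma> \<circ> ?\<rho>)) ?\<tau> = vsum 3 (gm t) (cweight (gc t)) (?\<tau> \<circ> ?\<rho>)"
      by (rule vsum_rename) (use assms(1,2) in \<open>auto simp: place_def\<close>)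
    also have "vsum 3 (gm t) (cweight (gc t)) (?\<tau> \<circ> ?\<rho>) = of_bool (b = gate t (\<sigma> x1) (\<sigma> x2))"
      using assms(1,2) by (simp add: vsum_gc place_def)
    also have "Q (?\<tau> y) ?\<tau> = Q b \<sigma>"
      by (simp only: fun_upd_same dep_upd[OF assms(3) order_refl])
    finally show ?thesis .
  qed
  then show ?thesis
    by (cases "gate t (\<sigma> x1) (\<sigma> x2)") simp_all
qed

primrec compile :: "(nat \<Rightarrow> nat) \<Rightarrow> form \<Rightarrow> nat \<Rightarrow> nat \<times> (constraint \<times> nat list) list \<times> nat" where
  "compile ix (Prop x) B = (ix x, [], 0)"
| "compile ix (Neg a) B = (case compile ix a B of (x, cs, m) \<Rightarrow>
     (B + m, rename (place x x (B + m)) (gc 1) @ cs, m + Suc (gm 1)))"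
| "compile ix (Disj a b) B = (case compile ix a B of (x, cs, m) \<Rightarrow> case compile ix b (B + m) of (x', cs', m') \<Rightarrow>
     (B + m + m', rename (place x x' (B + m + m')) (gc 2) @ cs' @ cs, m + m' + Suc (gm 2)))"
| "compile ix (Conj a b) B = (case compile ix a B of (x, cs, m) \<Rightarrow> case compile ix b (B + m) of (x', cs', m') \<Rightarrow>
     (B + m + m', rename (place x x' (B + m + m')) (gc 3) @ cs' @ cs, m + m' + Suc (gm 3)))"

text \<open>The quantification over contexts \<open>Q\<close> is what makes this inductive: a larger
  formula, with its remaining gates, is such a context for its subformulas. The context may use the
  variables below \<open>B\<close> and the output bit.\<close>

definition compiled :: "(nat \<Rightarrow> nat) \<Rightarrow> form \<Rightarrow> nat \<Rightarrow> nat \<times> (constraint \<times> nat list) list \<times> nat \<Rightarrow> bool" where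
  "compiled ix \<phi> B r \<longleftrightarrow> (case r of (x, cs, m) \<Rightarrow> x < B + m \<and> csp_over F (B + m) cs \<and>
    (\<forall>Q \<sigma>. (\<forall>b. dep B (Q b)) \<longrightarrow> vsum B m (\<lambda>\<sigma>. cweight cs \<sigma> * Q (\<sigma> x) \<sigma>) \<sigma> = Q (sat (\<lambda>x. \<sigma> (ix x)) \<phi>) \<sigma>))"

lemma compiledD:
  assumes "compiled ix \<phi> B (x, cs, m)"
  shows "x < B + m" "csp_over F (B + m) cs"
    "(\<And>b. dep B (Q b)) \<Longrightarrow> vsum B m (\<lambda>\<sigma>. cweight cs \<sigma> * Q (\<sigma> x) \<sigma>) \<sigma> = Q (sat (\<lambda>x. \<sigma> (ix x)) \<phi>) \<sigma>"
  using assms unfolding compiled_def by auto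

lemma sat_cong: "(\<And>x. x \<in> vars \<phi> \<Longrightarrow> \<sigma> x = \<tau> x) \<Longrightarrow> sat \<sigma> \<phi> = sat \<tau> \<phi>"
  by (induction \<phi>) auto

lemma csp_over_gate: "x1 < y \<Longrightarrow> x2 < y \<Longrightarrow> csp_over F (y + Suc (gm t)) (rename (place x1 x2 y) (gc t))"
  by (rule csp_over_rename[OF csp_over_gc]) (auto simp: place_def)

lemma dep_Q: "(\<And>b. dep B (Q b)) \<Longrightarrow> x < B' \<Longrightarrow> x' < B' \<Longrightarrow> B \<le> B' \<Longrightarrow> dep B' (\<lambda>\<sigma>. Q (h (\<sigma> x) (\<sigma> x')) \<sigma>)"
  unfolding dep_def by (smt (verit) order_less_le_trans)

lemma compiled_unary:
  assumes "compiled ix a B (x, cs, m)" "\<And>\<sigma>. sat \<sigma> \<phi> = gate t (sat \<sigma> a) (sat \<sigma> a)"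
  shows "compiled ix \<phi> B (B + m, rename (place x x (B + m)) (gc t) @ cs, m + Suc (gm t))"
proof -
  note a = compiledD[OF assms(1)]
  have "vsum B (m + Suc (gm t)) (\<lambda>\<sigma>. cweight (rename (place x x (B + m)) (gc t) @ cs) \<sigma> * Q (\<sigma> (B + m)) \<sigma>) \<sigma> =
      Q (sat (\<lambda>x. \<sigma> (ix x)) \<phi>) \<sigma>" if Q: "\<And>b. dep B (Q b)" for Q :: "bool \<Rightarrow> (nat \<Rightarrow> bool) \<Rightarrow> complex" and \<sigma>
  proof -
    have "vsum (B + m) (Suc (gm t)) (\<lambda>\<sigma>. cweight (rename (place x x (B + m)) (gc t) @ cs) \<sigma> * Q (\<sigma> (B + m)) \<sigma>) \<sigma>
        = cweight cs \<sigma> * Q (gate t (\<sigma> x) (\<sigma> x)) \<sigma>" for \<sigma>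
    proof -
      have "vsum (B + m) (Suc (gm t)) (\<lambda>\<sigma>. cweight (rename (place x x (B + m)) (gc t) @ cs) \<sigma> * Q (\<sigma> (B + m)) \<sigma>) \<sigma>
        = vsum (B + m) (Suc (gm t)) (\<lambda>\<sigma>. cweight (rename (place x x (B + m)) (gc t)) \<sigma> * (cweight cs \<sigma> * Q (\<sigma> (B + m)) \<sigma>)) \<sigma>"
        by (rule vsum_cong) simp
      also have "\<dots> = cweight cs \<sigma> * Q (gate t (\<sigma> x) (\<sigma> x)) \<sigma>"
        by (rule gate_sum[OF a(1) a(1), of "\<lambda>b \<sigma>. cweight cs \<sigma> * Q b \<sigma>"])
           (intro dep_mult dep_cweight[OF a(2)] dep_mono[OF Q], simp)
      finally show ?thesis .
    qed
    then have "vsum B (m + Suc (gm t)) (\<lambda>\<sigma>. cweight (rename (place x x (B + m)) (gc t) @ cs) \<sigma> * Q (\<sigma> (B + m)) \<sigma>) \<sigma>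
      = vsum B m (\<lambda>\<sigma>. cweight cs \<sigma> * (\<lambda>b. Q (gate t b b)) (\<sigma> x) \<sigma>) \<sigma>"
      unfolding vsum_add by (intro vsum_cong)
    also have "\<dots> = Q (gate t (sat (\<lambda>x. \<sigma> (ix x)) a) (sat (\<lambda>x. \<sigma> (ix x)) a)) \<sigma>"
      by (rule a(3)) (rule Q)
    finally show ?thesis by (simp add: assms(2))
  qed
  then show ?thesis
    using csp_over_gate[OF a(1) a(1), of t] csp_over_mono[OF a(2)] by (simp add: compiled_def add.assoc)
qed

lemma compiled_binary:
  assumes "compiled ix a B (x, cs, m)" "compiled ix b (B + m) (x', cs', m')"
    and ix: "\<And>z. z \<in> vars b \<Longrightarrow> ix z < B" and \<phi>: "\<And>\<sigma>. sat \<sigma> \<phi> = gate t (sat \<sigma> a) (sat \<sigma> b)"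
  shows "compiled ix \<phi> B (B + m + m', rename (place x x' (B + m + m')) (gc t) @ cs' @ cs, m + m' + Suc (gm t))"
proof -
  note a = compiledD[OF assms(1)] and b = compiledD[OF assms(2)]
  let ?y = "B + m + m'"
  let ?g = "rename (place x x' ?y) (gc t)"
  have a1: "x < ?y" using a(1) by simp
  have "vsum B (m + m' + Suc (gm t)) (\<lambda>\<sigma>. cweight (?g @ cs' @ cs) \<sigma> * Q (\<sigma> ?y) \<sigma>) \<sigma> =
      Q (sat (\<lambda>x. \<sigma> (ix x)) \<phi>) \<sigma>" if Q: "\<And>b. dep B (Q b)" for Q :: "bool \<Rightarrow> (nat \<Rightarrow> bool) \<Rightarrow> complex" and \<sigma>
  proof -
    have 1: "vsum ?y (Suc (gm t)) (\<lambda>\<sigma>. cweight (?g @ cs' @ cs) \<sigma> * Q (\<sigma> ?y) \<sigma>) \<sigma>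
        = cweight cs' \<sigma> * (cweight cs \<sigma> * Q (gate t (\<sigma> x) (\<sigma> x')) \<sigma>)" for \<sigma>
    proof -
      have "vsum ?y (Suc (gm t)) (\<lambda>\<sigma>. cweight (?g @ cs' @ cs) \<sigma> * Q (\<sigma> ?y) \<sigma>) \<sigma>
        = vsum ?y (Suc (gm t)) (\<lambda>\<sigma>. cweight ?g \<sigma> * (cweight cs' \<sigma> * (cweight cs \<sigma> * Q (\<sigma> ?y) \<sigma>))) \<sigma>"
        by (rule vsum_cong) simp
      also have "\<dots> = cweight cs' \<sigma> * (cweight cs \<sigma> * Q (gate t (\<sigma> x) (\<sigma> x')) \<sigma>)"
        by (rule gate_sum[OF a1 b(1), of "\<lambda>b \<sigma>. cweight cs' \<sigma> * (cweight cs \<sigma> * Q b \<sigma>)"])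
           (intro dep_mult dep_cweight[OF b(2)] dep_mono[OF dep_cweight[OF a(2)]] dep_mono[OF Q]; simp)
      finally show ?thesis .
    qed
    have 2: "vsum (B + m) (m' + Suc (gm t)) (\<lambda>\<sigma>. cweight (?g @ cs' @ cs) \<sigma> * Q (\<sigma> ?y) \<sigma>) \<sigma>
        = cweight cs \<sigma> * Q (gate t (\<sigma> x) (sat (\<lambda>x. \<sigma> (ix x)) b)) \<sigma>" for \<sigma>
    proof -
      have "vsum (B + m) (m' + Suc (gm t)) (\<lambda>\<sigma>. cweight (?g @ cs' @ cs) \<sigma> * Q (\<sigma> ?y) \<sigma>) \<sigma>
        = vsum (B + m) m' (\<lambda>\<sigma>. cweight cs' \<sigma> * (\<lambda>c \<sigma>. cweight cs \<sigma> * Q (gate t (\<sigma> x) c) \<sigma>) (\<sigma> x') \<sigma>) \<sigma>"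
        unfolding vsum_add by (intro vsum_cong 1)
      also have "\<dots> = (\<lambda>c \<sigma>. cweight cs \<sigma> * Q (gate t (\<sigma> x) c) \<sigma>) (sat (\<lambda>x. \<sigma> (ix x)) b) \<sigma>"
      proof (rule b(3))
        fix c
        show "dep (B + m) (\<lambda>\<sigma>. cweight cs \<sigma> * Q (gate t (\<sigma> x) c) \<sigma>)"
          by (intro dep_mult dep_cweight[OF a(2)] dep_Q[where h = "\<lambda>d _. gate t d c", OF Q a(1) a(1)]) simp
      qed
      finally show ?thesis .
    qed
    have "vsum B (m + m' + Suc (gm t)) (\<lambda>\<sigma>. cweight (?g @ cs' @ cs) \<sigma> * Q (\<sigma> ?y) \<sigma>) \<sigma>
        = vsum B m (\<lambda>\<sigma>. cweight cs \<sigma> * (\<lambda>c \<sigma>. Q (gate t c (sat (\<lambda>x. \<sigma> (ix x)) b)) \<sigma>) (\<sigma> x) \<sigma>) \<sigma>"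
      unfolding add.assoc[of m m' "Suc (gm t)"] vsum_add[of B m] by (intro vsum_cong 2)
    also have "\<dots> = (\<lambda>c \<sigma>. Q (gate t c (sat (\<lambda>x. \<sigma> (ix x)) b)) \<sigma>) (sat (\<lambda>x. \<sigma> (ix x)) a) \<sigma>"
    proof (rule a(3))
      fix c
      \<comment> \<open>Once the variables of \<open>b\<close> are summed out, only its truth value
        is left. It depends on variables below \<open>B\<close>, so it may be part of the context
        for \<open>a\<close>.\<close>
      show "dep B (\<lambda>\<sigma>. Q (gate t c (sat (\<lambda>x. \<sigma> (ix x)) b)) \<sigma>)"
        unfolding dep_def
      proof (intro allI impI)
        fix \<sigma> \<tau> :: "nat \<Rightarrow> bool"
        assume *: "\<forall>i<B. \<sigma> i = \<tau> i"
        have "sat (\<lambda>x. \<sigma> (ix x)) b = sat (\<lambda>x. \<tau> (ix x)) b"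
          by (rule sat_cong) (use * ix in auto)
        then show "Q (gate t c (sat (\<lambda>x. \<sigma> (ix x)) b)) \<sigma> = Q (gate t c (sat (\<lambda>x. \<tau> (ix x)) b)) \<tau>"
          using depD[OF Q, of \<sigma> \<tau>] * by simp
      qed
    qed
    finally show ?thesis by (simp add: \<phi>)
  qed
  then show ?thesis
    using csp_over_gate[OF a1 b(1), of t] csp_over_mono[OF a(2), of "?y + Suc (gm t)"] csp_over_mono[OF b(2), of "?y + Suc (gm t)"]
    by (simp add: compiled_def add.assoc)
qed

lemma compile_correct:
  "(\<And>x. x \<in> vars \<phi> \<Longrightarrow> ix x < B) \<Longrightarrow> compiled ix \<phi> B (compile ix \<phi> B)"
proof (induction \<phi> arbitrary: B)
  case (Prop x)
  then show ?case by (simp add: compiled_def)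
next
  case (Neg a)
  obtain x cs m where 1: "compile ix a B = (x, cs, m)" by (cases "compile ix a B")
  have "compiled ix a B (x, cs, m)"
    using Neg.IH[of B] Neg.prems unfolding 1 by simp
  from compiled_unary[OF this, of "Neg a" 1] show ?case by (simp add: 1 gate_def)
next
  case (Disj a b)
  obtain x cs m where 1: "compile ix a B = (x, cs, m)" by (cases "compile ix a B")
  obtain x' cs' m' where 2: "compile ix b (B + m) = (x', cs', m')" by (cases "compile ix b (B + m)")
  have "compiled ix a B (x, cs, m)" "compiled ix b (B + m) (x', cs', m')"
    using Disj.IH(1)[of B] Disj.IH(2)[of "B + m"] Disj.prems unfolding 1 2 by (simp_all add: trans_less_add1)
  from compiled_binary[OF this, of "Disj a b" 2] Disj.prems show ?case by (simp add: 1 2 gate_def)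
next
  case (Conj a b)
  obtain x cs m where 1: "compile ix a B = (x, cs, m)" by (cases "compile ix a B")
  obtain x' cs' m' where 2: "compile ix b (B + m) = (x', cs', m')" by (cases "compile ix b (B + m)")
  have "compiled ix a B (x, cs, m)" "compiled ix b (B + m) (x', cs', m')"
    using Conj.IH(1)[of B] Conj.IH(2)[of "B + m"] Conj.prems unfolding 1 2 by (simp_all add: trans_less_add1)
  from compiled_binary[OF this, of "Conj a b" 3] Conj.prems show ?case by (simp add: 1 2 gate_def)
qed

end

section \<open>The reduction as a program\<close>

primrec vapp :: "val \<Rightarrow> val \<Rightarrow> val" where
  "vapp (Cell a b) ys = Cell a (vapp b ys)"
| "vapp Null ys = ys"
| "vapp (Num z) ys = ys"

lemma vsize_vapp: "vsize (vapp xs ys) \<le> vsize xs + vsize ys"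
  by (induction xs) auto

lemma vapp_enc: "vapp (enc_list xs) (enc_list ys) = enc_list (xs @ ys)"
  by (induction xs) auto

lemma ptime_vapp: "ptime f \<Longrightarrow> ptime g \<Longrightarrow> ptime (\<lambda>v. vapp (f v) (g v))"
proof (rule ptime_lin[where R = "\<lambda>e v. vapp v e" and leaf = "\<lambda>e v. \<not> isc v"
      and L = "\<lambda>e v. e" and A = "\<lambda>e v. right v" and N = "\<lambda>e v x. Cell (left v) x"
      and \<mu> = vsize and q = "[:0, 1:]"])
  show "vapp v e = (if \<not> isc v then e else Cell (left v) (vapp (right v) e))" for e v
    by (cases v) auto
  show "vsize (vapp v e) \<le> poly [:0, 1:] (vsize e + vsize v)" for e v
    using vsize_vapp[of v e] by simp
qed (intro ptime_rules | force simp: isc_iff)+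

text \<open>Reverse Polish form, which a single fold with a stack can process. Negation is given
  \<open>Null\<close> as a second child, so that the binary scheme of \<open>ptime_rec\<close>
  applies.\<close>

function postorder :: "val \<Rightarrow> val" where
  "postorder v = (if \<not> isc v \<or> num (left v) = 0 then if isc v then Cell v Null else Null
     else vapp (postorder (if num (left v) = 1 then right v else left (right v)))
       (vapp (postorder (if num (left v) = 1 then Null else right (right v))) (Cell (Num (num (left v))) Null)))"
  by pat_completeness auto

lemma postorder_decreasing: "isc v \<Longrightarrow>
    vsize (if num (left v) = 1 then right v else left (right v)) +
    vsize (if num (left v) = 1 then Null else right (right v)) < vsize v"
  using vsize_left_right[of "right v"] vsize_pos[of "left v"] by (cases v) auto

termination postorder
proof (relation "Wellfounded.measure vsize")
  fix v
  assume "\<not> (\<not> isc v \<or> num (left v) = 0)"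
  then have *: "vsize (if num (left v) = 1 then right v else left (right v)) +
    vsize (if num (left v) = 1 then Null else right (right v)) < vsize v"
    using postorder_decreasing by blast
  then show "((if num (left v) = 1 then right v else left (right v)), v) \<in> Wellfounded.measure vsize"
    unfolding in_measure by linarith
  from * show "((if num (left v) = 1 then Null else right (right v)), v) \<in> Wellfounded.measure vsize"
    unfolding in_measure by linarith
qed simp

declare postorder.simps [simp del]

lemma vsize_postorder: "vsize (postorder v) \<le> 3 * vsize v"
proof (induction v rule: postorder.induct)
  case (1 v)
  show ?case
  proof (cases "\<not> isc v \<or> num (left v) = 0")
    case True
    then show ?thesis using vsize_pos[of v] by (subst postorder.simps) auto
  next
    case False
    let ?a = "if num (left v) = 1 then right v else left (right v)"
    let ?b = "if num (left v) = 1 then Null else right (right v)"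
    have "vsize (postorder v) \<le> vsize (postorder ?a) + (vsize (postorder ?b) + 3)"
      using False vsize_vapp[of "postorder ?a" "vapp (postorder ?b) (Cell (Num (num (left v))) Null)"]
        vsize_vapp[of "postorder ?b" "Cell (Num (num (left v))) Null"]
      by (subst postorder.simps) simp
    with 1 False postorder_decreasing[of v] show ?thesis by simp
  qed
qed

lemma ptime_postorder: "ptime f \<Longrightarrow> ptime (\<lambda>v. postorder (f v))"
proof (rule ptime_rec[where R = "\<lambda>e v. postorder v" and leaf = "\<lambda>e v. \<not> isc v \<or> num (left v) = 0"
      and L = "\<lambda>e v. if isc v then Cell v Null else Null"
      and A = "\<lambda>e v. if num (left v) = 1 then right v else left (right v)"
      and B = "\<lambda>e v. if num (left v) = 1 then Null else right (right v)"
      and N = "\<lambda>e v x y. vapp x (vapp y (Cell (Num (num (left v))) Null))" and \<mu> = vsize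
      and q = "[:0, 3:]" and a = "\<lambda>v. Null"])
  show "postorder v = (if \<not> isc v \<or> num (left v) = 0 then if isc v then Cell v Null else Null
     else vapp (postorder (if num (left v) = 1 then right v else left (right v)))
       (vapp (postorder (if num (left v) = 1 then Null else right (right v))) (Cell (Num (num (left v))) Null)))" for v
    by (rule postorder.simps)
  show "vsize (if num (left v) = 1 then right v else left (right v)) +
    vsize (if num (left v) = 1 then Null else right (right v)) < vsize v" if "\<not> (\<not> isc v \<or> num (left v) = 0)" for v
    using that postorder_decreasing by blast
  show "vsize (if num (left v) = 1 then right v else left (right v)) \<le> vsize v"
    "vsize (if num (left v) = 1 then Null else right (right v)) \<le> vsize v" if "\<not> (\<not> isc v \<or> num (left v) = 0)" for v
    using that postorder_decreasing[of v] by linarith+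
  show "vsize (postorder v) \<le> poly [:0, 3:] (vsize e + vsize v)" for e v
    using vsize_postorder[of v] by simp
qed (intro ptime_rules ptime_vapp | force)+

primrec items :: "form \<Rightarrow> val list" where
  "items (Prop x) = [enc_form (Prop x)]"
| "items (Neg a) = items a @ [Num 1]"
| "items (Disj a b) = items a @ items b @ [Num 2]"
| "items (Conj a b) = items a @ items b @ [Num 3]"

lemma postorder_form: "postorder (enc_form \<phi>) = enc_list (items \<phi>)"
proof (induction \<phi>)
  case (Prop x)
  show ?case by (subst postorder.simps) (simp add: enc_nat_def)
next
  case (Neg \<phi>)
  have "Cell (Num 1) Null = enc_list [Num 1]" "postorder Null = enc_list []"
    by simp (subst postorder.simps, simp)
  then show ?case
    by (subst postorder.simps) (simp add: enc_nat_def Neg vapp_enc del: enc_list.simps)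
next
  case (Disj a b)
  have "Cell (Num 2) Null = enc_list [Num 2]" by simp
  then show ?case
    by (subst postorder.simps) (simp add: enc_nat_def Disj vapp_enc del: enc_list.simps)
next
  case (Conj a b)
  have "Cell (Num 3) Null = enc_list [Num 3]" by simp
  then show ?case
    by (subst postorder.simps) (simp add: enc_nat_def Conj vapp_enc del: enc_list.simps)
qed

text \<open>With at most \<open>K\<close> more per step the accumulator grows linearly in the length
  of the list. This fits the steps below, which add gadgets of fixed size.\<close>

lemma ptime_fold_const:
  assumes "ptime (\<lambda>w. G (left w) (left (right w)) (right (right w)))" "ptime l" "ptime a"
    and K: "\<And>v x y acc. vsize (G v (Cell x y) acc) \<le> vsize acc + K"
  shows "ptime (\<lambda>v. vfold (G v) (l v) (a v))"
proof -
  obtain p where p: "\<And>v. vsize (l v) \<le> poly p (vsize v)" using ptime_poly[OF assms(2)] by blast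
  obtain q where q: "\<And>v. vsize (a v) \<le> poly q (vsize v)" using ptime_poly[OF assms(3)] by blast
  show ?thesis
  proof (rule ptime_fold[OF assms(1-3), where I = "\<lambda>v l' acc. vsize acc + K * vlen l' \<le> vsize (a v) + K * vlen (l v)"
        and q = "q + [:K:] * p"])
    fix v l' acc
    assume "vsize acc + K * vlen l' \<le> vsize (a v) + K * vlen (l v)"
    moreover have "K * vlen (l v) \<le> K * poly p (vsize v)"
      using vlen_le[of "l v"] p[of v] by (intro mult_left_mono) simp_all
    moreover have "poly (q + [:K:] * p) (vsize v) = poly q (vsize v) + K * poly p (vsize v)" by simp
    ultimately show "vsize acc \<le> poly (q + [:K:] * p) (vsize v)" using q[of v] by linarith
  next
    fix v x y acc
    assume "vsize acc + K * vlen (Cell x y) \<le> vsize (a v) + K * vlen (l v)"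
    with K[of v x y acc] show "vsize (G v (Cell x y) acc) + K * vlen y \<le> vsize (a v) + K * vlen (l v)"
      by simp
  qed simp
qed

definition vrev :: "val \<Rightarrow> val" where
  "vrev l = vfold (\<lambda>l acc. Cell (left l) acc) l Null"

lemma vrev_enc: "vrev (enc_list xs) = enc_list (rev xs)"
proof -
  have "fold (\<lambda>x acc. Cell x acc) xs (enc_list ys) = enc_list (rev xs @ ys)" for ys
  proof (induction xs arbitrary: ys)
    case (Cons x xs)
    from Cons[of "x # ys"] show ?case by simp
  qed simp
  from this[of "[]"] show ?thesis
    unfolding vrev_def vfold_left[of "\<lambda>x acc. Cell x acc"] by simp
qed

lemma ptime_vrev: "ptime f \<Longrightarrow> ptime (\<lambda>v. vrev (f v))"
proof (erule ptime_comp)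
  show "ptime vrev"
    unfolding vrev_def
  proof (rule ptime_fold[where G = "\<lambda>_ l acc. Cell (left l) acc" and q = "[:1, 2:]"
        and I = "\<lambda>w l acc. vsize acc + vsize l \<le> vsize w + 1"])
  qed (intro ptime_rules | force)+
qed

text \<open>The variables of a formula are arbitrary naturals while those of an instance fill an
  initial segment; they are renumbered by their positions in the list of weights.\<close>

primrec vindex :: "complex \<Rightarrow> val \<Rightarrow> complex \<Rightarrow> complex" where
  "vindex x (Cell a b) i = (if num (left a) = x then i else vindex x b (i + 1))"
| "vindex x Null i = i"
| "vindex x (Num z) i = i"

lemma ptime_num_vindex: "ptime_num f \<Longrightarrow> ptime g \<Longrightarrow> ptime_num (\<lambda>v. vindex (f v) (g v) 0)"
  unfolding ptime_num_def
proof -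
  assume fg: "ptime (\<lambda>v. Num (f v))" "ptime g"
  have "ptime (\<lambda>v. Num (vindex (num (Num (f v))) (left (Cell (g v) (Num 0))) (num (right (Cell (g v) (Num 0))))))"
  proof (rule ptime_lin[where R = "\<lambda>e v. Num (vindex (num e) (left v) (num (right v)))"
        and leaf = "\<lambda>e v. \<not> isc (left v) \<or> num (left (left (left v))) = num e"
        and L = "\<lambda>e v. Num (num (right v))" and A = "\<lambda>e v. Cell (right (left v)) (Num (num (right v) + 1))"
        and N = "\<lambda>e v x. x" and \<mu> = "\<lambda>v. vsize (left v)" and q = 1])
    show "Num (vindex (num e) (left v) (num (right v))) =
      (if \<not> isc (left v) \<or> num (left (left (left v))) = num e then Num (num (right v))
       else Num (vindex (num e) (left (Cell (right (left v)) (Num (num (right v) + 1))))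
         (num (right (Cell (right (left v)) (Num (num (right v) + 1)))))))" for e v
      by (cases "left v") auto
    show "vsize (left v) \<le> vsize v" for v by (rule vsize_left)
    show "vsize (Cell (right (left v)) (Num (num (right v) + 1))) \<le> vsize v"
      if "\<not> (\<not> isc (left v) \<or> num (left (left (left v))) = num e)" for e v
      using that vsize_pos[of "right v"] by (cases v; cases "left v") auto
    show "vsize (left (Cell (right (left v)) (Num (num (right v) + 1)))) < vsize (left v)"
      if "\<not> (\<not> isc (left v) \<or> num (left (left (left v))) = num e)" for e v
      using that by (cases "left v") auto
  qed (intro ptime_rules fg | force simp: isc_iff)+
  then show "ptime (\<lambda>v. Num (vindex (f v) (g v) 0))" by simp
qed

primrec index :: "nat \<Rightarrow> nat list \<Rightarrow> nat" where
  "index x [] = 0"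
| "index x (y # ys) = (if y = x then 0 else Suc (index x ys))"

lemma index_less: "x \<in> set xs \<Longrightarrow> index x xs < length xs"
  by (induction xs) auto

lemma nth_index: "x \<in> set xs \<Longrightarrow> xs ! index x xs = x"
  by (induction xs) auto

lemma index_nth: "distinct xs \<Longrightarrow> i < length xs \<Longrightarrow> index (xs ! i) xs = i"
  by (induction xs arbitrary: i) (auto simp: less_Suc_eq_0_disj)

lemma vindex_enc: "vindex (of_nat x) (enc_list (map (\<lambda>x. Cell (enc_nat x) (g x)) xs)) i = i + of_nat (index x xs)"
  by (induction xs arbitrary: i) (auto simp: enc_nat_def)

section \<open>Writing out gadgets, variables and weights\<close>

text \<open>In a gate, the variables \<open>0\<close> and \<open>1\<close> are the inputs, \<open>2\<close> is the output and the others are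
  auxiliary; output and auxiliary variables get consecutive numbers from \<open>y\<close> on.\<close>

definition vplace :: "complex \<Rightarrow> complex \<Rightarrow> complex \<Rightarrow> nat \<Rightarrow> complex" where
  "vplace x1 x2 y p = (if p = 0 then x1 else if p = 1 then x2 else y + of_nat (p - 2))"

lemma vplace_of_nat: "vplace (of_nat x1) (of_nat x2) (of_nat y) p = of_nat (place x1 x2 y p)"
  by (simp add: vplace_def place_def)

lemma ptime_num_vplace: "ptime_num f \<Longrightarrow> ptime_num g \<Longrightarrow> ptime_num h \<Longrightarrow> ptime_num (\<lambda>v. vplace (f v) (g v) (h v) p)"
proof -
  assume fg: "ptime_num f" "ptime_num g" "ptime_num h"
  show ?thesis
  proof (cases p)
    case 0
    then show ?thesis using fg by (simp add: vplace_def)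
  next
    case (Suc n)
    then show ?thesis
      by (cases n) (simp_all add: vplace_def fg ptime_num_add ptime_num_const)
  qed
qed

definition enc_con :: "constraint \<times> nat list \<Rightarrow> val" where
  "enc_con = (\<lambda>(h, xs). Cell (enc_table (arity h) (app h)) (enc_list (map enc_nat xs)))"

text \<open>The list \<open>cs\<close> is fixed, so this recursion is unrolled into the text of the
  program; only the placement \<open>x1\<close>, \<open>x2\<close>, \<open>y\<close> is known at run
  time. The same holds for the count \<open>n\<close> in \<open>add_vars\<close>.\<close>

primrec emit :: "(constraint \<times> nat list) list \<Rightarrow> complex \<Rightarrow> complex \<Rightarrow> complex \<Rightarrow> val \<Rightarrow> val" where
  "emit [] x1 x2 y out = out"
| "emit (c # cs) x1 x2 y out = Cell (Cell (enc_table (arity (fst c)) (app (fst c)))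
     (enc_list (map (\<lambda>p. Num (vplace x1 x2 y p)) (snd c)))) (emit cs x1 x2 y out)"

lemma emit_of_nat: "emit cs (of_nat x1) (of_nat x2) (of_nat y) (enc_list (map enc_con ds)) =
    enc_list (map enc_con (rename (place x1 x2 y) cs @ ds))"
  by (induction cs) (auto simp: enc_con_def rename_def vplace_of_nat enc_nat_def o_def)

lemma vsize_emit: "\<exists>K. \<forall>x1 x2 y out. vsize (emit cs x1 x2 y out) = vsize out + K"
proof (induction cs)
  case (Cons c cs)
  then obtain K where K: "\<forall>x1 x2 y out. vsize (emit cs x1 x2 y out) = vsize out + K" by blast
  have "vsize (enc_list (map (\<lambda>p. Num (vplace x1 x2 y p)) ps)) = 2 * length ps + 1" for x1 x2 y ps
    by (induction ps) auto
  with K show ?case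
    by (intro exI[of _ "K + (2 * length (snd c) + 1) + vsize (enc_table (arity (fst c)) (app (fst c))) + 2"]) simp
qed simp

lemma ptime_emit: "ptime_num f \<Longrightarrow> ptime_num g \<Longrightarrow> ptime_num h \<Longrightarrow> ptime k \<Longrightarrow> ptime (\<lambda>v. emit cs (f v) (g v) (h v) (k v))"
proof (induction cs)
  case (Cons c cs)
  have "ptime (\<lambda>v. enc_list (map (\<lambda>p. Num (vplace (f v) (g v) (h v) p)) ps))" for ps
    by (induction ps) (simp_all add: ptime_const ptime_Cell ptime_Num ptime_num_vplace Cons.prems)
  with Cons show ?case by (simp add: ptime_const ptime_Cell)
qed simp

primrec add_vars :: "nat \<Rightarrow> complex \<Rightarrow> val \<Rightarrow> val" where
  "add_vars 0 b vs = vs"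
| "add_vars (Suc n) b vs = add_vars n (b + 1) (Cell (Num b) vs)"

lemma vsize_add_vars: "vsize (add_vars n b vs) = vsize vs + 2 * n"
  by (induction n arbitrary: b vs) auto

lemma ptime_add_vars: "ptime_num f \<Longrightarrow> ptime g \<Longrightarrow> ptime (\<lambda>v. add_vars n (f v) (g v))"
proof (induction n arbitrary: f g)
  case (Suc n)
  have "ptime_num (\<lambda>v. f v + 1)" by (intro ptime_num_add ptime_num_const Suc.prems)
  moreover have "ptime (\<lambda>v. Cell (Num (f v)) (g v))" by (intro ptime_Cell ptime_Num Suc.prems)
  ultimately show ?case using Suc.IH by simp
qed simp

text \<open>Reversed, because new variables are put in front; the program reverses the list once at
  the end.\<close>

definition enc_vars :: "nat \<Rightarrow> val" where
  "enc_vars n = enc_list (map enc_nat (rev [0..<n]))"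

lemma enc_vars_Suc: "Cell (Num (of_nat n)) (enc_vars n) = enc_vars (Suc n)"
  by (simp add: enc_vars_def enc_nat_def)

lemma add_vars_enc: "add_vars n (of_nat b) (enc_vars b) = enc_vars (b + n)"
proof (induction n arbitrary: b)
  case (Suc n)
  from Suc[of "Suc b"] show ?case by (simp add: enc_vars_Suc add.commute)
qed simp

definition weight_step :: "val \<Rightarrow> val \<Rightarrow> val" where
  "weight_step a acc = Cell (Num (num (left acc) + 1)) (Cell (Cell (Num (num (left acc))) (left (right acc)))
     (Cell (Cell (Cell (Num (num (left (right a)))) (Num (num (right (right a))))) (Cell (Num (num (left acc))) Null))
       (right (right acc))))"

definition weights :: "val \<Rightarrow> val" where
  "weights l = vfold (\<lambda>l acc. weight_step (left l) acc) l (Cell (Num 0) (Cell Null Null))"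

lemma ptime_weights: "ptime f \<Longrightarrow> ptime (\<lambda>v. weights (f v))"
proof (erule ptime_comp)
  show "ptime weights"
    unfolding weights_def
  proof (rule ptime_fold_const[where G = "\<lambda>_ l acc. weight_step (left l) acc" and K = 20])
    show "vsize (weight_step (left (Cell x y)) acc) \<le> vsize acc + 20" for x y acc
      using vsize_left_right[of acc] vsize_left_right[of "right acc"] vsize_pos[of "left acc"]
      by (simp add: weight_step_def)
  qed (unfold weight_step_def, (intro ptime_rules)+)
qed

definition weight :: "(nat \<Rightarrow> bool \<Rightarrow> complex) \<Rightarrow> nat \<Rightarrow> constraint" where
  "weight w x = (1, \<lambda>b. w x (hd b))"

definition weight_list :: "(nat \<Rightarrow> bool \<Rightarrow> complex) \<Rightarrow> nat list \<Rightarrow> nat \<Rightarrow> (constraint \<times> nat list) list" where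
  "weight_list w xs n = map (\<lambda>i. (weight w (xs ! i), [i])) [0..<n]"

lemma weights_enc: "weights (enc_list (map (\<lambda>x. Cell (enc_nat x) (Cell (Num (w x False)) (Num (w x True)))) xs)) =
    Cell (Num (of_nat (length xs))) (Cell (enc_vars (length xs))
      (enc_list (map enc_con (rev (weight_list w xs (length xs))))))"
proof -
  let ?e = "\<lambda>x. Cell (enc_nat x) (Cell (Num (w x False)) (Num (w x True)))"
  have "fold weight_step (map ?e xs) (Cell (Num 0) (Cell Null Null)) =
    Cell (Num (of_nat (length xs))) (Cell (enc_vars (length xs))
      (enc_list (map enc_con (rev (weight_list w xs (length xs))))))"
  proof (induction xs rule: rev_induct)
    case Nil
    show ?case by (simp add: enc_vars_def weight_list_def)
  next
    case (snoc x xs)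
    have "weight_list w (xs @ [x]) (length xs) = weight_list w xs (length xs)"
      by (simp add: weight_list_def nth_append)
    then have "weight_list w (xs @ [x]) (Suc (length xs)) = weight_list w xs (length xs) @ [(weight w x, [length xs])]"
      by (simp add: weight_list_def)
    with snoc show ?case
      by (simp add: weight_step_def enc_vars_Suc add.commute) (simp add: enc_con_def weight_def enc_nat_def)
  qed
  then show ?thesis
    unfolding weights_def vfold_left[of weight_step] .
qed

lemma csp_over_weight_list: "n \<le> m \<Longrightarrow> csp_over F m (weight_list w xs n)"
  by (auto simp: csp_over_def weight_list_def weight_def unary_def)

lemma cweight_rev: "cweight (rev cs) \<sigma> = cweight cs \<sigma>"
  by (induction cs) (auto simp: mult.commute)

lemma cweight_weight_list: "cweight (weight_list w xs n) \<sigma> = (\<Prod>i<n. w (xs ! i) (\<sigma> i))"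
  by (induction n) (simp_all add: weight_list_def weight_def)

definition enc_state :: "nat \<Rightarrow> nat list \<Rightarrow> (constraint \<times> nat list) list \<Rightarrow> val" where
  "enc_state n stk ds = Cell (Num (of_nat n)) (Cell (enc_list (map enc_nat stk))
     (Cell (enc_vars n) (enc_list (map enc_con ds))))"

context gates
begin

definition gate_step :: "nat \<Rightarrow> complex \<Rightarrow> complex \<Rightarrow> val \<Rightarrow> val \<Rightarrow> val" where
  "gate_step t x1 x2 stk acc = Cell (Num (num (left acc) + (of_nat (Suc (gm t)))))
     (Cell (Cell (Num (num (left acc))) stk)
       (Cell (add_vars (Suc (gm t)) (num (left acc)) (left (right (right acc))))
         (emit (gc t) x1 x2 (num (left acc)) (right (right (right acc))))))"

text \<open>Variables are cells and gate codes are numbers, hence the test \<open>isc a\<close>. The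
  top of the stack is the right operand, so \<open>x2\<close> is passed before
  \<open>x1\<close>.\<close>

definition item_step :: "val \<Rightarrow> val \<Rightarrow> val \<Rightarrow> val" where
  "item_step ws a acc = (let stk = left (right acc); x1 = num (left stk); x2 = num (left (right stk)) in
     if isc a then Cell (Num (num (left acc))) (Cell (Cell (Num (vindex (num (right a)) ws 0)) stk) (right (right acc)))
     else if num a = 1 then gate_step 1 x1 x1 (right stk) acc
     else if num a = 2 then gate_step 2 x2 x1 (right (right stk)) acc
     else gate_step 3 x2 x1 (right (right stk)) acc)"

lemma gate_step_enc: "gate_step t (of_nat x1) (of_nat x2) (enc_list (map enc_nat stk)) (enc_state n stk' ds) =
    enc_state (n + Suc (gm t)) (n # stk) (rename (place x1 x2 n) (gc t) @ ds)"
  unfolding gate_step_def enc_state_def left.simps right.simps num.simps emit_of_nat add_vars_enc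
  by (simp add: enc_nat_def)

text \<open>The stack machine computes \<open>compile\<close>: processing the items of a subformula
  pushes its output variable and leaves the rest of the stack untouched.\<close>

lemma fold_items:
  fixes g :: "nat \<Rightarrow> val" and xs :: "nat list"
  defines "ws \<equiv> enc_list (map (\<lambda>x. Cell (enc_nat x) (g x)) xs)"
  assumes "compile (\<lambda>x. index x xs) \<phi> n = (x, cs, m)"
  shows "fold (item_step ws) (items \<phi>) (enc_state n stk ds) = enc_state (n + m) (x # stk) (cs @ ds)"
  using assms(2)
proof (induction \<phi> arbitrary: n x cs m stk ds)
  case (Prop y)
  then show ?case
    by (simp add: item_step_def enc_state_def ws_def enc_nat_def[of y] vindex_enc)
      (auto simp: enc_nat_def)
next
  case (Neg a)
  obtain x1 cs1 m1 where 1: "compile (\<lambda>x. index x xs) a n = (x1, cs1, m1)"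
    by (cases "compile (\<lambda>x. index x xs) a n")
  have "item_step ws (Num 1) (enc_state (n + m1) (x1 # stk) (cs1 @ ds)) =
      gate_step 1 (of_nat x1) (of_nat x1) (enc_list (map enc_nat stk)) (enc_state (n + m1) (x1 # stk) (cs1 @ ds))"
    by (simp add: item_step_def Let_def enc_state_def enc_nat_def)
  with Neg.IH[OF 1] Neg.prems show ?case
    by (auto simp: 1 gate_step_enc add.assoc)
next
  case (Disj a b)
  obtain x1 cs1 m1 where 1: "compile (\<lambda>x. index x xs) a n = (x1, cs1, m1)"
    by (cases "compile (\<lambda>x. index x xs) a n")
  obtain x2 cs2 m2 where 2: "compile (\<lambda>x. index x xs) b (n + m1) = (x2, cs2, m2)"
    by (cases "compile (\<lambda>x. index x xs) b (n + m1)")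
  have "item_step ws (Num 2) (enc_state (n + m1 + m2) (x2 # x1 # stk) (cs2 @ cs1 @ ds)) =
      gate_step 2 (of_nat x1) (of_nat x2) (enc_list (map enc_nat stk))
        (enc_state (n + m1 + m2) (x2 # x1 # stk) (cs2 @ cs1 @ ds))"
    by (simp add: item_step_def Let_def enc_state_def enc_nat_def)
  with Disj.IH(1)[OF 1] Disj.IH(2)[OF 2] Disj.prems show ?case
    by (auto simp: 1 2 gate_step_enc add.assoc)
next
  case (Conj a b)
  obtain x1 cs1 m1 where 1: "compile (\<lambda>x. index x xs) a n = (x1, cs1, m1)"
    by (cases "compile (\<lambda>x. index x xs) a n")
  obtain x2 cs2 m2 where 2: "compile (\<lambda>x. index x xs) b (n + m1) = (x2, cs2, m2)"
    by (cases "compile (\<lambda>x. index x xs) b (n + m1)")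
  have "item_step ws (Num 3) (enc_state (n + m1 + m2) (x2 # x1 # stk) (cs2 @ cs1 @ ds)) =
      gate_step 3 (of_nat x1) (of_nat x2) (enc_list (map enc_nat stk))
        (enc_state (n + m1 + m2) (x2 # x1 # stk) (cs2 @ cs1 @ ds))"
    by (simp add: item_step_def Let_def enc_state_def enc_nat_def)
  with Conj.IH(1)[OF 1] Conj.IH(2)[OF 2] Conj.prems show ?case
    by (auto simp: 1 2 gate_step_enc add.assoc)
qed

lemma ptime_gate_step: "ptime_num f \<Longrightarrow> ptime_num g \<Longrightarrow> ptime h \<Longrightarrow> ptime k \<Longrightarrow> ptime (\<lambda>v. gate_step t (f v) (g v) (h v) (k v))"
  unfolding gate_step_def by (intro ptime_rules ptime_add_vars ptime_emit)

lemma ptime_item_step: "ptime f \<Longrightarrow> ptime g \<Longrightarrow> ptime h \<Longrightarrow> ptime (\<lambda>v. item_step (f v) (g v) (h v))"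
  unfolding item_step_def Let_def by (intro ptime_rules ptime_num_vindex ptime_gate_step)

lemma vsize_item_step: "\<exists>K. \<forall>ws a acc. vsize (item_step ws a acc) \<le> vsize acc + K"
proof -
  have "\<exists>K. \<forall>x1 x2 stk acc. vsize stk \<le> vsize (left (right acc)) \<longrightarrow>
      vsize (gate_step t x1 x2 stk acc) \<le> vsize acc + K" for t
  proof -
    obtain K where K: "\<forall>x1 x2 y out. vsize (emit (gc t) x1 x2 y out) = vsize out + K"
      using vsize_emit by blast
    have "vsize (gate_step t x1 x2 stk acc) \<le> vsize acc + (K + 2 * Suc (gm t) + 20)"
      if "vsize stk \<le> vsize (left (right acc))" for x1 x2 stk acc
      using that vsize_left_right[of acc] vsize_left_right[of "right acc"] vsize_left_right[of "right (right acc)"]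
        vsize_pos[of "left acc"]
      by (simp add: gate_step_def K vsize_add_vars del: add_vars.simps)
    then show ?thesis by blast
  qed
  then obtain K where K: "\<And>t x1 x2 stk acc. vsize stk \<le> vsize (left (right acc)) \<Longrightarrow>
      vsize (gate_step t x1 x2 stk acc) \<le> vsize acc + K t" by metis
  have "vsize (item_step ws a acc) \<le> vsize acc + (K 1 + K 2 + K 3 + 20)" for ws a acc
  proof -
    let ?stk = "left (right acc)"
    have 1: "vsize (right ?stk) \<le> vsize ?stk" by (rule vsize_right)
    have 2: "vsize (right (right ?stk)) \<le> vsize ?stk" by (meson order_trans vsize_right)
    show ?thesis
      using vsize_left_right[of acc] vsize_left_right[of "right acc"] vsize_pos[of "left acc"]
        K[OF 1, of 1 "num (left ?stk)" "num (left ?stk)"]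
        K[OF 2, of 2 "num (left (right ?stk))" "num (left ?stk)"]
        K[OF 2, of 3 "num (left (right ?stk))" "num (left ?stk)"]
      by (simp add: item_step_def Let_def)
  qed
  then show ?thesis by blast
qed

definition process :: "val \<Rightarrow> val \<Rightarrow> val \<Rightarrow> val" where
  "process ws l acc = vfold (\<lambda>l acc. item_step ws (left l) acc) l acc"

lemma ptime_process_aux: "ptime (\<lambda>w. process (left w) (left (right w)) (right (right w)))"
proof -
  obtain K where K: "\<forall>ws a acc. vsize (item_step ws a acc) \<le> vsize acc + K"
    using vsize_item_step by blast
  show ?thesis
    unfolding process_def
    by (rule ptime_fold_const[where G = "\<lambda>w l acc. item_step (left w) (left l) acc" and K = K])
      (use K in \<open>(intro ptime_rules ptime_item_step | force)+\<close>)
qed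

lemmas ptime_process = ptime3[OF ptime_process_aux]

definition initial :: "val \<Rightarrow> val" where
  "initial w = Cell (left w) (Cell Null (right w))"

text \<open>The table \<open>(0, 1)\<close> added at the end, on the variable left on the stack,
  forces the output of the formula to be true.\<close>

definition translate :: "val \<Rightarrow> val" where
  "translate v = (let s = process (right v) (postorder (left v)) (initial (weights (right v))) in
     Cell (vrev (left (right (right s))))
       (Cell (Cell (Cell (Num 0) (Num 1)) (Cell (left (left (right s))) Null)) (right (right (right s)))))"

lemma ptime_translate: "ptime translate"
  unfolding translate_def Let_def initial_def
  by (intro ptime_rules ptime_process ptime_postorder ptime_weights ptime_vrev)

lemma translate_correct:
  assumes "(v, y) \<in> SAT_C"
  shows "(translate v, y) \<in> CSP_star F"
proof -
  obtain \<phi> w where v: "v = enc_sat (\<phi>, w)" "y = sat_count (\<phi>, w)"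
    using assms unfolding SAT_C_def by auto
  define xs where "xs = sorted_list_of_set (vars \<phi>)"
  have xs: "set xs = vars \<phi>" "distinct xs" by (simp_all add: xs_def finite_vars)
  let ?ix = "\<lambda>x. index x xs"
  let ?L = "length xs"
  let ?ws = "enc_list (map (\<lambda>x. Cell (enc_nat x) (Cell (Num (w x False)) (Num (w x True)))) xs)"
  obtain x cs m where c: "compile ?ix \<phi> ?L = (x, cs, m)" by (cases "compile ?ix \<phi> ?L")
  have "compiled ?ix \<phi> ?L (compile ?ix \<phi> ?L)"
    by (rule compile_correct) (simp add: index_less xs)
  note C = compiledD[OF this[unfolded c]]
  define T :: constraint where "T = (1, \<lambda>b. of_bool (hd b))"
  let ?wl = "weight_list w xs ?L"
  let ?ds = "(T, [x]) # cs @ rev ?wl"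
  let ?I = "(?L + m, ?ds)"
  have init: "initial (weights ?ws) = enc_state ?L [] (rev ?wl)"
    by (simp add: weights_enc initial_def enc_state_def)
  have "process ?ws (postorder (enc_form \<phi>)) (initial (weights ?ws)) = enc_state (?L + m) [x] (cs @ rev ?wl)"
    unfolding process_def postorder_form vfold_left[of "item_step ?ws"] init
    by (rule fold_items[OF c])
  then have tr: "translate v = enc_csp ?I"
    by (simp add: translate_def v(1) enc_sat_def flip: xs_def)
      (simp add: enc_state_def enc_csp_def enc_vars_def vrev_enc rev_map T_def enc_con_def)
  have wl: "csp_over F n (rev ?wl)" if "?L \<le> n" for n
    using csp_over_weight_list[OF that] by (simp add: csp_over_def)
  have wf: "csp_over F (?L + m) ?ds"
    using C(1,2) wl[of "?L + m"] by (simp add: T_def unary_def)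
  then have inst: "?I \<in> csp_instances (F \<union> unary)"
    by (auto simp: csp_instances_def csp_over_def)
  have count: "csp_count ?I = y"
  proof -
    let ?P = "\<lambda>\<sigma>. of_bool (sat (\<lambda>z. \<sigma> (?ix z)) \<phi>) * cweight (rev ?wl) \<sigma>"
    have dP: "dep ?L ?P"
    proof (intro dep_mult dep_cweight[OF wl[OF order_refl]])
      show "dep ?L (\<lambda>\<sigma>. of_bool (sat (\<lambda>z. \<sigma> (?ix z)) \<phi>) :: complex)"
        unfolding dep_def
      proof (intro allI impI)
        fix \<sigma> \<tau> :: "nat \<Rightarrow> bool"
        assume "\<forall>i<?L. \<sigma> i = \<tau> i"
        then have "sat (\<lambda>z. \<sigma> (?ix z)) \<phi> = sat (\<lambda>z. \<tau> (?ix z)) \<phi>"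
          by (intro sat_cong) (simp add: index_less xs)
        then show "of_bool (sat (\<lambda>z. \<sigma> (?ix z)) \<phi>) = (of_bool (sat (\<lambda>z. \<tau> (?ix z)) \<phi>) :: complex)" by simp
      qed
    qed
    have "csp_count ?I = (\<Sum>\<sigma>\<in>{..<?L + m} \<rightarrow>\<^sub>E UNIV. cweight ?ds \<sigma>)"
      by (simp add: csp_count_def cweight_def)
    also have "\<dots> = vsum 0 (?L + m) (cweight ?ds) (\<lambda>_. False)"
      by (rule vsum_sum_PiE[symmetric, OF dep_cweight[OF wf]])
    also have "\<dots> = vsum 0 ?L (vsum ?L m (cweight ?ds)) (\<lambda>_. False)"
      by (simp add: vsum_add)
    also have "\<dots> = vsum 0 ?L ?P (\<lambda>_. False)"
    proof (rule vsum_cong)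
      fix \<tau> :: "nat \<Rightarrow> bool"
      \<comment> \<open>The context \<open>Q\<close> consists of \<open>T\<close> read at the output
        bit and of the weights, which only concern variables below \<open>length xs\<close>.\<close>
      have "vsum ?L m (cweight ?ds) \<tau> = vsum ?L m (\<lambda>\<sigma>. cweight cs \<sigma> * (\<lambda>b \<sigma>. of_bool b * cweight (rev ?wl) \<sigma>) (\<sigma> x) \<sigma>) \<tau>"
        by (rule vsum_cong) (simp add: T_def)
      also have "\<dots> = (\<lambda>b \<sigma>. of_bool b * cweight (rev ?wl) \<sigma>) (sat (\<lambda>z. \<tau> (?ix z)) \<phi>) \<tau>"
        by (rule C(3)) (intro dep_mult dep_cweight[OF wl[OF order_refl]], simp add: dep_def)
      finally show "vsum ?L m (cweight ?ds) \<tau> = ?P \<tau>" .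
    qed
    also have "\<dots> = (\<Sum>\<sigma>\<in>{..<?L} \<rightarrow>\<^sub>E UNIV. ?P \<sigma>)"
      by (rule vsum_sum_PiE[OF dP])
    also have "\<dots> = (\<Sum>\<sigma>\<in>{..<?L} \<rightarrow>\<^sub>E UNIV. if sat (\<lambda>z. \<sigma> (?ix z)) \<phi> then \<Prod>i<?L. w (xs ! i) (\<sigma> i) else 0)"
      by (intro sum.cong refl) (simp add: cweight_rev cweight_weight_list)
    also have "\<dots> = (\<Sum>\<sigma>\<in>{\<sigma> \<in> {..<?L} \<rightarrow>\<^sub>E UNIV. sat (\<lambda>z. \<sigma> (?ix z)) \<phi>}. \<Prod>i<?L. w (xs ! i) (\<sigma> i))"
      by (subst sum.inter_filter[symmetric]) (auto intro: finite_PiE)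
    also have "\<dots> = (\<Sum>\<sigma> | \<sigma> \<in> vars \<phi> \<rightarrow>\<^sub>E UNIV \<and> sat \<sigma> \<phi>. \<Prod>x\<in>vars \<phi>. w x (\<sigma> x))"
    \<comment> \<open>Assignments of positions and assignments of formula variables correspond
      through \<open>xs\<close>, which lists \<open>vars \<phi>\<close> without repetition.\<close>
    proof (rule sum.reindex_bij_witness[where i = "\<lambda>\<sigma>. restrict (\<lambda>i. \<sigma> (xs ! i)) {..<?L}"
          and j = "\<lambda>\<sigma>. restrict (\<lambda>z. \<sigma> (?ix z)) (vars \<phi>)"])
      fix \<sigma>
      assume \<sigma>: "\<sigma> \<in> {\<sigma> \<in> {..<?L} \<rightarrow>\<^sub>E UNIV. sat (\<lambda>z. \<sigma> (?ix z)) \<phi>}"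
      let ?\<tau> = "restrict (\<lambda>z. \<sigma> (?ix z)) (vars \<phi>)"
      show "restrict (\<lambda>i. ?\<tau> (xs ! i)) {..<?L} = \<sigma>"
      proof
        fix i
        show "restrict (\<lambda>i. ?\<tau> (xs ! i)) {..<?L} i = \<sigma> i"
        proof (cases "i < ?L")
          case True
          then have "xs ! i \<in> vars \<phi>" using nth_mem xs(1) by blast
          with True show ?thesis by (simp add: index_nth[OF xs(2)])
        next
          case False
          moreover have "\<sigma> \<in> {..<?L} \<rightarrow>\<^sub>E UNIV" using \<sigma> by blast
          ultimately show ?thesis using PiE_arb[of \<sigma> "{..<?L}" "\<lambda>_. UNIV" i] by simp
        qed
      qed
      have "sat ?\<tau> \<phi> = sat (\<lambda>z. \<sigma> (?ix z)) \<phi>" by (rule sat_cong) simp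
      then show "?\<tau> \<in> {\<sigma>. \<sigma> \<in> vars \<phi> \<rightarrow>\<^sub>E UNIV \<and> sat \<sigma> \<phi>}" using \<sigma> by auto
      have "(\<Prod>x\<in>vars \<phi>. w x (?\<tau> x)) = (\<Prod>i<?L. w (xs ! i) (?\<tau> (xs ! i)))"
        by (rule prod.reindex_bij_betw[symmetric]) (use bij_betw_nth[OF xs(2) refl, of "set xs"] xs in simp)
      also have "\<dots> = (\<Prod>i<?L. w (xs ! i) (\<sigma> i))"
      proof (rule prod.cong[OF refl])
        fix i
        assume "i \<in> {..<?L}"
        then have "i < ?L" "xs ! i \<in> vars \<phi>" using nth_mem xs(1) by auto
        then show "w (xs ! i) (?\<tau> (xs ! i)) = w (xs ! i) (\<sigma> i)" by (simp add: index_nth[OF xs(2)])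
      qed
      finally show "(\<Prod>x\<in>vars \<phi>. w x (?\<tau> x)) = (\<Prod>i<?L. w (xs ! i) (\<sigma> i))" .
    next
      fix \<tau>
      assume \<tau>: "\<tau> \<in> {\<sigma>. \<sigma> \<in> vars \<phi> \<rightarrow>\<^sub>E UNIV \<and> sat \<sigma> \<phi>}"
      let ?\<sigma> = "restrict (\<lambda>i. \<tau> (xs ! i)) {..<?L}"
      have e: "?\<sigma> (?ix z) = \<tau> z" if "z \<in> vars \<phi>" for z
        using that by (simp add: xs index_less nth_index)
      show "restrict (\<lambda>z. ?\<sigma> (?ix z)) (vars \<phi>) = \<tau>"
      proof
        fix z
        show "restrict (\<lambda>z. ?\<sigma> (?ix z)) (vars \<phi>) z = \<tau> z"
        proof (cases "z \<in> vars \<phi>")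
          case True
          then show ?thesis using e[OF True] by (simp only: restrict_apply if_True)
        next
          case False
          moreover have "\<tau> \<in> vars \<phi> \<rightarrow>\<^sub>E UNIV" using \<tau> by blast
          ultimately show ?thesis using PiE_arb[of \<tau> "vars \<phi>" "\<lambda>_. UNIV" z] by simp
        qed
      qed
      have "sat (\<lambda>z. ?\<sigma> (?ix z)) \<phi> = sat \<tau> \<phi>" by (rule sat_cong) (rule e)
      then show "?\<sigma> \<in> {\<sigma> \<in> {..<?L} \<rightarrow>\<^sub>E UNIV. sat (\<lambda>z. \<sigma> (?ix z)) \<phi>}" using \<tau> by auto
    qed
    also have "\<dots> = y" by (simp add: v(2) sat_count_def)
    finally show ?thesis .
  qed
  from imageI[OF inst, of "\<lambda>I. (enc_csp I, csp_count I)"] show ?thesis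
    unfolding CSP_star_def CSP_def tr count .
qed

end

text \<open>The graph of each gate is a ternary function of its inputs and output, so it is
  realizable outside \<open>ED\<close>; choosing one gadget per code instantiates the
  locale.\<close>

lemma SAT_reducible:
  assumes "F \<subseteq> constraints" "\<not> F \<subseteq> ED"
  shows "SAT_C \<le>\<^sub>A\<^sub>P CSP_star F"
proof -
  have "\<forall>t. \<exists>m cs. csp_over F (3 + m) cs \<and>
      (\<forall>\<sigma>. of_bool (\<sigma> 2 = gate t (\<sigma> 0) (\<sigma> 1)) = vsum 3 m (cweight cs) \<sigma>)"
    using realizable_ternary_of_not_ED[OF assms, of "\<lambda>a b c. of_bool (c = gate t a b)" for t]
    unfolding realizable_def by blast
  then obtain gm gc where g: "\<And>t. csp_over F (3 + gm t) (gc t)"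
    "\<And>t \<sigma>. of_bool (\<sigma> 2 = gate t (\<sigma> 0) (\<sigma> 1)) = vsum 3 (gm t) (cweight (gc t)) \<sigma>"
    by metis
  interpret gates F gm gc
    by unfold_locales (simp_all add: g flip: g(2))
  show ?thesis
    by (rule AP_reducible_of_ptime[OF ptime_translate translate_correct])
qed

theorem theorem1p1:
  fixes F :: "constraint set"
  assumes "F \<subseteq> constraints"
  shows "(F \<subseteq> ED \<longrightarrow> CSP_star F \<in> FP_C) \<and>
         (\<not> F \<subseteq> ED \<longrightarrow> SAT_C \<le>\<^sub>A\<^sub>P CSP_star F)"
  using ED_in_FP SAT_reducible[OF assms] by blast

end
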